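(* Let $G$ be a finite solvable group and let $p$ be an odd prime. If at least one of the following holds: (1) $\mathrm{acd}_{\mathbb{Q}_p,p'}(G) < \dfrac{2(p+1)}{p+3}$, (2) $\mathrm{acd}_{\mathbb{Q}_p}(G) < \dfrac{2(p+1)}{p+3}$, then $G$ is $p$-nilpotent.
   Context: $\mathbb{Q}_p$ denotes the cyclotomic field obtained by adjoining to $\mathbb{Q}$ a primitive $p$th root of unity in $\mathbb{C}$ (not the $p$-adic numbers). $\mathrm{Irr}(G)$ denotes the set of irreducible complex characters of the finite group $G$. For a subfield $k$ of $\mathbb{C}$ and a prime $p$, $\mathrm{Irr}_k(G)$ is the set of $\chi\in\mathrm{Irr}(G)$ all of whose values lie in $k$, and $\mathrm{Irr}_{k,p'}(G)$ is the set of $\chi\in\mathrm{Irr}_k(G)$ whose degree $\chi(1)$ is not divisible by $p$. $\mathrm{acd}_k(G)$ and $\mathrm{acd}_{k,p'}(G)$ denote the average of the degrees $\chi(1)$ over $\chi\in\mathrm{Irr}_k(G)$ and over $\chi\in\mathrm{Irr}_{k,p'}(G)$, respectively. $G$ is $p$-nilpotent if it has a normal $p$-complement, i.e. a normal subgroup of order prime to $p$ and of index a power of $p$. *)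

theory Defs
  imports
    "HOL-Algebra.Solvable_Groups"
    "HOL-Algebra.Generated_Fields"
    "HOL-Computational_Algebra.Primes"
    "Jordan_Normal_Form.VS_Connect"
begin

section \<open>Complex matrix representations and characters\<close>

definition mat_trace :: "'a :: comm_monoid_add mat \<Rightarrow> 'a" where
  "mat_trace A = (\<Sum>i<dim_row A. A $$ (i, i))"

definition GL_complex :: "nat \<Rightarrow> complex mat monoid" where
  "GL_complex n = units_of (ring_mat TYPE(complex) n ())"

definition matrix_rep ::
    "('a, 'b) monoid_scheme \<Rightarrow> nat \<Rightarrow> ('a \<Rightarrow> complex mat) \<Rightarrow> bool" where
  "matrix_rep G n \<rho> \<longleftrightarrow> \<rho> \<in> hom G (GL_complex n)"

definition invariant_subspace ::
    "('a, 'b) monoid_scheme \<Rightarrow> nat \<Rightarrow> ('a \<Rightarrow> complex mat) \<Rightarrow> complex vec set \<Rightarrow> bool" where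
  "invariant_subspace G n \<rho> W \<longleftrightarrow>
     VectorSpace.subspace class_ring W (module_vec TYPE(complex) n) \<and>
     (\<forall>g\<in>carrier G. \<forall>w\<in>W. \<rho> g *\<^sub>v w \<in> W)"

definition irreducible_rep ::
    "('a, 'b) monoid_scheme \<Rightarrow> nat \<Rightarrow> ('a \<Rightarrow> complex mat) \<Rightarrow> bool" where
  "irreducible_rep G n \<rho> \<longleftrightarrow> matrix_rep G n \<rho> \<and> n > 0 \<and>
     (\<forall>W. invariant_subspace G n \<rho> W \<longrightarrow> W = {0\<^sub>v n} \<or> W = carrier_vec n)"

text \<open>Characters are made extensional (undefined outside the carrier), so that equality of
  characters is equality of class functions on the carrier of the group.  Otherwise the cardinality
  of a set of characters would depend on irrelevant values.\<close>

definition rep_character ::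
    "('a, 'b) monoid_scheme \<Rightarrow> ('a \<Rightarrow> complex mat) \<Rightarrow> 'a \<Rightarrow> complex" where
  "rep_character G \<rho> = (\<lambda>g\<in>carrier G. mat_trace (\<rho> g))"

definition Irr :: "('a, 'b) monoid_scheme \<Rightarrow> ('a \<Rightarrow> complex) set" where
  "Irr G = {rep_character G \<rho> | \<rho> n. irreducible_rep G n \<rho>}"

text \<open>The degree \<open>\<chi>(1)\<close>, read as a natural number; see \<open>char_degree_rep_character\<close>.\<close>

definition char_degree :: "('a, 'b) monoid_scheme \<Rightarrow> ('a \<Rightarrow> complex) \<Rightarrow> nat" where
  "char_degree G \<chi> = (THE d. \<chi> \<one>\<^bsub>G\<^esub> = of_nat d)"

lemma char_degree_rep_character:
  assumes "group G" and "matrix_rep G n \<rho>"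
  shows "rep_character G \<rho> \<one>\<^bsub>G\<^esub> = of_nat n"
    and "char_degree G (rep_character G \<rho>) = n"
proof -
  interpret G: group G by fact
  interpret R: semiring "ring_mat TYPE(complex) n ()" by (rule semiring_mat)
  have "group (GL_complex n)"
    unfolding GL_complex_def by (rule R.units_group)
  then interpret \<rho>: group_hom G "GL_complex n" \<rho>
    using assms by (auto simp: group_hom_def group_hom_axioms_def matrix_rep_def)
  have "\<rho> \<one>\<^bsub>G\<^esub> = 1\<^sub>m n"
    using \<rho>.hom_one by (simp add: GL_complex_def units_of_one ring_mat_simps)
  then show *: "rep_character G \<rho> \<one>\<^bsub>G\<^esub> = of_nat n"
    by (simp add: rep_character_def mat_trace_def)
  show "char_degree G (rep_character G \<rho>) = n"
    unfolding char_degree_def * by auto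
qed

section \<open>Average character degrees over a field of values\<close>

text \<open>A subfield \<open>k\<close> of the complex numbers is represented by its set of elements.\<close>

definition Irr_over :: "complex set \<Rightarrow> ('a, 'b) monoid_scheme \<Rightarrow> ('a \<Rightarrow> complex) set" where
  "Irr_over k G = {\<chi> \<in> Irr G. \<forall>g\<in>carrier G. \<chi> g \<in> k}"

definition Irr_over_p' ::
    "complex set \<Rightarrow> nat \<Rightarrow> ('a, 'b) monoid_scheme \<Rightarrow> ('a \<Rightarrow> complex) set" where
  "Irr_over_p' k p G = {\<chi> \<in> Irr_over k G. \<not> p dvd char_degree G \<chi>}"

definition average_degree :: "('a, 'b) monoid_scheme \<Rightarrow> ('a \<Rightarrow> complex) set \<Rightarrow> real" where
  "average_degree G X = (\<Sum>\<chi>\<in>X. real (char_degree G \<chi>)) / real (card X)"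

definition acd_over :: "complex set \<Rightarrow> ('a, 'b) monoid_scheme \<Rightarrow> real" where
  "acd_over k G = average_degree G (Irr_over k G)"

definition acd_over_p' :: "complex set \<Rightarrow> nat \<Rightarrow> ('a, 'b) monoid_scheme \<Rightarrow> real" where
  "acd_over_p' k p G = average_degree G (Irr_over_p' k p G)"

text \<open>The subfield of the complex numbers generated by \<open>exp (2 \<pi> i / m)\<close>; it contains the
  rationals, being generated as a field, and every primitive \<open>m\<close>th root of unity generates the
  same field.\<close>

definition cyclotomic_field :: "nat \<Rightarrow> complex set" where
  "cyclotomic_field m = generate_field class_ring {cis (2 * pi / real m)}"

section \<open>Normal complements\<close>

definition p_nilpotent :: "nat \<Rightarrow> ('a, 'b) monoid_scheme \<Rightarrow> bool" where
  "p_nilpotent p G \<longleftrightarrow>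
     (\<exists>N. N \<lhd> G \<and> coprime p (card N) \<and> (\<exists>k. card (rcosets\<^bsub>G\<^esub> N) = p ^ k))"

end

theory Submission
  imports
    Defs
    "HOL-Algebra.Group_Action"
    "HOL-Algebra.Left_Coset"
    "HOL-Algebra.Sylow"
    "HOL-Number_Theory.Cong"
    "Jordan_Normal_Form.Schur_Decomposition"
begin

text \<open>Put \<open>w(d) = (p + 3) d - 2 (p + 1)\<close>; the only negative value at a positive degree is
  \<open>w(1) = -(p - 1)\<close>, so it suffices to find enough nonlinear characters of degree prime to \<open>p\<close>.
  Let \<open>R\<close> be normal and maximal such that \<open>G/R\<close> is not \<open>p\<close>-nilpotent. A minimal normal subgroup
  \<open>N/R\<close> of \<open>G/R\<close> is then a noncentral elementary abelian \<open>p\<close>-group, and a Frattini argument gives it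
  a complement \<open>L/R\<close>. An orbit \<open>A\<close> of characters of \<open>N/R\<close> carries a monomial representation of
  degree \<open>t = |A|\<close> with values in the \<open>p\<close>th cyclotomic field, and tensoring with the \<open>b\<close> linear
  characters of \<open>G\<close> over this field gives at least \<open>b / t\<close> irreducible characters. A Sylow
  \<open>p\<close>-subgroup fixes at least \<open>p - 1\<close> nontrivial characters of \<open>N/R\<close>, whose orbits have sizes \<open>t > 1\<close>
  prime to \<open>p\<close>. If some \<open>t \<ge> (p + 1) / 2\<close> then \<open>w(t) / t \<ge> p - 1\<close>; otherwise
  \<open>w(t) / t \<ge> t\<close> for all these orbits, and the sizes \<open>t\<close> sum to at least \<open>p - 1\<close>.
  In both cases the total weight \<open>b w(t) / t\<close> compensates the linear characters.\<close>

section \<open>Matrix representations\<close>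

text \<open>The bound is attained by the dihedral group of order \<open>2 p\<close>: two linear
  characters and (p - 1) / 2 characters of degree 2, all with values in the field. The weight
  \<open>w\<close> is scaled so that its sum over a nonempty finite set of characters is negative
  exactly when their average degree is below the bound. The obstacle is that linear characters of
  \<open>G\<close> need not be trivial on \<open>R\<close>, so averages of \<open>G/R\<close> do not
  control those of \<open>G\<close>: every orbit has to yield nonlinear characters in proportion to
  the number \<open>b\<close> of all linear characters of \<open>G\<close>. Tensoring achieves this.
  Two linear characters with the same product agree on the stabilizer of a member of the orbit, so
  their quotient is trivial on a subgroup of index \<open>t\<close>, and at most \<open>t\<close>
  linear characters share one product. The complement \<open>L/R\<close> serves to extend a
  character of \<open>N/R\<close> to its stabilizer with values that are still \<open>p\<close>th
  roots of unity; the induced representation is then explicit and stays inside the field. Only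
  orthogonality of linear characters is used: irreducibility comes from the diagonal action of
  \<open>N\<close>, distinctness from sums over cosets of \<open>N\<close>.\<close>

lemma matrix_repI:
  fixes G (structure)
  assumes "group G"
    and "\<And>g. g \<in> carrier G \<Longrightarrow> \<rho> g \<in> carrier_mat n n"
    and "\<rho> \<one>\<^bsub>G\<^esub> = 1\<^sub>m n"
    and "\<And>g h. g \<in> carrier G \<Longrightarrow> h \<in> carrier G \<Longrightarrow> \<rho> (g \<otimes>\<^bsub>G\<^esub> h) = \<rho> g * \<rho> h"
  shows "matrix_rep G n \<rho>"
proof -
  interpret group G by fact
  have "\<rho> g \<in> Units (ring_mat TYPE(complex) n ())" if g: "g \<in> carrier G" for g
  proof -
    have "\<rho> (inv g) * \<rho> g = 1\<^sub>m n" "\<rho> g * \<rho> (inv g) = 1\<^sub>m n"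
      using assms(3) assms(4)[of "inv g" g] assms(4)[of g "inv g"] g by simp_all
    then show ?thesis
      using assms(2) g by (auto simp: Units_def ring_mat_simps)
  qed
  then show ?thesis
    by (auto simp: matrix_rep_def GL_complex_def hom_def units_of_def ring_mat_simps assms)
qed

lemma matrix_repD:
  assumes "group G" and "matrix_rep G n \<rho>"
  shows "\<And>g. g \<in> carrier G \<Longrightarrow> \<rho> g \<in> carrier_mat n n"
    and "\<rho> \<one>\<^bsub>G\<^esub> = 1\<^sub>m n"
    and "\<And>g h. g \<in> carrier G \<Longrightarrow> h \<in> carrier G \<Longrightarrow> \<rho> (g \<otimes>\<^bsub>G\<^esub> h) = \<rho> g * \<rho> h"
proof -
  interpret G: group G by fact
  interpret R: semiring "ring_mat TYPE(complex) n ()" by (rule semiring_mat)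
  have "group (GL_complex n)"
    unfolding GL_complex_def by (rule R.units_group)
  then interpret \<rho>: group_hom G "GL_complex n" \<rho>
    using assms by (auto simp: group_hom_def group_hom_axioms_def matrix_rep_def)
  show "\<rho> g \<in> carrier_mat n n" if "g \<in> carrier G" for g
    using \<rho>.hom_closed[OF that] by (auto simp: GL_complex_def units_of_def Units_def ring_mat_simps)
  show "\<rho> \<one>\<^bsub>G\<^esub> = 1\<^sub>m n"
    using \<rho>.hom_one by (simp add: GL_complex_def units_of_one ring_mat_simps)
  show "\<rho> (g \<otimes>\<^bsub>G\<^esub> h) = \<rho> g * \<rho> h" if "g \<in> carrier G" "h \<in> carrier G" for g h
    using \<rho>.hom_mult[OF that] by (simp add: GL_complex_def units_of_mult ring_mat_simps)
qed

lemma subspace_vec_iff: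
  "VectorSpace.subspace class_ring W (module_vec TYPE(complex) n) \<longleftrightarrow>
     W \<subseteq> carrier_vec n \<and> 0\<^sub>v n \<in> W \<and> (\<forall>v\<in>W. \<forall>w\<in>W. v + w \<in> W) \<and> (\<forall>c. \<forall>v\<in>W. c \<cdot>\<^sub>v v \<in> W)"
  using vec_vs[where ?'a = complex, of n] vec_module[where ?'a = complex, of n]
  by (auto simp: VectorSpace.subspace_def submodule_def module_vec_simps)

lemma mat_pow_rep:
  assumes G: "group G" and \<rho>: "matrix_rep G n \<rho>" and g: "g \<in> carrier G"
  shows "\<rho> (g [^]\<^bsub>G\<^esub> (i::nat)) = \<rho> g ^\<^sub>m i"
proof -
  interpret group G by fact
  show ?thesis
    using matrix_repD(1)[OF G \<rho> g]
    by (induction i) (simp_all add: matrix_repD(2,3)[OF G \<rho>] g)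
qed

lemma mat_trace_comm:
  fixes A B :: "'a :: comm_semiring_0 mat"
  assumes "A \<in> carrier_mat n m" "B \<in> carrier_mat m n"
  shows "mat_trace (A * B) = mat_trace (B * A)"
proof -
  have "mat_trace (A * B) = (\<Sum>i<n. \<Sum>j<m. A $$ (i,j) * B $$ (j,i))"
    using assms by (auto simp: mat_trace_def scalar_prod_def atLeast0LessThan intro!: sum.cong)
  also have "\<dots> = (\<Sum>j<m. \<Sum>i<n. B $$ (j,i) * A $$ (i,j))"
    by (subst sum.swap) (simp add: mult.commute)
  also have "\<dots> = mat_trace (B * A)"
    using assms by (auto simp: mat_trace_def scalar_prod_def atLeast0LessThan intro!: sum.cong)
  finally show ?thesis .
qed

section \<open>Finiteness of the set of irreducible characters\<close>

text \<open>A Schur form has the same trace and carries the eigenvalues on its diagonal; applying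
  \<open>A ^\<^sub>m k\<close> to an eigenvector shows that each of them is a \<open>k\<close>th
  root of unity.\<close>

lemma mat_trace_finite_order:
  fixes A :: "complex mat"
  assumes A: "A \<in> carrier_mat n n" and k: "A ^\<^sub>m k = 1\<^sub>m n"
  shows "\<exists>f. (\<forall>i<n. f i ^ k = 1) \<and> mat_trace A = (\<Sum>i<n. f i)"
proof -
  obtain as where as: "char_poly A = (\<Prod>a\<leftarrow>as. [:- a, 1:])"
    using char_poly_factorized[OF A] by blast
  obtain B where B: "B \<in> carrier_mat n n" "upper_triangular B" "similar_mat A B"
    using schur_decomposition_exists[OF A as] by blast
  obtain P Q where PQ: "similar_mat_wit A B P Q"
    using B(3) by (auto simp: similar_mat_def)
  note w = similar_mat_witD2[OF A PQ]
  have "mat_trace A = mat_trace (P * (B * Q))"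
    using w by (simp add: assoc_mult_mat[of P n n B n Q n])
  also have "\<dots> = mat_trace ((B * Q) * P)"
    using w by (intro mat_trace_comm[of _ n n]) auto
  also have "(B * Q) * P = B"
    using w by (simp add: assoc_mult_mat[of B n n Q n P n])
  finally have tr: "mat_trace A = (\<Sum>i<n. B $$ (i,i))"
    using B(1) by (simp add: mat_trace_def)
  have "B $$ (i,i) ^ k = 1" if i: "i < n" for i
  proof -
    have "char_poly A = (\<Prod>a\<leftarrow>diag_mat B. [:- a, 1:])"
      using char_poly_similar[OF B(3)] char_poly_upper_triangular[OF B(1,2)] by simp
    moreover have "B $$ (i,i) \<in> set (diag_mat B)"
      using B(1) i by (auto simp: diag_mat_def)
    ultimately have "poly (char_poly A) (B $$ (i,i)) = 0"
      by (auto simp: poly_prod_list prod_list_zero_iff)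
    then obtain v where v: "eigenvector A v (B $$ (i,i))"
      using eigenvalue_root_char_poly[OF A] by (auto simp: eigenvalue_def)
    then have vn: "v \<in> carrier_vec n" "v \<noteq> 0\<^sub>v n"
      using A by (auto simp: eigenvector_def)
    have eq: "v = B $$ (i,i) ^ k \<cdot>\<^sub>v v"
      using eigenvector_pow[OF A v, of k] vn by (simp add: k)
    obtain j where j: "j < n" "v $ j \<noteq> 0"
      using vn by (metis eq_vecI carrier_vecD index_zero_vec)
    have "v $ j = B $$ (i,i) ^ k * v $ j"
      using arg_cong[OF eq, of "\<lambda>u. u $ j"] vn j by simp
    then show ?thesis using j by simp
  qed
  then show ?thesis using tr by (intro exI[of _ "\<lambda>i. B $$ (i,i)"]) auto
qed

text \<open>Padding \<open>A\<close> with zero rows to a square matrix does not change its kernel,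
  and expansion along the zero row \<open>m\<close> shows that the determinant vanishes.\<close>

lemma exists_vec_kernel:
  fixes A :: "complex mat"
  assumes A: "A \<in> carrier_mat m n" and "m < n"
  shows "\<exists>v \<in> carrier_vec n. v \<noteq> 0\<^sub>v n \<and> A *\<^sub>v v = 0\<^sub>v m"
proof -
  define B where "B = mat n n (\<lambda>(i,j). if i < m then A $$ (i,j) else 0)"
  have B: "B \<in> carrier_mat n n" by (simp add: B_def)
  have "det B = (\<Sum>j<n. B $$ (m,j) * cofactor B m j)"
    using laplace_expansion_row[OF B] \<open>m < n\<close> by blast
  also have "\<dots> = 0" using \<open>m < n\<close> by (simp add: B_def)
  finally obtain v where v: "v \<in> carrier_vec n" "v \<noteq> 0\<^sub>v n" "B *\<^sub>v v = 0\<^sub>v n"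
    using det_0_iff_vec_prod_zero_field[OF B] by blast
  have "A *\<^sub>v v = 0\<^sub>v m"
  proof (rule eq_vecI)
    fix i assume "i < dim_vec (0\<^sub>v m :: complex vec)"
    then have i: "i < m" by simp
    have "row A i = row B i"
      using A i \<open>m < n\<close> by (auto simp: B_def)
    moreover have "(B *\<^sub>v v) $ i = 0" using v(3) i \<open>m < n\<close> by simp
    ultimately show "(A *\<^sub>v v) $ i = 0\<^sub>v m $ i"
      using A B i \<open>m < n\<close> by simp
  qed (use A in simp)
  then show ?thesis using v by blast
qed

text \<open>The orbit of one vector \<open>u\<close> has at most |G| elements, so in a larger space
  some nonzero \<open>v\<close> is orthogonal to all of it. The vectors whose whole orbit is
  orthogonal to \<open>v\<close> form an invariant subspace containing \<open>u\<close>; by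
  irreducibility it is everything, which forces \<open>v\<close> to be zero.\<close>

lemma irreducible_rep_degree_le:
  fixes G (structure)
  assumes G: "group G" and fin: "finite (carrier G)" and irr: "irreducible_rep G n \<rho>"
  shows "n \<le> card (carrier G)"
proof (rule ccontr)
  interpret group G by fact
  define m where "m = card (carrier G)"
  assume "\<not> n \<le> card (carrier G)"
  then have mn: "m < n" by (simp add: m_def)
  have \<rho>: "matrix_rep G n \<rho>" and n: "n > 0"
    using irr by (auto simp: irreducible_rep_def)
  note R = matrix_repD[OF G \<rho>]
  obtain e where e: "bij_betw e {..<m} (carrier G)"
    using ex_bij_betw_nat_finite[OF fin] by (auto simp: m_def atLeast0LessThan)
  have ec: "e i \<in> carrier G" if "i < m" for i using e that by (auto simp: bij_betw_def)
  define u :: "complex vec" where "u = unit_vec n 0"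
  have u: "u \<in> carrier_vec n" by (simp add: u_def)
  \<comment> \<open>The rows of \<open>A\<close> are the translates of \<open>u\<close>, so a kernel
    vector of \<open>A\<close> is orthogonal to the orbit of \<open>u\<close>. The pairing is
    bilinear, without conjugation.\<close>
  define A where "A = mat m n (\<lambda>(i,j). (\<rho> (e i) *\<^sub>v u) $ j)"
  have A: "A \<in> carrier_mat m n" by (simp add: A_def)
  obtain v where v: "v \<in> carrier_vec n" "v \<noteq> 0\<^sub>v n" "A *\<^sub>v v = 0\<^sub>v m"
    using exists_vec_kernel[OF A mn] by blast
  define W where "W = {w \<in> carrier_vec n. \<forall>g\<in>carrier G. v \<bullet> (\<rho> g *\<^sub>v w) = 0}"
  have "invariant_subspace G n \<rho> W"
    unfolding invariant_subspace_def subspace_vec_iff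
  proof (intro conjI ballI allI)
    fix x y c assume "x \<in> W" "y \<in> W"
    moreover have "v \<bullet> (\<rho> g *\<^sub>v x + \<rho> g *\<^sub>v y) = v \<bullet> (\<rho> g *\<^sub>v x) + v \<bullet> (\<rho> g *\<^sub>v y)"
      if "g \<in> carrier G" "x \<in> carrier_vec n" "y \<in> carrier_vec n" for g x y
      using v(1) R(1)[OF that(1)] that by (intro scalar_prod_add_distrib[of _ n]) auto
    ultimately show "x + y \<in> W" 
      using v R(1) unfolding W_def by (auto simp: mult_add_distrib_mat_vec[of _ n n])
  next
    fix c x assume "x \<in> W"
    moreover have "v \<bullet> (c \<cdot>\<^sub>v (\<rho> g *\<^sub>v x)) = c * (v \<bullet> (\<rho> g *\<^sub>v x))"
      if "g \<in> carrier G" "x \<in> carrier_vec n" for g x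
      using v(1) R(1)[OF that(1)] that by (intro scalar_prod_smult_distrib[of _ n]) auto
    ultimately show "c \<cdot>\<^sub>v x \<in> W"
      using v R(1) unfolding W_def by (auto simp: mult_mat_vec[of _ n n])
  next
    fix g w assume g: "g \<in> carrier G" and w: "w \<in> W"
    have "v \<bullet> (\<rho> h *\<^sub>v (\<rho> g *\<^sub>v w)) = 0" if h: "h \<in> carrier G" for h
    proof -
      have "\<rho> h *\<^sub>v (\<rho> g *\<^sub>v w) = \<rho> (h \<otimes> g) *\<^sub>v w"
        using g h w R(1) by (simp add: R(3) W_def assoc_mult_mat_vec[of _ n n _ n])
      then show ?thesis using g h w by (simp add: W_def)
    qed
    then show "\<rho> g *\<^sub>v w \<in> W" using R(1)[OF g] w by (auto simp: W_def)
  next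
    have "\<rho> g *\<^sub>v 0\<^sub>v n = 0\<^sub>v n" if "g \<in> carrier G" for g
      using R(1)[OF that] by (intro eq_vecI) auto
    then show "0\<^sub>v n \<in> W" using v(1) by (simp add: W_def)
  qed (auto simp: W_def)
  then have W: "W = {0\<^sub>v n} \<or> W = carrier_vec n"
    using irr by (auto simp: irreducible_rep_def)
  have "u \<in> W"
  proof -
    have "v \<bullet> (\<rho> g *\<^sub>v u) = 0" if g: "g \<in> carrier G" for g
    proof -
      have "g \<in> e ` {..<m}" using e g by (simp add: bij_betw_def)
      then obtain i where i: "i < m" "e i = g" by auto
      have "row A i = \<rho> g *\<^sub>v u"
        using i R(1)[OF g] u by (auto simp: A_def)
      then have "(\<rho> g *\<^sub>v u) \<bullet> v = 0"
        using arg_cong[OF v(3), of "\<lambda>x. x $ i"] i A by simp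
      then show ?thesis
        using v(1) R(1)[OF g] u by (metis comm_scalar_prod mult_mat_vec_carrier)
    qed
    then show ?thesis using u by (simp add: W_def)
  qed
  moreover have "u \<noteq> 0\<^sub>v n" 
  proof
    assume "u = 0\<^sub>v n"
    then have "u $ 0 = 0" using n by simp
    then show False using n by (simp add: u_def)
  qed
  ultimately have Wc: "W = carrier_vec n" using W by auto
  obtain j where j: "j < n" "v $ j \<noteq> 0"
    using v by (metis eq_vecI carrier_vecD index_zero_vec)
  have "unit_vec n j \<in> W" using Wc by simp
  then have "v \<bullet> (\<rho> \<one> *\<^sub>v unit_vec n j) = 0" by (auto simp: W_def)
  then show False using j v(1) by (simp add: R(2))
qed

text \<open>Degrees are at most |G| and values are sums of roots of unity of order dividing |G|, so
  all values lie in one finite set \<open>T\<close>; extensionality of characters then leaves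
  finitely many functions. Finiteness gives the cardinality and the sum in
  \<open>average_degree\<close> their intended meaning.\<close>

lemma finite_Irr:
  fixes G (structure)
  assumes G: "group G" and fin: "finite (carrier G)"
  shows "finite (Irr G)"
proof -
  interpret group G by fact
  define k where "k = card (carrier G)"
  have k: "k > 0" using fin by (auto simp: k_def card_gt_0_iff)
  define Z where "Z = {z::complex. z ^ k = 1}"
  have Z: "finite Z" using finite_roots_unity[of k] k by (simp add: Z_def)
  define T where "T = (\<Union>n\<le>k. (\<lambda>f. \<Sum>i<n. f i) ` ({..<n} \<rightarrow>\<^sub>E Z))"
  have T: "finite T" unfolding T_def using Z by (intro finite_UN_I finite_imageI finite_PiE) auto
  have "Irr G \<subseteq> carrier G \<rightarrow>\<^sub>E T"
  proof
    fix \<chi> assume "\<chi> \<in> Irr G"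
    then obtain \<rho> n where \<chi>: "\<chi> = rep_character G \<rho>" and irr: "irreducible_rep G n \<rho>"
      by (auto simp: Irr_def)
    have \<rho>: "matrix_rep G n \<rho>" using irr by (auto simp: irreducible_rep_def)
    have nk: "n \<le> k" using irreducible_rep_degree_le[OF G fin irr] by (simp add: k_def)
    have "mat_trace (\<rho> g) \<in> T" if g: "g \<in> carrier G" for g
    proof -
      have "\<rho> g ^\<^sub>m k = 1\<^sub>m n"
        using mat_pow_rep[OF G \<rho> g, of k] pow_order_eq_1[OF g] matrix_repD(2)[OF G \<rho>]
        by (simp add: k_def Coset.order_def)
      from mat_trace_finite_order[OF matrix_repD(1)[OF G \<rho> g] this]
      obtain f where f: "\<forall>i<n. f i ^ k = 1" "mat_trace (\<rho> g) = (\<Sum>i<n. f i)" by blast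
      have "restrict f {..<n} \<in> {..<n} \<rightarrow>\<^sub>E Z" using f(1) by (auto simp: Z_def)
      moreover have "mat_trace (\<rho> g) = (\<Sum>i<n. restrict f {..<n} i)" using f(2) by simp
      ultimately show ?thesis using nk unfolding T_def by blast
    qed
    then show "\<chi> \<in> carrier G \<rightarrow>\<^sub>E T"
      by (auto simp: \<chi> rep_character_def)
  qed
  then show ?thesis using finite_PiE[OF fin, of "\<lambda>_. T"] T finite_subset by blast
qed

section \<open>Linear characters\<close>

text \<open>Linear characters are taken as extensional multiplicative functions, not as 1 by 1
  representations, so that products and inverses can be formed pointwise;
  \<open>degree_one_Irr\<close> is the bridge to \<open>Irr\<close>.\<close>

definition lin_chars :: "('a, 'b) monoid_scheme \<Rightarrow> ('a \<Rightarrow> complex) set" where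
  "lin_chars G = {\<beta> \<in> carrier G \<rightarrow>\<^sub>E - {0}.
     \<forall>g\<in>carrier G. \<forall>h\<in>carrier G. \<beta> (g \<otimes>\<^bsub>G\<^esub> h) = \<beta> g * \<beta> h}"

lemma lin_charsI:
  assumes "\<beta> \<in> extensional (carrier G)"
    and "\<And>g. g \<in> carrier G \<Longrightarrow> \<beta> g \<noteq> 0"
    and "\<And>g h. g \<in> carrier G \<Longrightarrow> h \<in> carrier G \<Longrightarrow> \<beta> (g \<otimes>\<^bsub>G\<^esub> h) = \<beta> g * \<beta> h"
  shows "\<beta> \<in> lin_chars G"
  using assms by (auto simp: lin_chars_def PiE_def)

lemma lin_charsD:
  assumes "\<beta> \<in> lin_chars G"
  shows "\<beta> \<in> extensional (carrier G)"
    and "\<And>g. g \<in> carrier G \<Longrightarrow> \<beta> g \<noteq> 0"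
    and "\<And>g h. g \<in> carrier G \<Longrightarrow> h \<in> carrier G \<Longrightarrow> \<beta> (g \<otimes>\<^bsub>G\<^esub> h) = \<beta> g * \<beta> h"
  using assms by (auto simp: lin_chars_def PiE_def)

lemma lin_chars_eqI:
  assumes "\<beta> \<in> lin_chars G" "\<gamma> \<in> lin_chars G" "\<And>g. g \<in> carrier G \<Longrightarrow> \<beta> g = \<gamma> g"
  shows "\<beta> = \<gamma>"
  using assms lin_charsD(1) by (blast intro: extensionalityI)

lemma lin_chars_mult:
  assumes "monoid G" "\<beta> \<in> lin_chars G" "\<gamma> \<in> lin_chars G"
  shows "(\<lambda>g\<in>carrier G. \<beta> g * \<gamma> g) \<in> lin_chars G"
proof -
  interpret monoid G by fact
  show ?thesis using lin_charsD[OF assms(2)] lin_charsD[OF assms(3)]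
    by (intro lin_charsI) auto
qed

lemma lin_chars_inverse:
  assumes "monoid G" "\<beta> \<in> lin_chars G"
  shows "(\<lambda>g\<in>carrier G. inverse (\<beta> g)) \<in> lin_chars G"
proof -
  interpret monoid G by fact
  show ?thesis using lin_charsD[OF assms(2)] by (intro lin_charsI) auto
qed

lemma lin_chars_trivial: "monoid G \<Longrightarrow> (\<lambda>g\<in>carrier G. 1) \<in> lin_chars G"
  by (intro lin_charsI) (auto simp: monoid.m_closed)

context group
begin

lemma lin_char_one: "\<beta> \<in> lin_chars G \<Longrightarrow> \<beta> \<one> = 1"
  using lin_charsD(2,3)[of \<beta> G \<one>] lin_charsD(3)[of \<beta> G \<one> \<one>] by simp

lemma lin_char_inv:
  assumes "\<beta> \<in> lin_chars G" "g \<in> carrier G"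
  shows "\<beta> (inv g) = inverse (\<beta> g)"
proof -
  have "\<beta> (inv g) * \<beta> g = 1"
    using lin_charsD(3)[OF assms(1), of "inv g" g] lin_char_one[OF assms(1)] assms(2) by simp
  then show ?thesis by (metis inverse_unique mult.commute)
qed

lemma lin_char_pow:
  assumes "\<beta> \<in> lin_chars G" "g \<in> carrier G"
  shows "\<beta> (g [^] (k::nat)) = \<beta> g ^ k"
  by (induction k) (simp_all add: lin_char_one lin_charsD(3) assms)

lemma lin_char_conj:
  assumes "\<beta> \<in> lin_chars G" "g \<in> carrier G" "h \<in> carrier G"
  shows "\<beta> (g \<otimes> h \<otimes> inv g) = \<beta> h" "\<beta> (inv g \<otimes> h \<otimes> g) = \<beta> h"
  using assms lin_charsD(2)[OF assms(1,2)] by (simp_all add: lin_charsD(3)[OF assms(1)] lin_char_inv)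

lemma finite_lin_chars:
  assumes fin: "finite (carrier G)"
  shows "finite (lin_chars G)"
proof -
  define k where "k = Coset.order G"
  have k: "k > 0" using fin by (auto simp: k_def Coset.order_def card_gt_0_iff)
  have "\<beta> g ^ k = 1" if "\<beta> \<in> lin_chars G" "g \<in> carrier G" for \<beta> g
    using lin_char_pow[OF that, of k] lin_char_one[OF that(1)] pow_order_eq_1[OF that(2)]
    by (simp add: k_def)
  then have "lin_chars G \<subseteq> carrier G \<rightarrow>\<^sub>E {z. z ^ k = 1}"
    by (auto simp: lin_chars_def)
  then show ?thesis
    using finite_PiE[OF fin, of "\<lambda>_. {z::complex. z ^ k = 1}"] finite_roots_unity[of k] k finite_subset
    by fastforce
qed

lemma bij_betw_mult_left:
  assumes "g \<in> carrier G"
  shows "bij_betw ((\<otimes>) g) (carrier G) (carrier G)"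
  by (rule bij_betw_byWitness[where f' = "(\<otimes>) (inv g)"]) (use assms in \<open>auto simp: m_assoc[symmetric]\<close>)

text \<open>Translating the summation variable by \<open>g\<close> multiplies the sum by \<beta>(g),
  which differs from 1.\<close>

lemma sum_lin_char:
  assumes "\<beta> \<in> lin_chars G" "g \<in> carrier G" "\<beta> g \<noteq> 1"
  shows "(\<Sum>h\<in>carrier G. \<beta> h) = 0"
proof -
  have "(\<Sum>h\<in>carrier G. \<beta> h) = (\<Sum>h\<in>carrier G. \<beta> (g \<otimes> h))"
    by (rule sum.reindex_bij_betw[OF bij_betw_mult_left[OF assms(2)], symmetric])
  also have "\<dots> = \<beta> g * (\<Sum>h\<in>carrier G. \<beta> h)"
    using assms(1,2) by (simp add: lin_charsD(3) sum_distrib_left)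
  finally show ?thesis using assms(3) by (metis mult_cancel_right1)
qed

lemma lin_chars_orthogonal:
  assumes "\<beta> \<in> lin_chars G" "\<gamma> \<in> lin_chars G"
  shows "(\<Sum>h\<in>carrier G. inverse (\<beta> h) * \<gamma> h) = (if \<beta> = \<gamma> then of_nat (card (carrier G)) else 0)"
proof (cases "\<beta> = \<gamma>")
  case True
  then show ?thesis using lin_charsD(2)[OF assms(1)] by simp
next
  case False
  define \<delta> where "\<delta> = (\<lambda>h\<in>carrier G. inverse (\<beta> h) * \<gamma> h)"
  have "\<delta> = (\<lambda>h\<in>carrier G. (\<lambda>g\<in>carrier G. inverse (\<beta> g)) h * \<gamma> h)" by (auto simp: \<delta>_def)
  then have \<delta>: "\<delta> \<in> lin_chars G"
    using lin_chars_mult[OF _ lin_chars_inverse[OF _ assms(1)] assms(2)] is_monoid by metis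
  obtain g where "g \<in> carrier G" "\<beta> g \<noteq> \<gamma> g" using False lin_chars_eqI[OF assms] by blast
  then have "g \<in> carrier G" "\<delta> g \<noteq> 1"
    using lin_charsD(2)[OF assms(1)] by (auto simp: \<delta>_def field_simps)
  then have "(\<Sum>h\<in>carrier G. \<delta> h) = 0" by (rule sum_lin_char[OF \<delta>])
  then show ?thesis using False by (simp add: \<delta>_def)
qed

text \<open>Sum \<gamma>(g) over all such \<gamma> and all \<open>g\<close> in two ways. For fixed
  \<gamma> only the trivial character contributes, giving |G|; for fixed \<open>g\<close> only the
  common kernel \<open>A\<close> contributes. Hence |G| = |A| |\<Gamma>|, and \<open>S\<close> lies
  in \<open>A\<close>. This replaces the passage to a quotient by the subgroup generated by
  \<open>S\<close>; it is applied to a stabilizer.\<close>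

lemma card_lin_chars_trivial_on:
  assumes fin: "finite (carrier G)" and S: "S \<subseteq> carrier G"
  shows "card {\<gamma> \<in> lin_chars G. \<forall>g\<in>S. \<gamma> g = 1} * card S \<le> card (carrier G)"
proof -
  define \<Gamma> where "\<Gamma> = {\<gamma> \<in> lin_chars G. \<forall>g\<in>S. \<gamma> g = 1}"
  have fin\<Gamma>: "finite \<Gamma>" using finite_lin_chars[OF fin] by (simp add: \<Gamma>_def)
  define triv where "triv = (\<lambda>g\<in>carrier G. 1::complex)"
  have triv: "triv \<in> \<Gamma>" using lin_chars_trivial[OF is_monoid] S by (auto simp: \<Gamma>_def triv_def)
  define F where "F g = (\<Sum>\<gamma>\<in>\<Gamma>. \<gamma> g)" for g
  define A where "A = {g \<in> carrier G. \<forall>\<gamma>\<in>\<Gamma>. \<gamma> g = 1}"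
  have F0: "F g = 0" if g: "g \<in> carrier G" "g \<notin> A" for g
  proof -
    obtain \<delta> where \<delta>: "\<delta> \<in> \<Gamma>" "\<delta> g \<noteq> 1" using g by (auto simp: A_def)
    have \<delta>l: "\<delta> \<in> lin_chars G" using \<delta> by (simp add: \<Gamma>_def)
    have undef: "\<gamma> h = undefined" if "\<gamma> \<in> \<Gamma>" "h \<notin> carrier G" for \<gamma> h
      using lin_charsD(1)[of \<gamma> G] that by (simp add: \<Gamma>_def extensional_def)
    \<comment> \<open>Multiplication by \<open>\<delta>\<close> permutes \<open>\<Gamma>\<close>, so
      \<open>F g\<close> equals itself times the number \<open>\<delta> g\<close>, which is not
      1.\<close>
    have "bij_betw (\<lambda>\<gamma>. \<lambda>h\<in>carrier G. \<delta> h * \<gamma> h) \<Gamma> \<Gamma>"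
    proof (rule bij_betw_byWitness[where f' = "\<lambda>\<gamma>. \<lambda>h\<in>carrier G. inverse (\<delta> h) * \<gamma> h"])
      show "(\<lambda>\<gamma>. \<lambda>h\<in>carrier G. \<delta> h * \<gamma> h) ` \<Gamma> \<subseteq> \<Gamma>"
        using lin_chars_mult[OF is_monoid \<delta>l] \<delta> S by (auto simp: \<Gamma>_def)
      have "(\<lambda>h\<in>carrier G. inverse (\<delta> h) * \<gamma> h) \<in> lin_chars G" if "\<gamma> \<in> lin_chars G" for \<gamma>
        using lin_charsD[OF \<delta>l] lin_charsD[OF that] by (intro lin_charsI) auto
      then show "(\<lambda>\<gamma>. \<lambda>h\<in>carrier G. inverse (\<delta> h) * \<gamma> h) ` \<Gamma> \<subseteq> \<Gamma>"
        using \<delta> S by (auto simp: \<Gamma>_def)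
      show "\<forall>\<gamma>\<in>\<Gamma>. (\<lambda>h\<in>carrier G. inverse (\<delta> h) * (\<lambda>h\<in>carrier G. \<delta> h * \<gamma> h) h) = \<gamma>"
        using lin_charsD(2)[OF \<delta>l] by (auto simp: fun_eq_iff) (metis undef)
      show "\<forall>\<gamma>\<in>\<Gamma>. (\<lambda>h\<in>carrier G. \<delta> h * (\<lambda>h\<in>carrier G. inverse (\<delta> h) * \<gamma> h) h) = \<gamma>"
        using lin_charsD(2)[OF \<delta>l] by (auto simp: fun_eq_iff) (metis undef)
    qed
    from sum.reindex_bij_betw[OF this, of "\<lambda>\<gamma>. \<gamma> g"]
    have "F g = \<delta> g * F g" using g by (simp add: F_def sum_distrib_left)
    then show ?thesis using \<delta>(2) by (metis mult_cancel_right1)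
  qed
  have "(of_nat (card (carrier G)) :: complex) = (\<Sum>\<gamma>\<in>\<Gamma>. \<Sum>g\<in>carrier G. \<gamma> g)"
  proof -
    have "(\<Sum>g\<in>carrier G. \<gamma> g) = 0" if "\<gamma> \<in> \<Gamma> - {triv}" for \<gamma>
    proof -
      have \<gamma>: "\<gamma> \<in> lin_chars G" "\<gamma> \<noteq> triv" using that by (auto simp: \<Gamma>_def)
      then obtain g where "g \<in> carrier G" "\<gamma> g \<noteq> triv g"
        using lin_chars_eqI triv by (metis (no_types, lifting) \<Gamma>_def mem_Collect_eq)
      then show ?thesis using sum_lin_char[OF \<gamma>(1)] by (auto simp: triv_def)
    qed
    then show ?thesis by (subst sum.remove[OF fin\<Gamma> triv]) (simp add: triv_def)
  qed
  also have "\<dots> = (\<Sum>g\<in>carrier G. F g)" unfolding F_def by (rule sum.swap)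
  also have "\<dots> = (\<Sum>g\<in>A. F g)"
    using fin F0 by (intro sum.mono_neutral_right) (auto simp: A_def)
  also have "\<dots> = (\<Sum>g\<in>A. of_nat (card \<Gamma>))"
  proof (rule sum.cong[OF refl])
    fix g assume "g \<in> A"
    then have "F g = (\<Sum>\<gamma>\<in>\<Gamma>. 1)" 
      unfolding F_def by (intro sum.cong refl) (simp only: A_def mem_Collect_eq)
    then show "F g = of_nat (card \<Gamma>)" by simp
  qed
  also have "\<dots> = of_nat (card A * card \<Gamma>)"
    by simp
  finally have "card (carrier G) = card A * card \<Gamma>" by (simp only: of_nat_eq_iff)
  moreover have "card S \<le> card A"
    using fin S by (intro card_mono) (auto simp: A_def \<Gamma>_def)
  ultimately show ?thesis by (simp add: \<Gamma>_def[symmetric] mult.commute)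
qed

end

text \<open>Nonzero scalar factors do not change which subspaces are invariant.\<close>

lemma irreducible_rep_twist:
  assumes G: "group G" and irr: "irreducible_rep G n \<rho>" and \<beta>: "\<beta> \<in> lin_chars G"
  shows "irreducible_rep G n (\<lambda>g. \<beta> g \<cdot>\<^sub>m \<rho> g)"
proof -
  interpret group G by fact
  have \<rho>: "matrix_rep G n \<rho>" using irr by (simp add: irreducible_rep_def)
  note R = matrix_repD[OF G \<rho>]
  have "matrix_rep G n (\<lambda>g. \<beta> g \<cdot>\<^sub>m \<rho> g)"
  proof (rule matrix_repI[OF G])
    fix g h assume gh: "g \<in> carrier G" "h \<in> carrier G"
    show "\<beta> (g \<otimes>\<^bsub>G\<^esub> h) \<cdot>\<^sub>m \<rho> (g \<otimes>\<^bsub>G\<^esub> h) = \<beta> g \<cdot>\<^sub>m \<rho> g * (\<beta> h \<cdot>\<^sub>m \<rho> h)"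
      using R(1)[OF gh(1)] R(1)[OF gh(2)] gh
      by (intro eq_matI) (auto simp: R(3) lin_charsD(3)[OF \<beta>])
  qed (auto simp: R lin_char_one[OF \<beta>] R(1) intro!: eq_matI)
  moreover have "invariant_subspace G n \<rho> W" if W: "invariant_subspace G n (\<lambda>g. \<beta> g \<cdot>\<^sub>m \<rho> g) W" for W
  proof -
    have "\<rho> g *\<^sub>v w \<in> W" if g: "g \<in> carrier G" and w: "w \<in> W" for g w
    proof -
      have wc: "w \<in> carrier_vec n" using W w by (auto simp: invariant_subspace_def subspace_vec_iff)
      have "inverse (\<beta> g) \<cdot>\<^sub>v ((\<beta> g \<cdot>\<^sub>m \<rho> g) *\<^sub>v w) \<in> W"
        using W g w by (auto simp: invariant_subspace_def subspace_vec_iff)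
      moreover have "inverse (\<beta> g) \<cdot>\<^sub>v ((\<beta> g \<cdot>\<^sub>m \<rho> g) *\<^sub>v w) = \<rho> g *\<^sub>v w"
        using R(1)[OF g] wc lin_charsD(2)[OF \<beta> g] by (intro eq_vecI) auto
      ultimately show ?thesis by simp
    qed
    then show ?thesis using W by (auto simp: invariant_subspace_def)
  qed
  ultimately show ?thesis using irr by (auto simp: irreducible_rep_def)
qed

text \<open>This identifies the only characters of negative weight with a set on which pointwise
  multiplication is available.\<close>

lemma degree_one_Irr:
  assumes G: "group G"
  shows "{\<chi> \<in> Irr G. char_degree G \<chi> = 1} = lin_chars G"
proof (intro equalityI subsetI)
  interpret group G by fact
  fix \<chi> assume "\<chi> \<in> {\<chi> \<in> Irr G. char_degree G \<chi> = 1}"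
  then obtain \<rho> n where \<chi>: "\<chi> = rep_character G \<rho>" and irr: "irreducible_rep G n \<rho>"
    and d: "char_degree G \<chi> = 1"
    by (auto simp: Irr_def)
  have \<rho>: "matrix_rep G n \<rho>" using irr by (simp add: irreducible_rep_def)
  have "n = 1" using char_degree_rep_character(2)[OF G \<rho>] d \<chi> by simp
  note R = matrix_repD[OF G \<rho>[unfolded \<open>n = 1\<close>]]
  have \<chi>v: "\<chi> g = \<rho> g $$ (0,0)" if "g \<in> carrier G" for g
    using R(1)[OF that] that by (simp add: \<chi> rep_character_def mat_trace_def)
  have mult: "\<chi> (g \<otimes>\<^bsub>G\<^esub> h) = \<chi> g * \<chi> h" if "g \<in> carrier G" "h \<in> carrier G" for g h
    using that R(1)[OF that(1)] R(1)[OF that(2)] by (simp add: \<chi>v R(3) scalar_prod_def)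
  have one: "\<chi> \<one>\<^bsub>G\<^esub> = 1" by (simp add: \<chi>v R(2))
  show "\<chi> \<in> lin_chars G"
  proof (rule lin_charsI)
    show "\<chi> g \<noteq> 0" if "g \<in> carrier G" for g
      using mult[of g "inv\<^bsub>G\<^esub> g"] that one by auto
    show "\<chi> \<in> extensional (carrier G)" by (simp add: \<chi> rep_character_def)
  qed (rule mult)
next
  interpret group G by fact
  fix \<beta> assume \<beta>: "\<beta> \<in> lin_chars G"
  define \<rho> where "\<rho> = (\<lambda>g. mat 1 1 (\<lambda>_. \<beta> g))"
  have \<rho>: "matrix_rep G 1 \<rho>"
    by (rule matrix_repI[OF G])
      (auto simp: \<rho>_def lin_char_one[OF \<beta>] lin_charsD(3)[OF \<beta>] scalar_prod_def intro!: eq_matI)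
  have "W = {0\<^sub>v 1} \<or> W = carrier_vec 1" if W: "invariant_subspace G 1 \<rho> W" for W
  proof (cases "W = {0\<^sub>v 1}")
    case False
    have W': "W \<subseteq> carrier_vec 1" "0\<^sub>v 1 \<in> W" "\<And>c v. v \<in> W \<Longrightarrow> c \<cdot>\<^sub>v v \<in> W"
      using W by (auto simp: invariant_subspace_def subspace_vec_iff)
    obtain v where v: "v \<in> W" "v \<noteq> 0\<^sub>v 1" using False W' by blast
    then have vc: "v \<in> carrier_vec 1" using W' by auto
    have v0: "v $ 0 \<noteq> 0" using v(2) vc by (metis carrier_vecD eq_vecI index_zero_vec less_one)
    have "w \<in> W" if w: "w \<in> carrier_vec 1" for w
    proof -
      have "(w $ 0 / v $ 0) \<cdot>\<^sub>v v = w" using w vc v0 by (intro eq_vecI) auto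
      then show ?thesis using W'(3)[OF v(1), of "w $ 0 / v $ 0"] by simp
    qed
    then show ?thesis using W' by auto
  qed simp
  then have irr: "irreducible_rep G 1 \<rho>" using \<rho> by (auto simp: irreducible_rep_def)
  have "rep_character G \<rho> = \<beta>"
    using lin_charsD(1)[OF \<beta>]
    by (auto simp: rep_character_def \<rho>_def mat_trace_def extensional_def fun_eq_iff)
  then show "\<beta> \<in> {\<chi> \<in> Irr G. char_degree G \<chi> = 1}"
    using irr char_degree_rep_character(2)[OF G \<rho>] by (auto simp: Irr_def)
qed

section \<open>Monomial representations from a split normal section\<close>

lemma (in group) inv_cancel_left:
  assumes "x \<in> carrier G" "y \<in> carrier G"
  shows "x \<otimes> (inv x \<otimes> y) = y" "inv x \<otimes> (x \<otimes> y) = y"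
  using assms by (simp_all add: m_assoc[symmetric])

text \<open>This describes \<open>G/R\<close> as a semidirect product of \<open>N/R\<close> and
  \<open>L/R\<close> through subgroups of \<open>G\<close>. Staying in \<open>G\<close> avoids
  inflating characters and lets every linear character of \<open>G\<close> act by twisting,
  including those that are nontrivial on \<open>R\<close>.\<close>

locale split_mod = group G for G (structure) +
  fixes N R L
  assumes fin: "finite (carrier G)" and N: "N \<lhd> G" and R: "R \<lhd> G" and L: "subgroup L G"
    and NL_int: "N \<inter> L = R" and NL: "N <#> L = carrier G"
begin

sublocale N: normal N G by (rule N)
sublocale R: normal R G by (rule R)
sublocale L: subgroup L G by (rule L)

lemma R_sub: "R \<subseteq> N" "R \<subseteq> L" using NL_int by auto

text \<open>\<open>X\<close> is the character group of \<open>N/R\<close>. The \<open>N\<close>-component \<open>nu g\<close> of \<open>g \<in> N L\<close> is only unique modulo \<open>R\<close>,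
  so that only the values of elements of \<open>X\<close> at it are meaningful.\<close>

definition X :: "('a \<Rightarrow> complex) set" where "X = {\<mu> \<in> lin_chars (G\<lparr>carrier := N\<rparr>). \<forall>r\<in>R. \<mu> r = 1}"

definition act :: "'a \<Rightarrow> ('a \<Rightarrow> complex) \<Rightarrow> 'a \<Rightarrow> complex" where "act g \<mu> = (\<lambda>n\<in>N. \<mu> (inv g \<otimes> n \<otimes> g))"

definition nu where "nu g = (SOME n. n \<in> N \<and> inv n \<otimes> g \<in> L)"

lemma X_I:
  assumes "\<mu> \<in> extensional N" "\<And>n. n \<in> N \<Longrightarrow> \<mu> n \<noteq> 0"
    "\<And>n m. n \<in> N \<Longrightarrow> m \<in> N \<Longrightarrow> \<mu> (n \<otimes> m) = \<mu> n * \<mu> m" "\<And>r. r \<in> R \<Longrightarrow> \<mu> r = 1"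
  shows "\<mu> \<in> X"
  unfolding X_def using assms by (auto intro!: lin_charsI)

lemma X_D:
  assumes "\<mu> \<in> X"
  shows "\<mu> \<in> extensional N" "\<And>n. n \<in> N \<Longrightarrow> \<mu> n \<noteq> 0"
    "\<And>n m. n \<in> N \<Longrightarrow> m \<in> N \<Longrightarrow> \<mu> (n \<otimes> m) = \<mu> n * \<mu> m" "\<And>r. r \<in> R \<Longrightarrow> \<mu> r = 1"
    "\<mu> \<one> = 1" "\<And>n. n \<in> N \<Longrightarrow> \<mu> (inv n) = inverse (\<mu> n)"
proof -
  have \<mu>: "\<mu> \<in> lin_chars (G\<lparr>carrier := N\<rparr>)" "\<forall>r\<in>R. \<mu> r = 1" using assms by (auto simp: X_def)
  show "\<mu> \<in> extensional N" "\<And>n. n \<in> N \<Longrightarrow> \<mu> n \<noteq> 0" "\<And>r. r \<in> R \<Longrightarrow> \<mu> r = 1"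
    using lin_charsD[OF \<mu>(1)] \<mu>(2) by auto
  show mult: "\<And>n m. n \<in> N \<Longrightarrow> m \<in> N \<Longrightarrow> \<mu> (n \<otimes> m) = \<mu> n * \<mu> m"
    using lin_charsD(3)[OF \<mu>(1)] by simp
  show one: "\<mu> \<one> = 1" using \<mu>(2) R.one_closed by blast
  show "\<mu> (inv n) = inverse (\<mu> n)" if "n \<in> N" for n
  proof -
    have "\<mu> n * \<mu> (inv n) = 1" using mult[of n "inv n"] one that by simp
    then show ?thesis by (metis inverse_unique)
  qed
qed

lemma X_eqI: "\<mu> \<in> X \<Longrightarrow> \<nu> \<in> X \<Longrightarrow> (\<And>n. n \<in> N \<Longrightarrow> \<mu> n = \<nu> n) \<Longrightarrow> \<mu> = \<nu>"
  using X_D(1) by (blast intro: extensionalityI)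

lemma finite_N: "finite N" using fin N.subset finite_subset by blast

lemma finite_X: "finite X"
proof -
  interpret Ng: group "G\<lparr>carrier := N\<rparr>" using N.subgroup_axioms by (rule subgroup_imp_group)
  show ?thesis using Ng.finite_lin_chars finite_N by (simp add: X_def)
qed

lemma X_orthogonal:
  assumes "\<mu> \<in> X" "\<nu> \<in> X"
  shows "(\<Sum>n\<in>N. inverse (\<mu> n) * \<nu> n) = (if \<mu> = \<nu> then of_nat (card N) else 0)"
proof -
  interpret Ng: group "G\<lparr>carrier := N\<rparr>" using N.subgroup_axioms by (rule subgroup_imp_group)
  show ?thesis using Ng.lin_chars_orthogonal[of \<mu> \<nu>] assms by (simp add: X_def)
qed

lemma conj_N: "g \<in> carrier G \<Longrightarrow> n \<in> N \<Longrightarrow> inv g \<otimes> n \<otimes> g \<in> N"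
  using N.inv_op_closed1 by simp

lemma act_X:
  assumes g: "g \<in> carrier G" and \<mu>: "\<mu> \<in> X"
  shows "act g \<mu> \<in> X"
proof (rule X_I)
  fix n m assume nm: "n \<in> N" "m \<in> N"
  have "inv g \<otimes> (n \<otimes> m) \<otimes> g = (inv g \<otimes> n \<otimes> g) \<otimes> (inv g \<otimes> m \<otimes> g)"
    using g nm by (simp add: m_assoc inv_cancel_left)
  then show "act g \<mu> (n \<otimes> m) = act g \<mu> n * act g \<mu> m"
    using nm g \<mu> by (simp add: act_def X_D(3) conj_N)
next
  fix r assume "r \<in> R"
  then show "act g \<mu> r = 1"
    using X_D(4)[OF \<mu>] R.inv_op_closed1[OF g] R_sub by (auto simp: act_def)
qed (use X_D[OF \<mu>] conj_N[OF g] in \<open>auto simp: act_def\<close>)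

lemma act_one: "\<mu> \<in> X \<Longrightarrow> act \<one> \<mu> = \<mu>"
  using X_D(1)[of \<mu>] by (auto simp: act_def extensional_def fun_eq_iff)

lemma act_mult:
  assumes "g \<in> carrier G" "h \<in> carrier G"
  shows "act (g \<otimes> h) \<mu> = act g (act h \<mu>)"
  using assms conj_N by (auto simp: act_def fun_eq_iff inv_mult_group m_assoc)

lemma act_inv:
  assumes "g \<in> carrier G" "\<mu> \<in> X"
  shows "act (inv g) (act g \<mu>) = \<mu>" "act g (act (inv g) \<mu>) = \<mu>"
  using assms by (simp_all add: act_mult[symmetric] act_one)

text \<open>Values of a homomorphism into a commutative group do not change under conjugation inside
  its domain, so the action on \<open>X\<close> depends only on the coset of
  \<open>N\<close>.\<close>

lemma act_N:
  assumes n: "n \<in> N" and \<mu>: "\<mu> \<in> X"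
  shows "act n \<mu> = \<mu>"
  by (rule X_eqI[OF act_X]) (use n \<mu> in \<open>auto simp: act_def X_D\<close>)

lemma nu:
  assumes g: "g \<in> carrier G"
  shows "nu g \<in> N" "inv (nu g) \<otimes> g \<in> L"
proof -
  have "g \<in> N <#> L" using g NL by simp
  then obtain n l where nl: "n \<in> N" "l \<in> L" "g = n \<otimes> l" by (auto simp: set_mult_def)
  then have "n \<in> N \<and> inv n \<otimes> g \<in> L" by (simp add: inv_cancel_left)
  then show "nu g \<in> N" "inv (nu g) \<otimes> g \<in> L"
    unfolding nu_def by (metis (mono_tags, lifting) someI)+
qed

text \<open>Two possible \<open>N\<close>-components of \<open>g\<close> differ by an element of
  both \<open>N\<close> and \<open>L\<close>, hence of \<open>R\<close>, where \<open>\<mu>\<close>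
  is 1.\<close>

lemma nu_unique:
  assumes \<mu>: "\<mu> \<in> X" and g: "g \<in> carrier G" and n: "n \<in> N" "inv n \<otimes> g \<in> L"
  shows "\<mu> (nu g) = \<mu> n"
proof -
  have "inv (nu g) \<otimes> n = (inv (nu g) \<otimes> g) \<otimes> inv (inv n \<otimes> g)"
    using g n nu(1)[OF g] by (simp add: inv_mult_group m_assoc inv_cancel_left)
  then have "inv (nu g) \<otimes> n \<in> L" using n(2) nu(2)[OF g] by simp
  moreover have "inv (nu g) \<otimes> n \<in> N" using n nu(1)[OF g] by simp
  ultimately have "\<mu> (inv (nu g) \<otimes> n) = 1" using X_D(4)[OF \<mu>] NL_int by blast
  then show ?thesis using X_D[OF \<mu>] nu(1)[OF g] n(1) by (simp add: field_simps)
qed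

text \<open>This cocycle identity makes the monomial matrices multiply correctly. For
  \<open>g\<close> fixing \<open>\<mu>\<close> it says that \<open>\<mu> (nu g)\<close> is
  multiplicative, that is, \<open>\<mu>\<close> extends to its stabilizer. It comes from writing n l
  m l' as n (l m l^-1) (l l').\<close>

lemma nu_mult:
  assumes \<mu>: "\<mu> \<in> X" and g: "g \<in> carrier G" and h: "h \<in> carrier G"
  shows "\<mu> (nu (g \<otimes> h)) = \<mu> (nu g) * act (inv g) \<mu> (nu h)"
proof -
  define n l m l' where "n = nu g" and "l = inv n \<otimes> g" and "m = nu h" and "l' = inv m \<otimes> h"
  have n: "n \<in> N" "l \<in> L" and m: "m \<in> N" "l' \<in> L"
    using nu[OF g] nu[OF h] by (auto simp: n_def l_def m_def l'_def)
  have c: "n \<in> carrier G" "l \<in> carrier G" "m \<in> carrier G" "l' \<in> carrier G" using n m by auto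
  have gh: "g = n \<otimes> l" "h = m \<otimes> l'" using g h c by (simp_all add: l_def l'_def inv_cancel_left)
  have lm: "l \<otimes> m \<otimes> inv l \<in> N" using N.inv_op_closed2[OF c(2) m(1)] by simp
  have "inv (n \<otimes> (l \<otimes> m \<otimes> inv l)) \<otimes> (g \<otimes> h) = l \<otimes> l'"
    using c by (simp add: gh inv_mult_group m_assoc inv_cancel_left)
  then have "\<mu> (nu (g \<otimes> h)) = \<mu> (n \<otimes> (l \<otimes> m \<otimes> inv l))"
    using n m lm g h by (intro nu_unique[OF \<mu>]) auto
  also have "\<dots> = \<mu> n * \<mu> (l \<otimes> m \<otimes> inv l)" using X_D[OF \<mu>] n lm by simp
  \<comment> \<open>Conjugation by \<open>n\<close> is invisible to \<open>\<mu>\<close> and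
    replaces conjugation by \<open>l\<close> with conjugation by \<open>g\<close>.\<close>
  also have "\<mu> (l \<otimes> m \<otimes> inv l) = \<mu> (n \<otimes> (l \<otimes> m \<otimes> inv l) \<otimes> inv n)"
    using X_D[OF \<mu>] n lm by simp
  also have "n \<otimes> (l \<otimes> m \<otimes> inv l) \<otimes> inv n = g \<otimes> m \<otimes> inv g"
    using c by (simp add: gh inv_mult_group m_assoc)
  also have "\<mu> \<dots> = act (inv g) \<mu> m" using m g by (simp add: act_def)
  finally show ?thesis by (simp add: n_def m_def)
qed

lemma nu_N: "\<mu> \<in> X \<Longrightarrow> n \<in> N \<Longrightarrow> \<mu> (nu n) = \<mu> n"
  using nu_unique[of \<mu> n n] by simp

lemma nu_N_mult:
  assumes "\<mu> \<in> X" "n \<in> N" "g \<in> carrier G"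
  shows "\<mu> (nu (n \<otimes> g)) = \<mu> n * \<mu> (nu g)"
  using assms by (simp add: nu_mult nu_N act_N)

section \<open>The monomial representation of an orbit and its character\<close>

text \<open>When \<open>e\<close> enumerates an orbit, this is the representation induced from the
  stabilizer of an orbit element \<open>\<mu>\<close> by its extension \<open>\<mu> (nu g)\<close>,
  written in a basis indexed by the orbit.\<close>

definition mono_mat :: "(nat \<Rightarrow> 'a \<Rightarrow> complex) \<Rightarrow> nat \<Rightarrow> 'a \<Rightarrow> complex mat" where
  "mono_mat e t g = mat t t (\<lambda>(i,j). if e i = act g (e j) then e i (nu g) else 0)"

definition orb where "orb \<mu> = (\<lambda>g. act g \<mu>) ` carrier G"

text \<open>The trace of \<open>mono_mat\<close>, expressed by the set alone, so that characters of
  different orbits can be compared without choosing enumerations.\<close>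

definition ochar where "ochar A g = (\<Sum>\<mu>\<in>{\<mu>\<in>A. act g \<mu> = \<mu>}. \<mu> (nu g))"

lemma orb_subset: "\<mu> \<in> X \<Longrightarrow> orb \<mu> \<subseteq> X"
  by (auto simp: orb_def act_X)

lemma finite_orb: "finite (orb \<mu>)" using fin by (simp add: orb_def)

lemma orb_self: "\<mu> \<in> X \<Longrightarrow> \<mu> \<in> orb \<mu>"
  unfolding orb_def by (rule image_eqI[of _ _ \<one>]) (simp_all add: act_one)

lemma orb_closed:
  assumes "\<mu> \<in> X" "\<nu> \<in> orb \<mu>" "g \<in> carrier G"
  shows "act g \<nu> \<in> orb \<mu>"
proof -
  obtain h where h: "h \<in> carrier G" "\<nu> = act h \<mu>" using assms by (auto simp: orb_def)
  then show ?thesis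
    unfolding orb_def using assms by (intro image_eqI[of _ _ "g \<otimes> h"]) (simp_all add: act_mult)
qed

lemma orb_trans:
  assumes "\<mu> \<in> X" "\<nu> \<in> orb \<mu>" "\<kappa> \<in> orb \<mu>"
  shows "\<exists>g\<in>carrier G. act g \<nu> = \<kappa>"
proof -
  obtain h k where hk: "h \<in> carrier G" "\<nu> = act h \<mu>" "k \<in> carrier G" "\<kappa> = act k \<mu>"
    using assms by (auto simp: orb_def)
  then have "act (k \<otimes> inv h) \<nu> = \<kappa>" using assms(1) by (simp add: act_mult act_X act_inv)
  then show ?thesis using hk by (intro bexI[of _ "k \<otimes> inv h"]) auto
qed

text \<open>Each column has a single nonzero entry, so an entry of the product is one product of two
  entries, and \<open>nu_mult\<close> evaluates it.\<close>

lemma mono_rep: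
  assumes \<mu>: "\<mu> \<in> X" and e: "bij_betw e {..<t} (orb \<mu>)"
  shows "matrix_rep G t (mono_mat e t)"
proof (rule matrix_repI)
  have eX: "e i \<in> X" if "i < t" for i using e orb_subset[OF \<mu>] that by (auto simp: bij_betw_def)
  have inj: "i = j" if "e i = e j" "i < t" "j < t" for i j
    using e that by (auto simp: bij_betw_def inj_on_def)
  show "mono_mat e t \<one> = 1\<^sub>m t"
    using inj by (intro eq_matI) (auto simp: mono_mat_def act_one eX nu_N X_D)
  fix g h assume gh: "g \<in> carrier G" "h \<in> carrier G"
  show "mono_mat e t (g \<otimes> h) = mono_mat e t g * mono_mat e t h"
  proof (rule eq_matI)
    fix i k assume "i < dim_row (mono_mat e t g * mono_mat e t h)" "k < dim_col (mono_mat e t g * mono_mat e t h)"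
    then have ik: "i < t" "k < t" by (auto simp: mono_mat_def)
    have "e k \<in> orb \<mu>" using e ik by (auto simp: bij_betw_def)
    then have "act h (e k) \<in> e ` {..<t}" using orb_closed[OF \<mu> _ gh(2)] e by (auto simp: bij_betw_def)
    then obtain j where j: "j < t" "e j = act h (e k)" by auto
    have jj: "e l = act h (e k) \<longleftrightarrow> l = j" if "l < t" for l using j that inj by metis
    have "(mono_mat e t g * mono_mat e t h) $$ (i,k) = (\<Sum>l<t. mono_mat e t g $$ (i,l) * mono_mat e t h $$ (l,k))"
      using ik by (auto simp: mono_mat_def scalar_prod_def atLeast0LessThan intro!: sum.cong)
    also have "\<dots> = (\<Sum>l<t. if l = j then mono_mat e t g $$ (i,j) * mono_mat e t h $$ (j,k) else 0)"
      using ik jj by (intro sum.cong) (auto simp: mono_mat_def)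
    also have "\<dots> = mono_mat e t g $$ (i,j) * mono_mat e t h $$ (j,k)" using j by simp
    also have "\<dots> = mono_mat e t (g \<otimes> h) $$ (i,k)"
    proof (cases "e i = act g (e j)")
      case True
      \<comment> \<open>This turns the conjugated factor in \<open>nu_mult\<close> into
        \<open>e j (nu h)\<close>.\<close>
      have "act (inv g) (e i) = e j" using True gh eX j(1) by (simp add: act_inv)
      then have "e i (nu (g \<otimes> h)) = e i (nu g) * e j (nu h)"
        using nu_mult[OF eX[OF ik(1)] gh] by simp
      then show ?thesis using True ik j gh by (simp add: mono_mat_def act_mult)
    next
      case False
      then show ?thesis using ik j gh by (simp add: mono_mat_def act_mult)
    qed
    finally show "mono_mat e t (g \<otimes> h) $$ (i,k) = (mono_mat e t g * mono_mat e t h) $$ (i,k)" by simp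
  qed (auto simp: mono_mat_def)
qed (auto simp: mono_mat_def)

lemma mono_trace:
  assumes e: "bij_betw e {..<t} A"
  shows "mat_trace (mono_mat e t g) = ochar A g"
proof -
  have A: "finite A" using e bij_betw_finite by blast
  have "mat_trace (mono_mat e t g) = (\<Sum>i<t. if act g (e i) = e i then e i (nu g) else 0)"
    by (auto simp: mono_mat_def mat_trace_def intro!: sum.cong)
  also have "\<dots> = (\<Sum>\<mu>\<in>A. if act g \<mu> = \<mu> then \<mu> (nu g) else 0)"
    by (rule sum.reindex_bij_betw[OF e])
  also have "\<dots> = ochar A g"
    unfolding ochar_def using A by (simp add: sum.If_cases Int_def)
  finally show ?thesis .
qed

lemma mono_diag:
  assumes eX: "\<And>i. i < t \<Longrightarrow> e i \<in> X" and inj: "inj_on e {..<t}" and n: "n \<in> N"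
    and w: "w \<in> carrier_vec t"
  shows "mono_mat e t n *\<^sub>v w = vec t (\<lambda>i. e i n * w $ i)"
proof (rule eq_vecI)
  fix i assume "i < dim_vec (vec t (\<lambda>i. e i n * w $ i))"
  then have i: "i < t" by simp
  have "(mono_mat e t n *\<^sub>v w) $ i = (\<Sum>j<t. mono_mat e t n $$ (i,j) * w $ j)"
    using i w by (auto simp: mono_mat_def scalar_prod_def atLeast0LessThan intro!: sum.cong)
  also have "\<dots> = (\<Sum>j<t. if j = i then e i n * w $ i else 0)"
    using i inj n eX by (intro sum.cong) (auto simp: mono_mat_def act_N nu_N inj_on_def)
  finally show "(mono_mat e t n *\<^sub>v w) $ i = vec t (\<lambda>i. e i n * w $ i) $ i" using i by simp
qed (use w in \<open>auto simp: mono_mat_def\<close>)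

lemma mono_unit_vec:
  assumes e: "inj_on e {..<t}" and ij: "i < t" "j < t" "e j = act g (e i)"
  shows "mono_mat e t g *\<^sub>v unit_vec t i = e j (nu g) \<cdot>\<^sub>v unit_vec t j"
proof (rule eq_vecI)
  fix k assume "k < dim_vec (e j (nu g) \<cdot>\<^sub>v unit_vec t j)"
  then have k: "k < t" by simp
  have "e k = e j \<longleftrightarrow> k = j" using e ij k by (auto simp: inj_on_def)
  moreover have "(mono_mat e t g *\<^sub>v unit_vec t i) $ k = mono_mat e t g $$ (k,i)"
    using ij k by (simp add: mono_mat_def scalar_prod_right_unit)
  ultimately show "(mono_mat e t g *\<^sub>v unit_vec t i) $ k = (e j (nu g) \<cdot>\<^sub>v unit_vec t j) $ k"
    using ij k by (auto simp: mono_mat_def)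
qed (auto simp: mono_mat_def)

text \<open>\<open>N\<close> acts diagonally through pairwise distinct characters. A nonzero vector
  of minimal support in an invariant subspace can therefore have only one nonzero coordinate, since
  otherwise a suitable element of \<open>N\<close> shortens it. This gives one unit vector, and
  transitivity on the orbit gives all of them.\<close>

lemma mono_irreducible:
  assumes \<mu>: "\<mu> \<in> X" and e: "bij_betw e {..<t} (orb \<mu>)"
  shows "irreducible_rep G t (mono_mat e t)"
proof -
  have eX: "e i \<in> X" if "i < t" for i using e orb_subset[OF \<mu>] that by (auto simp: bij_betw_def)
  have inj: "inj_on e {..<t}" using e by (auto simp: bij_betw_def)
  have tpos: "t > 0" using e orb_self[OF \<mu>] by (auto simp: bij_betw_def)
  have "W = {0\<^sub>v t} \<or> W = carrier_vec t" if W: "invariant_subspace G t (mono_mat e t) W" for W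
  proof (cases "W = {0\<^sub>v t}")
    case False
    have sub: "W \<subseteq> carrier_vec t" and zero: "0\<^sub>v t \<in> W"
      and add: "\<And>v w. v \<in> W \<Longrightarrow> w \<in> W \<Longrightarrow> v + w \<in> W"
      and smult: "\<And>c v. v \<in> W \<Longrightarrow> c \<cdot>\<^sub>v v \<in> W"
      and inv: "\<And>g w. g \<in> carrier G \<Longrightarrow> w \<in> W \<Longrightarrow> mono_mat e t g *\<^sub>v w \<in> W"
      using W by (auto simp: invariant_subspace_def subspace_vec_iff)
    define supp where "supp w = {i. i < t \<and> w $ i \<noteq> 0}" for w :: "complex vec"
    have supp0: "w = 0\<^sub>v t" if "w \<in> W" "supp w = {}" for w
      using that sub by (intro eq_vecI) (auto simp: supp_def)
    obtain w0 where "w0 \<in> W \<and> w0 \<noteq> 0\<^sub>v t" using False zero by blast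
    then obtain w where w: "w \<in> W" "w \<noteq> 0\<^sub>v t"
      and min: "\<And>v. v \<in> W \<Longrightarrow> v \<noteq> 0\<^sub>v t \<Longrightarrow> card (supp w) \<le> card (supp v)"
      using ex_has_least_nat[of "\<lambda>w. w \<in> W \<and> w \<noteq> 0\<^sub>v t" w0 "\<lambda>w. card (supp w)"] by blast
    have wc: "w \<in> carrier_vec t" using w sub by auto
    obtain i where i: "i < t" "w $ i \<noteq> 0" using supp0[OF w(1)] w(2) by (auto simp: supp_def)
    have only: "w $ j = 0" if j: "j < t" "j \<noteq> i" for j
    proof (rule ccontr)
      assume wj: "w $ j \<noteq> 0"
      have "e i \<noteq> e j" using inj i j by (auto simp: inj_on_def)
      then obtain n where n: "n \<in> N" "e i n \<noteq> e j n" using X_eqI eX i(1) j(1) by blast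
      \<comment> \<open>This combination kills coordinate \<open>i\<close>, keeps coordinate
        \<open>j\<close> nonzero and creates no new support.\<close>
      define v where "v = mono_mat e t n *\<^sub>v w + (- e i n) \<cdot>\<^sub>v w"
      have "v \<in> W" unfolding v_def using w n by (intro add smult inv) auto
      have v: "v $ k = (e k n - e i n) * w $ k" if "k < t" for k
        using that wc by (simp add: v_def mono_diag[OF eX inj n(1) wc] algebra_simps)
      have "v $ j \<noteq> 0" using v[OF j(1)] n wj by simp
      then have "v \<noteq> 0\<^sub>v t" using j by auto
      have "supp v \<subseteq> supp w" "i \<in> supp w" "i \<notin> supp v"
        using v i(2) by (auto simp: supp_def i(1))
      then have "supp v \<subset> supp w" by blast
      then have "card (supp v) < card (supp w)"
        by (intro psubset_card_mono) (auto simp: supp_def)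
      then show False using min[OF \<open>v \<in> W\<close> \<open>v \<noteq> 0\<^sub>v t\<close>] by simp
    qed
    have "(inverse (w $ i)) \<cdot>\<^sub>v w = unit_vec t i"
      using only i wc by (intro eq_vecI) auto
    then have ui: "unit_vec t i \<in> W" using smult[OF w(1)] by metis
    have u: "unit_vec t j \<in> W" if j: "j < t" for j
    proof -
      have "e i \<in> orb \<mu>" "e j \<in> orb \<mu>" using e i j by (auto simp: bij_betw_def)
      then obtain g where g: "g \<in> carrier G" "act g (e i) = e j" using orb_trans[OF \<mu>] by blast
      have "inverse (e j (nu g)) \<cdot>\<^sub>v (mono_mat e t g *\<^sub>v unit_vec t i) \<in> W"
        using g ui by (intro smult inv)
      moreover have "inverse (e j (nu g)) \<cdot>\<^sub>v (mono_mat e t g *\<^sub>v unit_vec t i) = unit_vec t j"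
        using mono_unit_vec[OF inj i(1) j g(2)[symmetric]] X_D(2)[OF eX[OF j] nu(1)[OF g(1)]]
        by (simp add: smult_smult_assoc)
      ultimately show ?thesis by simp
    qed
    have "v \<in> W" if v: "v \<in> carrier_vec t" for v
    proof -
      have "k \<le> t \<Longrightarrow> vec t (\<lambda>i. if i < k then v $ i else 0) \<in> W" for k
      proof (induction k)
        case 0
        have "vec t (\<lambda>i. if i < (0::nat) then v $ i else 0) = 0\<^sub>v t" by (intro eq_vecI) auto
        then show ?case using zero by simp
      next
        case (Suc k)
        have "vec t (\<lambda>i. if i < Suc k then v $ i else 0) =
          vec t (\<lambda>i. if i < k then v $ i else 0) + v $ k \<cdot>\<^sub>v unit_vec t k"
          using Suc.prems v by (intro eq_vecI) (auto simp: less_Suc_eq)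
        then show ?case using Suc by (simp add: add smult u)
      qed
      from this[of t] have "vec t (\<lambda>i. if i < t then v $ i else 0) \<in> W" by simp
      moreover have "vec t (\<lambda>i. if i < t then v $ i else 0) = v" using v by (intro eq_vecI) auto
      ultimately show ?thesis by simp
    qed
    then show ?thesis using sub by auto
  qed simp
  then show ?thesis using mono_rep[OF assms] tpos by (simp add: irreducible_rep_def)
qed

lemma monomial_character:
  assumes \<mu>: "\<mu> \<in> X" and \<beta>: "\<beta> \<in> lin_chars G"
  defines "\<chi> \<equiv> \<lambda>g\<in>carrier G. \<beta> g * ochar (orb \<mu>) g"
  shows "\<chi> \<in> Irr G" "char_degree G \<chi> = card (orb \<mu>)"
proof -
  obtain e where e: "bij_betw e {..<card (orb \<mu>)} (orb \<mu>)"
    using ex_bij_betw_nat_finite[OF finite_orb] by (auto simp: atLeast0LessThan)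
  define \<rho> where "\<rho> = (\<lambda>g. \<beta> g \<cdot>\<^sub>m mono_mat e (card (orb \<mu>)) g)"
  have irr: "irreducible_rep G (card (orb \<mu>)) \<rho>"
    unfolding \<rho>_def by (rule irreducible_rep_twist[OF is_group mono_irreducible[OF \<mu> e] \<beta>])
  have "mat_trace (\<rho> g) = \<beta> g * mat_trace (mono_mat e (card (orb \<mu>)) g)" for g
    by (simp add: \<rho>_def mat_trace_def mono_mat_def sum_distrib_left)
  then have \<chi>: "rep_character G \<rho> = \<chi>"
    by (simp add: rep_character_def \<chi>_def mono_trace[OF e])
  then show "\<chi> \<in> Irr G" using irr by (auto simp: Irr_def)
  show "char_degree G \<chi> = card (orb \<mu>)"
    using char_degree_rep_character(2)[OF is_group, of "card (orb \<mu>)" \<rho>] irr \<chi>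
    by (simp add: irreducible_rep_def)
qed

text \<open>On the coset of \<open>g\<close>, \<open>ochar A\<close> is a combination of those
  characters in \<open>A\<close> that \<open>g\<close> fixes, with coefficients \<nu>(nu g), and
  orthogonality on \<open>N\<close> extracts the coefficient of \<open>\<mu>\<close>. Membership in
  an orbit and values on a stabilizer thus become visible in the character.\<close>

lemma ochar_N_sum:
  assumes A: "A \<subseteq> X" and \<mu>: "\<mu> \<in> X" and g: "g \<in> carrier G"
  shows "(\<Sum>n\<in>N. inverse (\<mu> n) * ochar A (n \<otimes> g)) =
    (if \<mu> \<in> A \<and> act g \<mu> = \<mu> then of_nat (card N) * \<mu> (nu g) else 0)"
proof -
  define F where "F = {\<nu>\<in>A. act g \<nu> = \<nu>}"
  have FX: "F \<subseteq> X" "finite F" using A finite_subset[OF _ finite_X] by (auto simp: F_def)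
  have oc: "ochar A (n \<otimes> g) = (\<Sum>\<nu>\<in>F. \<nu> n * \<nu> (nu g))" if n: "n \<in> N" for n
  proof -
    have "{\<nu>\<in>A. act (n \<otimes> g) \<nu> = \<nu>} = F"
      using A n g by (auto simp: F_def act_mult act_N act_X subset_iff)
    then show ?thesis
      unfolding ochar_def using FX n g by (auto intro!: sum.cong simp: nu_N_mult subset_iff)
  qed
  have "(\<Sum>n\<in>N. inverse (\<mu> n) * ochar A (n \<otimes> g)) =
      (\<Sum>n\<in>N. \<Sum>\<nu>\<in>F. inverse (\<mu> n) * \<nu> n * \<nu> (nu g))"
    by (simp add: oc sum_distrib_left mult.assoc)
  also have "\<dots> = (\<Sum>\<nu>\<in>F. (\<Sum>n\<in>N. inverse (\<mu> n) * \<nu> n) * \<nu> (nu g))"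
    by (subst sum.swap) (simp add: sum_distrib_right)
  also have "\<dots> = (\<Sum>\<nu>\<in>F. if \<nu> = \<mu> then of_nat (card N) * \<mu> (nu g) else 0)"
    using FX \<mu> by (intro sum.cong) (auto simp: X_orthogonal subset_iff)
  also have "\<dots> = (if \<mu> \<in> F then of_nat (card N) * \<mu> (nu g) else 0)"
    using FX(2) by simp
  finally show ?thesis by (simp add: F_def)
qed

lemma ochar_R:
  assumes "A \<subseteq> X" "r \<in> R"
  shows "ochar A r = of_nat (card A)"
proof -
  have r: "r \<in> N" using assms R_sub by auto
  have "{\<mu>\<in>A. act r \<mu> = \<mu>} = A" using assms(1) r by (auto simp: act_N)
  moreover have "(\<Sum>\<mu>\<in>A. \<mu> (nu r)) = (\<Sum>\<mu>\<in>A. 1)"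
    using assms by (intro sum.cong refl) (auto simp: nu_N r X_D(4))
  ultimately show ?thesis by (simp add: ochar_def)
qed

text \<open>The restriction to \<open>R\<close> shows that the quotient of \<open>\<beta>\<close> and \<open>\<gamma>\<close> is an invariant element of \<open>X\<close> on \<open>N\<close>,
  hence trivial there; the orbit is then recovered from the restriction to \<open>N\<close>.\<close>

lemma monomial_character_eqD:
  assumes inv_triv: "\<And>\<nu>. \<nu> \<in> X \<Longrightarrow> (\<And>g. g \<in> carrier G \<Longrightarrow> act g \<nu> = \<nu>) \<Longrightarrow> \<nu> = (\<lambda>n\<in>N. 1)"
    and \<mu>: "\<mu> \<in> X" and \<mu>': "\<mu>' \<in> X" and \<beta>: "\<beta> \<in> lin_chars G" and \<gamma>: "\<gamma> \<in> lin_chars G"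
    and eq: "\<And>g. g \<in> carrier G \<Longrightarrow> \<beta> g * ochar (orb \<mu>) g = \<gamma> g * ochar (orb \<mu>') g"
  shows "orb \<mu> = orb \<mu>'" "\<And>g. g \<in> carrier G \<Longrightarrow> act g \<mu> = \<mu> \<Longrightarrow> \<beta> g = \<gamma> g"
proof -
  define \<delta> where "\<delta> g = inverse (\<beta> g) * \<gamma> g" for g
  have \<delta>: "\<And>g h. g \<in> carrier G \<Longrightarrow> h \<in> carrier G \<Longrightarrow> \<delta> (g \<otimes> h) = \<delta> g * \<delta> h"
    "\<And>g. g \<in> carrier G \<Longrightarrow> \<delta> g \<noteq> 0" "\<delta> \<one> = 1"
    by (simp_all add: \<delta>_def lin_charsD(2,3)[OF \<beta>] lin_charsD(2,3)[OF \<gamma>] lin_char_one \<beta> \<gamma>)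
  have eq': "ochar (orb \<mu>) g = \<delta> g * ochar (orb \<mu>') g" if "g \<in> carrier G" for g
    using eq[OF that] lin_charsD(2)[OF \<beta> that] by (simp add: \<delta>_def field_simps)
  have OX: "orb \<mu> \<subseteq> X" "orb \<mu>' \<subseteq> X" using orb_subset \<mu> \<mu>' by auto
  have card: "card (orb \<mu>) = card (orb \<mu>')"
    using eq'[of \<one>] ochar_R[OF OX(1), of \<one>] ochar_R[OF OX(2), of \<one>] \<delta>(3)
    by (simp add: R.one_closed)
  have cpos: "card (orb \<mu>) > 0" using finite_orb orb_self[OF \<mu>] card_gt_0_iff by blast
  have \<delta>R: "\<delta> r = 1" if "r \<in> R" for r
  proof -
    have "of_nat (card (orb \<mu>)) = \<delta> r * of_nat (card (orb \<mu>))"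
      using eq'[of r] ochar_R[OF OX(1) that] ochar_R[OF OX(2) that] card that R.subset by auto
    then show ?thesis using cpos by simp
  qed
  have "(\<lambda>n\<in>N. \<delta> n) = (\<lambda>n\<in>N. 1)"
  proof (rule inv_triv)
    show "(\<lambda>n\<in>N. \<delta> n) \<in> X" using R_sub \<delta>R by (intro X_I) (auto simp: \<delta>)
    fix g assume g: "g \<in> carrier G"
    have "\<delta> (inv g \<otimes> n \<otimes> g) = \<delta> n" if "n \<in> N" for n
      using that g by (simp add: \<delta>_def lin_char_conj \<beta> \<gamma>)
    then show "act g (\<lambda>n\<in>N. \<delta> n) = (\<lambda>n\<in>N. \<delta> n)"
      using g conj_N by (auto simp: act_def fun_eq_iff)
  qed
  then have \<delta>N: "\<delta> n = 1" if "n \<in> N" for n using that by (metis restrict_apply')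
  \<comment> \<open>Since \<open>\<delta>\<close> is trivial on \<open>N\<close>, it is constant on
    the coset of \<open>g\<close> and leaves the sum as a factor.\<close>
  have key: "(\<Sum>n\<in>N. inverse (\<nu> n) * ochar (orb \<mu>) (n \<otimes> g)) =
      \<delta> g * (\<Sum>n\<in>N. inverse (\<nu> n) * ochar (orb \<mu>') (n \<otimes> g))" if "g \<in> carrier G" for \<nu> g
    using that by (simp add: eq' \<delta> \<delta>N sum_distrib_left mult.left_commute)
  have Npos: "card N > 0" using finite_N N.one_closed card_gt_0_iff by blast
  have "orb \<mu> \<subseteq> orb \<mu>'"
  proof
    fix \<nu> assume \<nu>: "\<nu> \<in> orb \<mu>"
    then have \<nu>X: "\<nu> \<in> X" using OX by auto
    \<comment> \<open>At the identity the coefficient of \<open>\<nu>\<close> is |N| or 0 according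
      to membership in the orbit.\<close>
    show "\<nu> \<in> orb \<mu>'"
      using key[of \<one> \<nu>] ochar_N_sum[OF OX(1) \<nu>X, of \<one>] ochar_N_sum[OF OX(2) \<nu>X, of \<one>] \<nu> Npos
      by (auto simp: act_one \<nu>X nu_N X_D split: if_splits)
  qed
  then show "orb \<mu> = orb \<mu>'" using card finite_orb card_subset_eq by metis
  fix g assume g: "g \<in> carrier G" "act g \<mu> = \<mu>"
  \<comment> \<open>As \<open>g\<close> fixes \<open>\<mu>\<close>, the coefficient of
    \<open>\<mu>\<close> is the same nonzero number on both sides.\<close>
  have "\<delta> g = 1"
    using key[OF g(1), of \<mu>] ochar_N_sum[OF OX(1) \<mu> g(1)] g Npos orb_self[OF \<mu>] X_D(2)[OF \<mu> nu(1)[OF g(1)]]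
    by (simp add: \<open>orb \<mu> = orb \<mu>'\<close>[symmetric])
  then show "\<beta> g = \<gamma> g" using lin_charsD(2)[OF \<beta> g(1)] by (simp add: \<delta>_def field_simps)
qed

end

section \<open>Fixed points of actions of groups of prime power order\<close>

text \<open>\<open>BijGroup\<close> consists of extensional maps, hence the restriction to
  \<open>E\<close>; actions can then be given as plain functions such as \<open>act\<close>.\<close>

lemma group_action_restrict:
  assumes G: "group G"
    and closed: "\<And>g x. g \<in> carrier G \<Longrightarrow> x \<in> E \<Longrightarrow> a g x \<in> E"
    and one: "\<And>x. x \<in> E \<Longrightarrow> a \<one>\<^bsub>G\<^esub> x = x"
    and mult: "\<And>g h x. g \<in> carrier G \<Longrightarrow> h \<in> carrier G \<Longrightarrow> x \<in> E \<Longrightarrow> a (g \<otimes>\<^bsub>G\<^esub> h) x = a g (a h x)"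
  shows "group_action G E (\<lambda>g. \<lambda>x\<in>E. a g x)"
proof -
  interpret group G by fact
  have Bij: "(\<lambda>x\<in>E. a g x) \<in> Bij E" if g: "g \<in> carrier G" for g
  proof -
    have "a (inv\<^bsub>G\<^esub> g) (a g x) = x" "a g (a (inv\<^bsub>G\<^esub> g) x) = x" if "x \<in> E" for x
      using that g by (simp_all add: mult[symmetric] one)
    then have "bij_betw (\<lambda>x\<in>E. a g x) E E"
      using g closed by (intro bij_betw_byWitness[where f' = "a (inv\<^bsub>G\<^esub> g)"]) auto
    then show ?thesis by (simp add: Bij_def)
  qed
  have "(\<lambda>g. \<lambda>x\<in>E. a g x) \<in> hom G (BijGroup E)"
    by (rule homI) (auto simp: BijGroup_def Bij compose_def mult closed fun_eq_iff)
  then show ?thesis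
    by (auto simp: group_action_def group_hom_def group_hom_axioms_def G group_BijGroup)
qed

lemma card_orbit_stabilizer:
  assumes G: "group G"
    and closed: "\<And>g x. g \<in> carrier G \<Longrightarrow> x \<in> E \<Longrightarrow> a g x \<in> E"
    and one: "\<And>x. x \<in> E \<Longrightarrow> a \<one>\<^bsub>G\<^esub> x = x"
    and mult: "\<And>g h x. g \<in> carrier G \<Longrightarrow> h \<in> carrier G \<Longrightarrow> x \<in> E \<Longrightarrow> a (g \<otimes>\<^bsub>G\<^esub> h) x = a g (a h x)"
    and x: "x \<in> E"
  shows "card ((\<lambda>g. a g x) ` carrier G) * card {g \<in> carrier G. a g x = x} = Coset.order G"
    and "subgroup {g \<in> carrier G. a g x = x} G"
proof -
  interpret group_action G E "\<lambda>g. \<lambda>x\<in>E. a g x"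
    by (rule group_action_restrict[OF G closed one mult])
  have 1: "orbit G (\<lambda>g. \<lambda>x\<in>E. a g x) x = (\<lambda>g. a g x) ` carrier G"
    using x by (auto simp: orbit_def)
  have 2: "stabilizer G (\<lambda>g. \<lambda>x\<in>E. a g x) x = {g \<in> carrier G. a g x = x}"
    using x by (auto simp: stabilizer_def)
  show "card ((\<lambda>g. a g x) ` carrier G) * card {g \<in> carrier G. a g x = x} = Coset.order G"
    using orbit_stabilizer_theorem[OF x] by (simp add: 1 2)
  show "subgroup {g \<in> carrier G. a g x = x} G"
    using stabilizer_subgroup[OF x] by (simp add: 2)
qed

text \<open>Every orbit of a non-fixed point has size a positive power of \<open>p\<close>. The
  induction removes one such orbit at a time; it contains no fixed points, so their number is
  unchanged.\<close>

lemma p_group_fixed_points: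
  assumes G: "group G" and p: "prime p" and ord: "Coset.order G = p ^ k" and E: "finite E"
    and closed: "\<And>g x. g \<in> carrier G \<Longrightarrow> x \<in> E \<Longrightarrow> a g x \<in> E"
    and one: "\<And>x. x \<in> E \<Longrightarrow> a \<one>\<^bsub>G\<^esub> x = x"
    and mult: "\<And>g h x. g \<in> carrier G \<Longrightarrow> h \<in> carrier G \<Longrightarrow> x \<in> E \<Longrightarrow> a (g \<otimes>\<^bsub>G\<^esub> h) x = a g (a h x)"
  shows "[card E = card {x \<in> E. \<forall>g\<in>carrier G. a g x = x}] (mod p)"
  using E closed one mult
proof (induction "card E" arbitrary: E rule: less_induct)
  case less
  interpret group G by fact
  define F where "F = {x \<in> E. \<forall>g\<in>carrier G. a g x = x}"
  show ?case
  proof (cases "F = E")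
    case True
    then show ?thesis by (simp add: F_def)
  next
    case False
    then obtain x where x: "x \<in> E" "x \<notin> F" by (auto simp: F_def)
    define U where "U = (\<lambda>g. a g x) ` carrier G"
    have U: "U \<subseteq> E" "x \<in> U" using x(1) less.prems
      by (auto simp: U_def intro!: image_eqI[of _ _ "\<one>\<^bsub>G\<^esub>"])
    have finU: "finite U" using U less.prems(1) finite_subset by blast
    have "card U * card {g \<in> carrier G. a g x = x} = p ^ k"
      unfolding U_def using card_orbit_stabilizer(1)[OF G less.prems(2-4) x(1)] ord by simp
    then obtain j where j: "card U = p ^ j" using p by (metis divides_primepow_nat dvd_triv_left)
    have "j \<noteq> 0"
    proof
      assume "j = 0"
      then have "card U = 1" using j by simp
      then have "U = {x}" using U by (auto simp: card_1_singleton_iff)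
      then have "x \<in> F" using x(1) unfolding F_def U_def by blast
      then show False using x by simp
    qed
    then have pU: "p dvd card U" using j by simp
    have UF: "y \<notin> F" if "y \<in> U" for y
    proof
      assume y: "y \<in> F"
      obtain g where g: "g \<in> carrier G" "y = a g x" using \<open>y \<in> U\<close> by (auto simp: U_def)
      have "a (inv\<^bsub>G\<^esub> g) y = x" using g x less.prems(4)[of "inv\<^bsub>G\<^esub> g" g x] less.prems(3) by simp
      then have "x = y" using y g by (auto simp: F_def)
      then show False using x y by simp
    qed
    have closed': "a g y \<in> E - U" if "g \<in> carrier G" "y \<in> E - U" for g y
    proof -
      have "a g y \<notin> U"
      proof
        assume "a g y \<in> U"
        then obtain h where h: "h \<in> carrier G" "a g y = a h x" by (auto simp: U_def)
        have "y = a (inv\<^bsub>G\<^esub> g) (a g y)"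
          using that less.prems(4)[of "inv\<^bsub>G\<^esub> g" g y] less.prems(3) by simp
        also have "\<dots> = a (inv\<^bsub>G\<^esub> g \<otimes>\<^bsub>G\<^esub> h) x" using that h x less.prems(4) by simp
        finally have "y \<in> U" using that h by (auto simp: U_def)
        then show False using that by simp
      qed
      then show ?thesis using that less.prems(2) by auto
    qed
    have "card (E - U) < card E" using U x less.prems(1) by (intro psubset_card_mono) auto
    from less.hyps[OF this _ closed'] have "[card (E - U) = card {y \<in> E - U. \<forall>g\<in>carrier G. a g y = y}] (mod p)"
      using less.prems by auto
    also have "{y \<in> E - U. \<forall>g\<in>carrier G. a g y = y} = F" using UF by (auto simp: F_def)
    finally have "[card (E - U) = card F] (mod p)" .
    moreover have "card E = card (E - U) + card U"
      using U finU less.prems(1) by (metis card_Diff_subset card_mono le_add_diff_inverse2)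
    ultimately show ?thesis
      using pU unfolding F_def[symmetric] by (simp add: cong_def mod_eq_0_iff_dvd mod_add_eq[symmetric])
  qed
qed

section \<open>Orbits on the character group of an elementary abelian section\<close>

text \<open>\<open>pow_R\<close> makes the values of \<open>X\<close> \<open>p\<close>th roots of
  unity. \<open>inv_triv\<close> is the form in which minimality and noncentrality of
  \<open>N/R\<close> are used: it excludes orbits of size 1 other than that of the trivial
  character, and it separates the twisted characters.\<close>

locale split_mod_prime = split_mod G N R L for G (structure) and N R L +
  fixes p :: nat
  assumes p: "prime p"
    and pow_R: "\<And>n. n \<in> N \<Longrightarrow> n [^] p \<in> R"
    and inv_triv: "\<And>\<nu>. \<nu> \<in> X \<Longrightarrow> (\<And>g. g \<in> carrier G \<Longrightarrow> act g \<nu> = \<nu>) \<Longrightarrow> \<nu> = (\<lambda>n\<in>N. 1)"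
    and nontriv: "\<exists>\<mu>\<in>X. \<mu> \<noteq> (\<lambda>n\<in>N. 1)"
begin

abbreviation "triv \<equiv> (\<lambda>n\<in>N. 1 :: complex)"

lemma triv_X: "triv \<in> X" by (rule X_I) (use R_sub in auto)

lemma X_pow:
  assumes "\<mu> \<in> X" "n \<in> N"
  shows "\<mu> n ^ p = 1"
proof -
  have "\<mu> (n [^] k) = \<mu> n ^ k \<and> n [^] k \<in> N" for k :: nat
    using assms by (induction k) (auto simp: X_D)
  then show ?thesis using X_D(4)[OF assms(1) pow_R[OF assms(2)]] by metis
qed

text \<open>Under pointwise multiplication \<open>X\<close> is a group, in which a nontrivial
  element has order \<open>p\<close>; Lagrange's theorem applies.\<close>

lemma p_dvd_card_X: "p dvd card X"
proof -
  define H where "H = \<lparr>carrier = X, monoid.mult = (\<lambda>\<mu> \<nu>. \<lambda>n\<in>N. \<mu> n * \<nu> n), one = triv\<rparr>"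
  have closed: "(\<lambda>n\<in>N. \<mu> n * \<nu> n) \<in> X" if "\<mu> \<in> X" "\<nu> \<in> X" for \<mu> \<nu>
    by (rule X_I) (use X_D[OF that(1)] X_D[OF that(2)] R_sub in auto)
  have inv: "\<exists>\<nu>\<in>X. (\<lambda>n\<in>N. \<nu> n * \<mu> n) = triv" if "\<mu> \<in> X" for \<mu>
  proof
    show "(\<lambda>n\<in>N. inverse (\<mu> n)) \<in> X" by (rule X_I) (use X_D[OF that] R_sub in auto)
    show "(\<lambda>n\<in>N. (\<lambda>n\<in>N. inverse (\<mu> n)) n * \<mu> n) = triv" using X_D[OF that] by auto
  qed
  have ext: "(\<lambda>n\<in>N. \<mu> n) = \<mu>" if "\<mu> \<in> X" for \<mu>
    using X_D(1)[OF that] by (auto simp: extensional_def)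
  interpret H: group H
  proof (rule groupI)
    fix \<mu> assume "\<mu> \<in> carrier H"
    then show "\<one>\<^bsub>H\<^esub> \<otimes>\<^bsub>H\<^esub> \<mu> = \<mu>" using ext[of \<mu>] by (simp add: H_def cong: restrict_cong)
    show "\<exists>\<nu>\<in>carrier H. \<nu> \<otimes>\<^bsub>H\<^esub> \<mu> = \<one>\<^bsub>H\<^esub>" using inv[of \<mu>] \<open>\<mu> \<in> carrier H\<close> by (simp add: H_def)
  qed (auto simp: H_def closed triv_X mult.assoc cong: restrict_cong)
  obtain \<mu> where \<mu>: "\<mu> \<in> X" "\<mu> \<noteq> triv" using nontriv by blast
  have \<mu>H: "\<mu> \<in> carrier H" using \<mu> by (simp add: H_def)
  have "\<mu> [^]\<^bsub>H\<^esub> k = (\<lambda>n\<in>N. \<mu> n ^ k)" for k :: nat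
    by (induction k) (auto simp: H_def nat_pow_def mult.commute cong: restrict_cong)
  then have "\<mu> [^]\<^bsub>H\<^esub> p = \<one>\<^bsub>H\<^esub>" using X_pow[OF \<mu>(1)] by (auto simp: H_def)
  then have "H.ord \<mu> dvd p" using H.pow_eq_id[OF \<mu>H] by blast
  moreover have "H.ord \<mu> \<noteq> 1" using H.ord_eq_1[OF \<mu>H] \<mu>(2) by (simp add: H_def)
  ultimately have "H.ord \<mu> = p" using p by (auto simp: prime_nat_iff)
  then show ?thesis using H.ord_dvd_group_order[OF \<mu>H] by (simp add: Coset.order_def H_def)
qed

lemma card_orb_stab:
  assumes "\<mu> \<in> X"
  shows "card (orb \<mu>) * card {g \<in> carrier G. act g \<mu> = \<mu>} = card (carrier G)"
    and "subgroup {g \<in> carrier G. act g \<mu> = \<mu>} G"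
  using card_orbit_stabilizer[where G = G and a = act and E = X, OF is_group act_X act_one act_mult assms]
  by (auto simp: orb_def Coset.order_def)

lemma orb_triv: "\<mu> \<in> X \<Longrightarrow> card (orb \<mu>) = 1 \<Longrightarrow> \<mu> = triv"
proof -
  assume \<mu>: "\<mu> \<in> X" "card (orb \<mu>) = 1"
  then have "orb \<mu> = {\<mu>}" using orb_self[of \<mu>] by (auto simp: card_1_singleton_iff)
  then have "act g \<mu> = \<mu>" if "g \<in> carrier G" for g using that unfolding orb_def by blast
  then show "\<mu> = triv" by (rule inv_triv[OF \<mu>(1)])
qed

text \<open>The fixed points \<open>V\<close> of a Sylow \<open>p\<close>-subgroup number 0 modulo
  \<open>p\<close> because |X| does, and the trivial character is among them, so there are at least
  \<open>p\<close>. Their stabilizers contain a Sylow \<open>p\<close>-subgroup and so have index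
  prime to \<open>p\<close>.\<close>

lemma p'_orbits:
  obtains V where "V \<subseteq> X" "card V \<ge> p" "\<And>\<mu>. \<mu> \<in> V \<Longrightarrow> \<not> p dvd card (orb \<mu>)"
proof -
  define a where "a = multiplicity p (Coset.order G)"
  have ord: "Coset.order G \<noteq> 0" using fin order_gt_0_iff_finite by simp
  obtain m where m: "Coset.order G = p ^ a * m" "\<not> p dvd m"
    using multiplicity_decompose'[of "Coset.order G" p] p ord unfolding a_def
    by (metis not_prime_unit)
  obtain S where S: "subgroup S G" "card S = p ^ a"
    using sylow_thm[OF p is_group m(1) fin] by blast
  interpret S: group "G\<lparr>carrier := S\<rparr>" using S(1) by (rule subgroup_imp_group)
  have Sc: "S \<subseteq> carrier G" using S(1) by (rule subgroup.subset)
  define V where "V = {\<mu> \<in> X. \<forall>g\<in>S. act g \<mu> = \<mu>}"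
  have "[card X = card V] (mod p)"
    using p_group_fixed_points[where G = "G\<lparr>carrier := S\<rparr>" and a = act and E = X and k = a and p = p]
      S Sc finite_X p by (auto simp: V_def Coset.order_def act_X act_one act_mult S.is_group subset_iff)
  then have "p dvd card V" using p_dvd_card_X by (simp add: cong_dvd_iff)
  moreover have "card V > 0"
  proof -
    have "triv \<in> V" using Sc conj_N by (auto simp: V_def triv_X act_def fun_eq_iff)
    then show ?thesis using finite_X by (auto simp: V_def card_gt_0_iff)
  qed
  ultimately have "card V \<ge> p" by (simp add: dvd_imp_le)
  moreover have "\<not> p dvd card (orb \<mu>)" if \<mu>: "\<mu> \<in> V" for \<mu>
  proof
    assume "p dvd card (orb \<mu>)"
    define T where "T = {g \<in> carrier G. act g \<mu> = \<mu>}"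
    have \<mu>X: "\<mu> \<in> X" using \<mu> by (simp add: V_def)
    have T: "subgroup T G" "card (orb \<mu>) * card T = p ^ a * m"
      using card_orb_stab[OF \<mu>X] m(1) by (auto simp: T_def Coset.order_def)
    have "S \<subseteq> T" using Sc \<mu> by (auto simp: T_def V_def)
    interpret T: group "G\<lparr>carrier := T\<rparr>" using T(1) by (rule subgroup_imp_group)
    have "subgroup S (G\<lparr>carrier := T\<rparr>)" using subgroup_incl[OF S(1) T(1) \<open>S \<subseteq> T\<close>] .
    from T.lagrange[OF this] have "p ^ a dvd card T"
      using S(2) by (metis dvd_triv_right Coset.order_def partial_object.select_convs(1) partial_object.update_convs(1) partial_object.surjective)
    \<comment> \<open>The stabilizer already absorbs the full \<open>p\<close>-part of |G|, so
      another factor \<open>p\<close> from the orbit is too much.\<close>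
    then have "p ^ a * p dvd p ^ a * m"
      using \<open>p dvd card (orb \<mu>)\<close> T(2) by (metis mult.commute mult_dvd_mono)
    then show False using m(2) p by simp
  qed
  ultimately show ?thesis using that[of V] by (auto simp: V_def)
qed

end

section \<open>The weighted sum of character degrees\<close>

lemma sum_fibers_le:
  fixes f :: "'a \<Rightarrow> 'b"
  assumes "finite B" and "\<And>b. b \<in> B \<Longrightarrow> card {c \<in> B. f c = f b} \<le> t"
  shows "card B \<le> t * card (f ` B)"
proof -
  have "card B = (\<Sum>y\<in>f ` B. card {c \<in> B. f c = y})"
    using sum.image_gen[OF assms(1), of "\<lambda>_. 1::nat" f] by simp
  also have "\<dots> \<le> (\<Sum>y\<in>f ` B. t)" using assms(2) by (intro sum_mono) auto
  finally show ?thesis by (simp add: mult.commute)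
qed

context split_mod_prime
begin

text \<open>Characters in the fiber of \<beta> agree with \<beta> on the stabilizer of
  \<open>\<mu>\<close>. Dividing by \<beta> embeds the fiber into the linear characters trivial on
  that stabilizer, of which there are at most as many as its index, the orbit size.\<close>

lemma monomial_fiber_card:
  assumes \<mu>: "\<mu> \<in> X" and B: "B \<subseteq> lin_chars G"
  shows "card B \<le> card (orb \<mu>) * card ((\<lambda>\<beta>. \<lambda>g\<in>carrier G. \<beta> g * ochar (orb \<mu>) g) ` B)"
proof (rule sum_fibers_le)
  show "finite B" using B finite_lin_chars[OF fin] finite_subset by blast
  define T where "T = {g \<in> carrier G. act g \<mu> = \<mu>}"
  define \<Gamma> where "\<Gamma> = {\<gamma> \<in> lin_chars G. \<forall>g\<in>T. \<gamma> g = 1}"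
  have T: "card (orb \<mu>) * card T = card (carrier G)" "subgroup T G"
    using card_orb_stab[OF \<mu>] by (auto simp: T_def)
  have Tc: "T \<subseteq> carrier G" by (auto simp: T_def)
  have Tpos: "card T > 0"
    using subgroup.one_closed[OF T(2)] finite_subset[OF Tc fin] by (auto simp: card_gt_0_iff)
  have "card \<Gamma> * card T \<le> card (orb \<mu>) * card T"
    using card_lin_chars_trivial_on[OF fin Tc] T(1) by (simp add: \<Gamma>_def)
  then have \<Gamma>: "card \<Gamma> \<le> card (orb \<mu>)" using Tpos by simp
  fix \<beta> assume "\<beta> \<in> B"
  then have \<beta>: "\<beta> \<in> lin_chars G" using B by auto
  define F where "F = {\<gamma> \<in> B. (\<lambda>g\<in>carrier G. \<gamma> g * ochar (orb \<mu>) g) = (\<lambda>g\<in>carrier G. \<beta> g * ochar (orb \<mu>) g)}"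
  define q where "q \<gamma> = (\<lambda>g\<in>carrier G. (\<lambda>g\<in>carrier G. inverse (\<beta> g)) g * \<gamma> g)" for \<gamma> :: "'a \<Rightarrow> complex"
  have "q \<gamma> \<in> \<Gamma>" if "\<gamma> \<in> F" for \<gamma>
  proof -
    have \<gamma>: "\<gamma> \<in> lin_chars G" using that B by (auto simp: F_def)
    have "\<gamma> g * ochar (orb \<mu>) g = \<beta> g * ochar (orb \<mu>) g" if "g \<in> carrier G" for g
      using \<open>\<gamma> \<in> F\<close> that by (auto simp: F_def dest: restrict_apply' fun_cong[where x = g])
    then have "\<gamma> g = \<beta> g" if "g \<in> T" for g
      using monomial_character_eqD(2)[OF inv_triv \<mu> \<mu> \<gamma> \<beta>] that by (auto simp: T_def)
    moreover have "q \<gamma> \<in> lin_chars G"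
      unfolding q_def by (rule lin_chars_mult[OF is_monoid lin_chars_inverse[OF is_monoid \<beta>] \<gamma>])
    ultimately show ?thesis using Tc lin_charsD(2)[OF \<beta>] by (auto simp: \<Gamma>_def q_def)
  qed
  moreover have "inj_on q F"
  proof (rule inj_onI)
    fix \<gamma> \<delta> assume "\<gamma> \<in> F" "\<delta> \<in> F" and eq: "q \<gamma> = q \<delta>"
    then have "\<gamma> \<in> lin_chars G" "\<delta> \<in> lin_chars G" using B by (auto simp: F_def)
    moreover have "\<gamma> g = \<delta> g" if "g \<in> carrier G" for g
      using fun_cong[OF eq, of g] that lin_charsD(2)[OF \<beta> that] by (simp add: q_def)
    ultimately show "\<gamma> = \<delta>" by (rule lin_chars_eqI)
  qed
  moreover have "finite \<Gamma>" using finite_lin_chars[OF fin] by (simp add: \<Gamma>_def)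
  ultimately have "card F \<le> card \<Gamma>" by (intro card_inj_on_le[of q]) auto
  then show "card {\<gamma> \<in> B. (\<lambda>g\<in>carrier G. \<gamma> g * ochar (orb \<mu>) g) =
      (\<lambda>g\<in>carrier G. \<beta> g * ochar (orb \<mu>) g)} \<le> card (orb \<mu>)"
    using \<Gamma> by (simp add: F_def)
qed

text \<open>Here \<open>w\<close> is the weight that an orbit of size \<open>t\<close> supplies per
  linear character. After multiplication by \<open>t\<close> the last two bounds have slack 4t - 2(p
  + 1) and (t - 2)(p + 1 - t); the second vanishes at t = 2, the dihedral case.\<close>

lemma orbit_weight:
  fixes t :: nat
  assumes "t \<ge> 2"
  defines "w \<equiv> ((real p + 3) * real t - 2 * (real p + 1)) / real t"
  shows "w \<ge> 0" "real t \<ge> (real p + 1) / 2 \<Longrightarrow> w \<ge> real p - 1" "real t \<le> real p + 1 \<Longrightarrow> w \<ge> real t"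
proof -
  have t: "real t \<ge> 2" using assms(1) by simp
  have "(real p + 3) * real t \<ge> (real p + 3) * 2" using t by (intro mult_left_mono) auto
  then show "w \<ge> 0" using t unfolding w_def by (intro divide_nonneg_nonneg) auto
  show "w \<ge> real p - 1" if "real t \<ge> (real p + 1) / 2"
  proof -
    have "(real p - 1) * real t \<le> (real p + 3) * real t - 2 * (real p + 1)"
      using that by (simp add: algebra_simps)
    then show ?thesis using t by (simp add: w_def pos_le_divide_eq)
  qed
  show "w \<ge> real t" if "real t \<le> real p + 1"
  proof -
    have "(real t - 2) * (real p + 1 - real t) \<ge> 0" using that t by simp
    then have "real t * real t \<le> (real p + 3) * real t - 2 * (real p + 1)"
      by (simp add: algebra_simps)
    then show ?thesis using t by (simp add: w_def pos_le_divide_eq)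
  qed
qed

text \<open>An arbitrary \<open>J\<close> between the two sets treats both averages at once: the
  constructed characters have degree prime to \<open>p\<close>, so they lie in \<open>J\<close>, and
  whatever else \<open>J\<close> contains beyond linear characters has nonnegative weight.\<close>

lemma weighted_degree_sum_nonneg:
  fixes k :: "complex set"
  assumes k: "0 \<in> k" "1 \<in> k" "\<And>x y. x \<in> k \<Longrightarrow> y \<in> k \<Longrightarrow> x + y \<in> k"
      "\<And>x y. x \<in> k \<Longrightarrow> y \<in> k \<Longrightarrow> x * y \<in> k" "\<And>z. z ^ p = 1 \<Longrightarrow> z \<in> k"
    and J: "Irr_over_p' k p G \<subseteq> J" "J \<subseteq> Irr_over k G"
  shows "(\<Sum>\<chi>\<in>J. (real p + 3) * real (char_degree G \<chi>) - 2 * (real p + 1)) \<ge> 0"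
proof -
  define w where "w d = (real p + 3) * real d - 2 * (real p + 1)" for d :: nat
  define B where "B = {\<beta> \<in> lin_chars G. \<forall>g\<in>carrier G. \<beta> g \<in> k}"
  have Bl: "B \<subseteq> lin_chars G" by (auto simp: B_def)
  obtain V where V: "V \<subseteq> X" "card V \<ge> p" "\<And>\<mu>. \<mu> \<in> V \<Longrightarrow> \<not> p dvd card (orb \<mu>)"
    using p'_orbits by blast
  \<comment> \<open>A set of orbits, since several elements of \<open>V\<close> may share an orbit
    whose characters must be counted once.\<close>
  define \<Omega> where "\<Omega> = orb ` (V - {triv})"
  define Y where "Y A = (\<lambda>\<beta>. \<lambda>g\<in>carrier G. \<beta> g * ochar A g) ` B" for A
  have finV: "finite V" using V(1) finite_X finite_subset by blast
  have fin\<Omega>: "finite \<Omega>" using finV by (simp add: \<Omega>_def)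
  have finB: "finite B" using finite_lin_chars[OF fin] Bl finite_subset by blast
  have finJ: "finite J" using J(2) finite_Irr[OF is_group fin] finite_subset[of J "Irr G"]
    by (auto simp: Irr_over_def)
  have orbit_card: "card A \<ge> 2" if A: "A \<in> \<Omega>" for A
  proof -
    obtain \<mu> where \<mu>: "\<mu> \<in> V" "\<mu> \<noteq> triv" "A = orb \<mu>" using A unfolding \<Omega>_def by blast
    then have "card A \<noteq> 1" using orb_triv V(1) by auto
    moreover have "card A \<noteq> 0" using \<mu> V(1) orb_self[of \<mu>] finite_orb[of \<mu>] by auto
    ultimately show ?thesis by simp
  qed
  have Y: "Y A \<subseteq> J - B" "\<And>\<chi>. \<chi> \<in> Y A \<Longrightarrow> char_degree G \<chi> = card A" "card B \<le> card A * card (Y A)"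
    if A: "A \<in> \<Omega>" for A
  proof -
    obtain \<mu> where \<mu>: "\<mu> \<in> V" "A = orb \<mu>" using A unfolding \<Omega>_def by blast
    have \<mu>X: "\<mu> \<in> X" using \<mu> V(1) by auto
    show "card B \<le> card A * card (Y A)" using monomial_fiber_card[OF \<mu>X Bl] by (simp add: Y_def \<mu>)
    show deg: "char_degree G \<chi> = card A" if "\<chi> \<in> Y A" for \<chi>
      using that Bl by (auto simp: Y_def \<mu> monomial_character(2)[OF \<mu>X] subset_iff)
    have "\<chi> \<in> J - B" if \<chi>: "\<chi> \<in> Y A" for \<chi>
    proof -
      obtain \<beta> where \<beta>: "\<beta> \<in> B" "\<chi> = (\<lambda>g\<in>carrier G. \<beta> g * ochar A g)" using \<chi> by (auto simp: Y_def)
      have "\<chi> \<in> Irr G" using monomial_character(1)[OF \<mu>X] \<beta> Bl by (auto simp: \<mu>)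
      moreover have "\<chi> g \<in> k" if g: "g \<in> carrier G" for g
      proof -
        have nuk: "\<nu> (nu g) \<in> k" if "\<nu> \<in> A" for \<nu>
        proof -
          have "\<nu> \<in> X" using that orb_subset[OF \<mu>X] by (auto simp: \<mu>)
          then show ?thesis using X_pow[of \<nu> "nu g"] nu(1)[OF g] k(5) by blast
        qed
        \<comment> \<open>For infinite \<open>F\<close> the sum is 0 by convention, so closure under
          0 covers that case.\<close>
        have sumk: "sum f F \<in> k" if "\<And>x. x \<in> F \<Longrightarrow> f x \<in> k" for f and F :: "('a \<Rightarrow> complex) set"
          using that by (induction F rule: infinite_finite_induct) (auto simp: k)
        have "ochar A g \<in> k" unfolding ochar_def by (rule sumk) (simp add: nuk)
        then show ?thesis using \<beta> g k(4) by (auto simp: B_def)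
      qed
      moreover have "\<not> p dvd char_degree G \<chi>" using deg[OF \<chi>] V(3)[OF \<mu>(1)] by (simp add: \<mu>)
      ultimately have "\<chi> \<in> Irr_over_p' k p G" by (auto simp: Irr_over_p'_def Irr_over_def)
      moreover have "\<chi> \<notin> B"
      proof
        assume "\<chi> \<in> B"
        then have "\<chi> \<in> {\<chi> \<in> Irr G. char_degree G \<chi> = 1}"
          using Bl degree_one_Irr[OF is_group] by auto
        then show False using deg[OF \<chi>] orbit_card[OF A] by simp
      qed
      ultimately show ?thesis using J(1) by auto
    qed
    then show "Y A \<subseteq> J - B" by auto
  qed
  have disj: "Y A \<inter> Y A' = {}" if AA': "A \<in> \<Omega>" "A' \<in> \<Omega>" "A \<noteq> A'" for A A'
  proof (rule ccontr)
    assume "Y A \<inter> Y A' \<noteq> {}"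
    then obtain \<chi> where "\<chi> \<in> Y A" "\<chi> \<in> Y A'" by auto
    then obtain \<beta> \<gamma> where bg: "\<beta> \<in> lin_chars G" "\<gamma> \<in> lin_chars G"
      "(\<lambda>g\<in>carrier G. \<beta> g * ochar A g) = (\<lambda>g\<in>carrier G. \<gamma> g * ochar A' g)"
      using Bl by (auto simp: Y_def)
    obtain \<mu> \<mu>' where \<mu>: "\<mu> \<in> X" "A = orb \<mu>" "\<mu>' \<in> X" "A' = orb \<mu>'"
      using AA' V(1) unfolding \<Omega>_def by blast
    have "\<beta> g * ochar A g = \<gamma> g * ochar A' g" if "g \<in> carrier G" for g
      using fun_cong[OF bg(3), of g] that by simp
    then have "orb \<mu> = orb \<mu>'"
      using monomial_character_eqD(1)[OF inv_triv \<mu>(1,3) bg(1,2)] \<mu> by auto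
    then show False using AA' \<mu> by simp
  qed
  have deg1: "char_degree G \<chi> = 1 \<longleftrightarrow> \<chi> \<in> B" if "\<chi> \<in> J" for \<chi>
    using that J(2) degree_one_Irr[OF is_group] by (auto simp: B_def Irr_over_def)
  have BJ: "B \<subseteq> J"
  proof -
    have "\<chi> \<in> Irr G \<and> char_degree G \<chi> = 1" if "\<chi> \<in> B" for \<chi>
      using that Bl degree_one_Irr[OF is_group] by blast
    then have "B \<subseteq> Irr_over_p' k p G"
      using prime_gt_1_nat[OF p] by (auto simp: B_def Irr_over_p'_def Irr_over_def)
    then show ?thesis using J(1) by auto
  qed
  have w_nonneg: "w (char_degree G \<chi>) \<ge> 0" if "\<chi> \<in> J - B" for \<chi>
  proof -
    have "\<chi> \<in> Irr G" using that J(2) by (auto simp: Irr_over_def)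
    then obtain \<rho> n where \<rho>: "\<chi> = rep_character G \<rho>" "irreducible_rep G n \<rho>" by (auto simp: Irr_def)
    then have "char_degree G \<chi> = n" "n > 0"
      using char_degree_rep_character(2)[OF is_group, of n \<rho>] by (auto simp: irreducible_rep_def)
    moreover have "char_degree G \<chi> \<noteq> 1" using deg1 that by auto
    ultimately have "real (char_degree G \<chi>) \<ge> 2" by simp
    then have "(real p + 3) * real (char_degree G \<chi>) \<ge> (real p + 3) * 2" by (intro mult_left_mono) auto
    then show ?thesis by (simp add: w_def)
  qed
  define v where "v A = w (card A) / real (card A)" for A :: "('a \<Rightarrow> complex) set"
  have v: "v A \<ge> 0" "real (card A) \<ge> (real p + 1) / 2 \<Longrightarrow> v A \<ge> real p - 1"
    "real (card A) \<le> real p + 1 \<Longrightarrow> v A \<ge> real (card A)" if "A \<in> \<Omega>" for A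
    using orbit_weight[OF orbit_card[OF that]] by (simp_all add: v_def w_def)
  have sum_v: "(\<Sum>A\<in>\<Omega>. v A) \<ge> real p - 1"
  proof (cases "\<exists>A\<in>\<Omega>. real (card A) \<ge> (real p + 1) / 2")
    case True
    then obtain A where A: "A \<in> \<Omega>" "real (card A) \<ge> (real p + 1) / 2" by blast
    have "v A \<le> (\<Sum>A\<in>\<Omega>. v A)" using fin\<Omega> A v(1) by (intro member_le_sum) auto
    then show ?thesis using v(2)[OF A] by simp
  next
    case False
    have "V - {triv} \<subseteq> \<Union>\<Omega>" using V(1) orb_self by (auto simp: \<Omega>_def)
    moreover have "finite (\<Union>\<Omega>)" using fin\<Omega> finite_orb by (auto simp: \<Omega>_def)
    ultimately have "card (V - {triv}) \<le> card (\<Union>\<Omega>)" by (rule card_mono[rotated])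
    also have "\<dots> \<le> (\<Sum>A\<in>\<Omega>. card A)" by (rule card_Union_le_sum_card)
    finally have "real (card (V - {triv})) \<le> (\<Sum>A\<in>\<Omega>. real (card A))" by (metis of_nat_le_iff of_nat_sum)
    \<comment> \<open>At most one element is lost, whether or not \<open>V\<close> contains
      \<open>triv\<close>; the remaining characters are covered by the orbits.\<close>
    moreover have "card (V - {triv}) \<ge> card V - 1" using finV by (simp add: card_Diff_singleton_if)
    moreover have "(\<Sum>A\<in>\<Omega>. real (card A)) \<le> (\<Sum>A\<in>\<Omega>. v A)"
    proof (rule sum_mono)
      fix A assume A: "A \<in> \<Omega>"
      have "real (card A) < (real p + 1) / 2" using False A by auto
      then have "real (card A) \<le> real p + 1" by simp
      then show "real (card A) \<le> v A" by (rule v(3)[OF A])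
    qed
    ultimately show ?thesis using V(2) prime_gt_1_nat[OF p] by linarith
  qed
  have "real (card B) * (real p - 1) \<le> (\<Sum>A\<in>\<Omega>. real (card B) * v A)"
    using sum_v by (simp add: sum_distrib_left[symmetric] mult_left_mono)
  also have "\<dots> \<le> (\<Sum>A\<in>\<Omega>. \<Sum>\<chi>\<in>Y A. w (char_degree G \<chi>))"
  proof (rule sum_mono)
    fix A assume A: "A \<in> \<Omega>"
    \<comment> \<open>The fiber bound is multiplied by \<open>v A\<close>, which is nonnegative; the
      factor \<open>card A\<close> then cancels the denominator of \<open>v A\<close>.\<close>
    have "real (card B) * v A \<le> real (card A * card (Y A)) * v A"
      using Y(3)[OF A] v(1)[OF A] by (intro mult_right_mono) (simp_all only: of_nat_le_iff)
    also have "\<dots> = (\<Sum>\<chi>\<in>Y A. w (card A))" using orbit_card[OF A] by (simp add: v_def)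
    also have "\<dots> = (\<Sum>\<chi>\<in>Y A. w (char_degree G \<chi>))" using Y(2)[OF A] by (intro sum.cong) auto
    finally show "real (card B) * v A \<le> (\<Sum>\<chi>\<in>Y A. w (char_degree G \<chi>))" .
  qed
  also have "\<dots> = (\<Sum>\<chi>\<in>(\<Union>A\<in>\<Omega>. Y A). w (char_degree G \<chi>))"
    using fin\<Omega> finB disj by (intro sum.UNION_disjoint[symmetric]) (auto simp: Y_def)
  also have "\<dots> \<le> (\<Sum>\<chi>\<in>J - B. w (char_degree G \<chi>))"
    using finJ Y(1) w_nonneg by (intro sum_mono2) auto
  finally have 1: "real (card B) * (real p - 1) \<le> (\<Sum>\<chi>\<in>J - B. w (char_degree G \<chi>))" .
  have "(\<Sum>\<chi>\<in>B. w (char_degree G \<chi>)) = (\<Sum>\<chi>\<in>B. - (real p - 1))"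
  proof (rule sum.cong[OF refl])
    fix \<chi> assume "\<chi> \<in> B"
    then have "char_degree G \<chi> = 1" using deg1 BJ by blast
    then show "w (char_degree G \<chi>) = - (real p - 1)" by (simp add: w_def)
  qed
  then have "(\<Sum>\<chi>\<in>J. w (char_degree G \<chi>)) \<ge> 0"
    using 1 sum.subset_diff[OF BJ finJ, of "\<lambda>\<chi>. w (char_degree G \<chi>)"] by (simp add: algebra_simps)
  then show ?thesis by (simp add: w_def)
qed

end

section \<open>Normal subgroups of solvable groups and quotients\<close>

lemma (in group) card_subgroup_dvd:
  assumes "subgroup A G" "subgroup B G" "A \<subseteq> B"
  shows "card A dvd card B"
proof -
  interpret B: group "G\<lparr>carrier := B\<rparr>" using assms(2) by (rule subgroup_imp_group)
  have "subgroup A (G\<lparr>carrier := B\<rparr>)" by (rule subgroup_incl[OF assms])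
  from B.lagrange[OF this] show ?thesis by (metis dvd_triv_right Coset.order_def partial_object.select_convs(1) partial_object.update_convs(1) partial_object.surjective)
qed

text \<open>\<open>sylow_thm\<close> with exponent 1 yields a subgroup of order exactly
  \<open>r\<close>, even if higher powers of \<open>r\<close> divide the order.\<close>

lemma (in group) cauchy_subgroup:
  assumes A: "subgroup A G" "finite A" and r: "prime r" "r dvd card A"
  shows "\<exists>x\<in>A. x \<noteq> \<one> \<and> x [^] r = \<one>"
proof -
  interpret A: group "G\<lparr>carrier := A\<rparr>" using A(1) by (rule subgroup_imp_group)
  obtain m where "card A = r ^ 1 * m" using r(2) by auto
  then obtain S where S: "subgroup S (G\<lparr>carrier := A\<rparr>)" "card S = r"
    using sylow_thm[OF r(1) A.is_group, of 1 m] A(2) by (auto simp: Coset.order_def)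
  have SA: "S \<subseteq> A" using subgroup.subset[OF S(1)] by simp
  have SG: "subgroup S G" using incl_subgroup[OF A(1) S(1)] .
  interpret S: group "G\<lparr>carrier := S\<rparr>" using SG by (rule subgroup_imp_group)
  have "card S > 1" using S(2) prime_gt_1_nat[OF r(1)] by simp
  have "\<not> S \<subseteq> {\<one>}"
  proof
    assume "S \<subseteq> {\<one>}"
    then have "card S \<le> card {\<one>}" by (intro card_mono) auto
    then show False using \<open>card S > 1\<close> by simp
  qed
  then obtain x where x: "x \<in> S" "x \<noteq> \<one>" by blast
  have "x [^]\<^bsub>G\<lparr>carrier := S\<rparr>\<^esub> r = \<one>" using S.pow_order_eq_1[of x] x S(2) by (simp add: Coset.order_def)
  then have "x [^] r = \<one>" by (simp add: nat_pow_consistent[symmetric])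
  then show ?thesis using x SA by blast
qed

lemma (in group) pow_coprime_eq_one:
  fixes m n :: nat
  assumes "x \<in> carrier G" "x [^] m = \<one>" "x [^] n = \<one>" "coprime m n"
  shows "x = \<one>"
proof -
  have "ord x dvd m" "ord x dvd n" using assms pow_eq_id by auto
  then have "ord x = 1" using assms(4) by (metis coprime_common_divisor_nat)
  then show ?thesis using ord_eq_1[OF assms(1)] by simp
qed

text \<open>In a minimal normal subgroup \<open>N\<close> inside \<open>K\<close>, the derived
  subgroup is normal in \<open>G\<close> and proper by solvability, hence trivial. The elements
  killed by a prime \<open>r\<close> dividing |N| then form a nontrivial normal subgroup, hence all
  of \<open>N\<close>, and Cauchy's theorem excludes other prime divisors.\<close>

lemma (in group) elementary_abelian_normal_subgroup:
  assumes fin: "finite (carrier G)" and solv: "solvable G" and K: "K \<lhd> G" "K \<noteq> {\<one>}"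
  shows "\<exists>N r. prime r \<and> N \<lhd> G \<and> N \<noteq> {\<one>} \<and> N \<subseteq> K \<and> (\<exists>a. card N = r ^ a) \<and>
    (\<forall>x\<in>N. \<forall>y\<in>N. x \<otimes> y = y \<otimes> x) \<and> (\<forall>x\<in>N. x [^] r = \<one>) \<and>
    (\<forall>T. T \<lhd> G \<and> T \<subseteq> N \<longrightarrow> T = {\<one>} \<or> T = N)"
proof -
  obtain N where N: "N \<lhd> G" "N \<noteq> {\<one>}" "N \<subseteq> K"
    and min: "\<And>T. T \<lhd> G \<Longrightarrow> T \<noteq> {\<one>} \<Longrightarrow> T \<subseteq> K \<Longrightarrow> card N \<le> card T"
    using ex_has_least_nat[of "\<lambda>N. N \<lhd> G \<and> N \<noteq> {\<one>} \<and> N \<subseteq> K" K card] K by auto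
  interpret N: normal N G by (rule N(1))
  have finN: "finite N" using fin N.subset finite_subset by blast
  have minimal: "T = {\<one>} \<or> T = N" if "T \<lhd> G" "T \<subseteq> N" for T
  proof (cases "T = {\<one>}")
    case False
    then have "card N \<le> card T" using min[OF that(1)] that(2) N(3) by auto
    then have "card T = card N" using card_mono[OF finN that(2)] by (rule antisym[rotated])
    then have "T = N" by (rule card_subset_eq[OF finN that(2)])
    then show ?thesis by blast
  qed simp
  have "derived G N \<noteq> N"
  proof
    assume eq: "derived G N = N"
    \<comment> \<open>A perfect \<open>N\<close> would survive every step of the derived series of
      \<open>G\<close>.\<close>
    have fix_N: "(derived G ^^ n) N = N" for n by (induction n) (simp_all add: eq)
    obtain n where "(derived G ^^ n) (carrier G) = {\<one>}"
      using solv solvable_imp_trivial_derived_seq unfolding solvable_def by blast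
    then have "N \<subseteq> {\<one>}"
      using mono_exp_of_derived[OF N.subset, of n] fix_N by auto
    then show False using N(2) N.one_closed by auto
  qed
  then have der: "derived G N = {\<one>}"
    using minimal[OF derived_is_normal[OF N(1)] derived_incl[OF subset_refl N.subgroup_axioms]] \<open>derived G N \<noteq> N\<close> by blast
  have comm: "x \<otimes> y = y \<otimes> x" if xy: "x \<in> N" "y \<in> N" for x y
  proof -
    have "x \<otimes> y \<otimes> inv x \<otimes> inv y \<in> derived G N"
      unfolding derived_def by (rule generate.incl) (use xy in auto)
    then have "x \<otimes> y \<otimes> inv x \<otimes> inv y = \<one>" using der by simp
    then have "(x \<otimes> y) \<otimes> inv (y \<otimes> x) = \<one>" using xy by (simp add: inv_mult_group m_assoc)
    then show ?thesis using xy by (metis N.mem_carrier inv_equality inv_inv inv_closed m_closed)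
  qed
  have "card N \<noteq> 1" using N(2) N.one_closed by (metis card_1_singletonE singletonD)
  then obtain r where r: "prime r" "r dvd card N" using prime_factor_nat by blast
  define E where "E = {x \<in> N. x [^] r = \<one>}"
  have powN: "x [^] (k::nat) \<in> N" if "x \<in> N" for x k using that by (induction k) auto
  have pow_mult: "(x \<otimes> y) [^] (k::nat) = x [^] k \<otimes> y [^] k" if "x \<in> N" "y \<in> N" for x y k
    using pow_mult_distrib[OF comm[OF that]] that by simp
  have "E \<lhd> G"
  proof (rule normal_invI)
    show "subgroup E G"
      by (rule subgroupI) (auto simp: E_def pow_mult nat_pow_inv intro!: exI[of _ \<one>])
    fix g x assume g: "g \<in> carrier G" and x: "x \<in> E"
    have xc: "x \<in> carrier G" using x by (auto simp: E_def)
    have "(g \<otimes> x \<otimes> inv g) [^] (k::nat) = g \<otimes> x [^] k \<otimes> inv g" for k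
      by (induction k) (use g xc in \<open>simp_all add: m_assoc inv_cancel_left\<close>)
    then show "g \<otimes> x \<otimes> inv g \<in> E" using x g N.inv_op_closed2[OF g] by (simp add: E_def)
  qed
  moreover have "E \<noteq> {\<one>}" using cauchy_subgroup[OF N.subgroup_axioms finN r] by (auto simp: E_def)
  moreover have "E \<subseteq> N" by (auto simp: E_def)
  ultimately have "E = N" using minimal by blast
  then have expo: "x [^] r = \<one>" if "x \<in> N" for x using that by (auto simp: E_def)
  have "\<exists>a. card N = r ^ a"
  proof -
    have "card N \<noteq> 0" using finN N.one_closed by (metis card_0_eq empty_iff)
    then obtain m where m: "card N = r ^ multiplicity r (card N) * m" "\<not> r dvd m"
      using multiplicity_decompose'[of "card N" r] r(1) by (metis not_prime_unit)
    have "m = 1"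
    proof (rule ccontr)
      assume "m \<noteq> 1"
      then obtain s where s: "prime s" "s dvd m" using prime_factor_nat by blast
      then have "s dvd card N" using m(1) by (metis dvd_mult)
      then obtain x where x: "x \<in> N" "x \<noteq> \<one>" "x [^] s = \<one>"
        using cauchy_subgroup[OF N.subgroup_axioms finN s(1)] by blast
      have "s \<noteq> r" using s m(2) by auto
      then have "coprime s r" using s(1) r(1) primes_coprime by blast
      then show False using pow_coprime_eq_one[OF _ x(3) expo[OF x(1)]] x by auto
    qed
    then show ?thesis using m(1) by (metis mult.right_neutral)
  qed
  note cardN = this
  show ?thesis
    by (rule exI[of _ N], rule exI[of _ r]) (use r(1) N comm expo minimal cardN in auto)
qed

section \<open>Correspondence of subgroups along a surjection\<close>

locale surj_group_hom = group_hom +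
  assumes surj: "h ` carrier G = carrier H" and finG: "finite (carrier G)"
begin

definition pre where "pre A = {g \<in> carrier G. h g \<in> A}"

lemma pre_subgroup: "subgroup A H \<Longrightarrow> subgroup (pre A) G"
  by (rule G.subgroupI)
    (auto simp: pre_def subgroup.m_closed subgroup.m_inv_closed subgroup.one_closed intro!: exI[of _ \<one>])

lemma pre_normal:
  assumes "A \<lhd> H"
  shows "pre A \<lhd> G"
proof (rule G.normal_invI)
  show "subgroup (pre A) G" using assms pre_subgroup normal_imp_subgroup by blast
qed (use normal.inv_op_closed2[OF assms] in \<open>auto simp: pre_def\<close>)

lemma image_pre: "A \<subseteq> carrier H \<Longrightarrow> h ` pre A = A"
proof -
  assume "A \<subseteq> carrier H"
  then have "A \<subseteq> h ` carrier G" by (simp only: surj)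
  then show "h ` pre A = A" by (auto simp: pre_def)
qed

lemma pre_image:
  assumes K: "subgroup K G" "kernel G H h \<subseteq> K"
  shows "pre (h ` K) = K"
proof -
  have "g \<in> K" if g: "g \<in> carrier G" "x \<in> K" "h g = h x" for g x
  proof -
    have x: "x \<in> carrier G" using K(1) g(2) by (meson subgroup.mem_carrier)
    have "g \<otimes> inv x \<in> kernel G H h" using g x by (simp add: kernel_def)
    then have "g \<otimes> inv x \<otimes> x \<in> K" using K g(2) by (meson subgroup.m_closed subsetD)
    then show ?thesis using g x by (simp add: G.m_assoc)
  qed
  then show ?thesis using subgroup.subset[OF K(1)] by (auto simp: pre_def)
qed

lemma image_normal: "K \<lhd> G \<Longrightarrow> h ` K \<lhd> H"
  using normal.surj_hom_normal_subgroup[OF _ group_hom_axioms surj] .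

text \<open>The fibers of \<open>h\<close> are translates of its kernel.\<close>

lemma card_pre:
  assumes "A \<subseteq> carrier H"
  shows "card (pre A) = card (kernel G H h) * card A"
proof -
  have fin: "finite (pre A)" using finG by (simp add: pre_def)
  have "card {g \<in> pre A. h g = y} = card (kernel G H h)" if y: "y \<in> A" for y
  proof -
    have "y \<in> h ` carrier G" unfolding surj using y assms by (rule subsetD[rotated])
    then obtain x where x: "x \<in> carrier G" "h x = y" by auto
    have "bij_betw (\<lambda>k. k \<otimes> x) (kernel G H h) {g \<in> pre A. h g = y}"
    proof (rule bij_betw_byWitness[where f' = "\<lambda>g. g \<otimes> inv x"])
      show "(\<lambda>k. k \<otimes> x) ` kernel G H h \<subseteq> {g \<in> pre A. h g = y}"
        using x y assms by (auto simp: kernel_def pre_def)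
      show "(\<lambda>g. g \<otimes> inv x) ` {g \<in> pre A. h g = y} \<subseteq> kernel G H h"
        using x y assms by (auto simp: kernel_def pre_def)
    qed (use x in \<open>auto simp: kernel_def pre_def G.m_assoc\<close>)
    from bij_betw_same_card[OF this] show ?thesis by (rule sym)
  qed
  moreover have "card (pre A) = (\<Sum>y\<in>h ` pre A. card {g \<in> pre A. h g = y})"
    using sum.image_gen[OF fin, of "\<lambda>_. 1::nat" h] by simp
  ultimately show ?thesis by (simp add: image_pre[OF assms])
qed

end

text \<open>For normal \<open>T\<close> this is \<open>p\<close>-nilpotency of
  \<open>G Mod T\<close>, with the complement given by its preimage \<open>K\<close>. Speaking of
  subgroups of \<open>G\<close> allows quotients of a quotient to be treated without iterated
  quotient types.\<close>

definition p_nilpotent_mod :: "nat \<Rightarrow> ('a, 'b) monoid_scheme \<Rightarrow> 'a set \<Rightarrow> bool" where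
  "p_nilpotent_mod p G T \<longleftrightarrow> (\<exists>K. K \<lhd> G \<and> T \<subseteq> K \<and> coprime p (card K div card T) \<and>
     (\<exists>j. card (rcosets\<^bsub>G\<^esub> K) = p ^ j))"

lemma (in group) p_nilpotent_mod_one: "p_nilpotent_mod p G {\<one>} \<longleftrightarrow> p_nilpotent p G"
proof -
  have "{\<one>} \<subseteq> K" if "K \<lhd> G" for K
    using subgroup.one_closed[OF normal_imp_subgroup[OF that]] by simp
  then show ?thesis by (auto simp: p_nilpotent_mod_def p_nilpotent_def)
qed

text \<open>The preimage \<open>K\<close> of the complement of \<open>G/T\<close> has order |T|
  |K/T|, so it is itself a normal complement in \<open>G\<close>.\<close>

lemma (in group) coprime_normal_imp_p_nilpotent:
  assumes fin: "finite (carrier G)" and T: "T \<lhd> G" "coprime p (card T)"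
    and "p_nilpotent_mod p G T"
  shows "p_nilpotent p G"
proof -
  obtain K j where K: "K \<lhd> G" "T \<subseteq> K" "coprime p (card K div card T)" "card (rcosets K) = p ^ j"
    using assms by (auto simp: p_nilpotent_mod_def)
  have "card T dvd card K" by (rule card_subgroup_dvd[OF normal_imp_subgroup[OF T(1)] normal_imp_subgroup[OF K(1)] K(2)])
  then have "card K = card T * (card K div card T)" by simp
  then have "coprime p (card K)" using T(2) K(3) by (metis coprime_mult_right_iff)
  then show ?thesis using K by (auto simp: p_nilpotent_def)
qed

context surj_group_hom
begin

lemma index_pre:
  assumes "subgroup A H"
  shows "card (rcosets\<^bsub>G\<^esub> (pre A)) = card (rcosets\<^bsub>H\<^esub> A)"
proof -
  have Ac: "A \<subseteq> carrier H" using assms by (rule subgroup.subset)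
  have "pre (carrier H) = carrier G" by (auto simp: pre_def)
  then have ord: "card (carrier G) = card (kernel G H h) * card (carrier H)"
    using card_pre[of "carrier H"] by simp
  have pos: "card (pre A) > 0"
    using subgroup.one_closed[OF pre_subgroup[OF assms]] finG by (auto simp: pre_def card_gt_0_iff)
  have "card (rcosets\<^bsub>G\<^esub> (pre A)) * card (pre A) = card (carrier G)"
    using G.lagrange[OF pre_subgroup[OF assms]] by (simp add: Coset.order_def)
  moreover have "card (rcosets\<^bsub>H\<^esub> A) * card A = card (carrier H)"
    using H.lagrange[OF assms] by (simp add: Coset.order_def)
  ultimately have "card (rcosets\<^bsub>G\<^esub> (pre A)) * card (pre A) = card (rcosets\<^bsub>H\<^esub> A) * card (pre A)"
    using ord card_pre[OF Ac] by (metis mult.left_commute)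
  then show ?thesis using pos by simp
qed

text \<open>Normal subgroups of \<open>H\<close> correspond to those of \<open>G\<close> above the
  kernel, and this preserves both indices and order quotients.\<close>

lemma p_nilpotent_mod_pre:
  assumes T: "T \<lhd> H"
  shows "p_nilpotent_mod p G (pre T) \<longleftrightarrow> p_nilpotent_mod p H T"
proof -
  have kpos: "card (kernel G H h) > 0"
    using finG subgroup.one_closed[OF subgroup_kernel] by (auto simp: kernel_def card_gt_0_iff)
  have Tc: "T \<subseteq> carrier H" using T normal_imp_subgroup subgroup.subset by blast
  have ker: "kernel G H h \<subseteq> pre T"
    using subgroup.one_closed[OF normal_imp_subgroup[OF T]] by (auto simp: kernel_def pre_def)
  have quot: "card (pre A) div card (pre T) = card A div card T" if "A \<subseteq> carrier H" for A
    using kpos by (simp add: card_pre that Tc)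
  show ?thesis
  proof
    assume "p_nilpotent_mod p H T"
    then obtain A j where A: "A \<lhd> H" "T \<subseteq> A" "coprime p (card A div card T)" "card (rcosets\<^bsub>H\<^esub> A) = p ^ j"
      by (auto simp: p_nilpotent_mod_def)
    have sA: "subgroup A H" using A(1) normal_imp_subgroup by blast
    have "pre T \<subseteq> pre A" using A(2) by (auto simp: pre_def)
    then show "p_nilpotent_mod p G (pre T)"
      unfolding p_nilpotent_mod_def using pre_normal[OF A(1)] A quot[OF subgroup.subset[OF sA]] index_pre[OF sA] by metis
  next
    assume "p_nilpotent_mod p G (pre T)"
    then obtain K j where K: "K \<lhd> G" "pre T \<subseteq> K" "coprime p (card K div card (pre T))" "card (rcosets\<^bsub>G\<^esub> K) = p ^ j"
      by (auto simp: p_nilpotent_mod_def)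
    have A: "h ` K \<lhd> H" by (rule image_normal[OF K(1)])
    have sA: "subgroup (h ` K) H" using A normal_imp_subgroup by blast
    have eq: "pre (h ` K) = K" using pre_image[OF normal_imp_subgroup[OF K(1)]] ker K(2) by blast
    have "T \<subseteq> h ` K" using image_pre[OF Tc] K(2) by blast
    then show "p_nilpotent_mod p H T"
      unfolding p_nilpotent_mod_def
      using A K quot[OF subgroup.subset[OF sA]] index_pre[OF sA] eq by metis
  qed
qed

end

lemma (in normal) surj_group_hom_Mod:
  assumes "finite (carrier G)"
  shows "surj_group_hom G (G Mod H) (\<lambda>a. H #> a)" "kernel G (G Mod H) (\<lambda>a. H #> a) = H"
proof -
  show "surj_group_hom G (G Mod H) (\<lambda>a. H #> a)"
    by (intro surj_group_hom.intro group_hom.intro group_hom_axioms.intro surj_group_hom_axioms.intro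
        is_group factorgroup_is_group r_coset_hom_Mod assms) (simp add: carrier_FactGroup)
  show "kernel G (G Mod H) (\<lambda>a. H #> a) = H"
    using coset_join1[OF _ _ subgroup_axioms] coset_join2[OF _ subgroup_axioms] subset
    by (auto simp: kernel_def)
qed

text \<open>Let \<open>M\<close> be a proper subgroup of greatest order and \<open>x\<close> outside
  it. Then the group is generated by \<open>M\<close> and \<open>x\<close>, and a power of
  \<open>x\<close> in \<open>M\<close> has exponent divisible by \<open>p\<close>. So sending m x^i
  to \<zeta>^i, for a \<open>p\<close>th root of unity \<zeta> other than 1, is well
  defined.\<close>

lemma (in group) lin_char_exists:
  fixes p :: nat
  assumes fin: "finite (carrier G)" and comm: "\<And>x y. x \<in> carrier G \<Longrightarrow> y \<in> carrier G \<Longrightarrow> x \<otimes> y = y \<otimes> x"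
    and p: "prime p" and expo: "\<And>x. x \<in> carrier G \<Longrightarrow> x [^] p = \<one>" and nontriv: "carrier G \<noteq> {\<one>}"
  shows "\<exists>\<beta>\<in>lin_chars G. \<exists>x\<in>carrier G. \<beta> x \<noteq> 1"
proof -
  have "\<exists>M. (subgroup M G \<and> M \<noteq> carrier G) \<and> (\<forall>M'. subgroup M' G \<and> M' \<noteq> carrier G \<longrightarrow> card M' \<le> card M)"
  proof (rule ex_has_greatest_nat)
    show "subgroup {\<one>} G \<and> {\<one>} \<noteq> carrier G" using triv_subgroup nontriv by auto
    show "\<forall>M'. subgroup M' G \<and> M' \<noteq> carrier G \<longrightarrow> card M' < Suc (card (carrier G))"
      using fin by (auto simp: less_Suc_eq_le intro: card_mono dest: subgroup.subset)
  qed
  then obtain M where M: "subgroup M G" "M \<noteq> carrier G"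
    and max: "\<And>M'. subgroup M' G \<Longrightarrow> M' \<noteq> carrier G \<Longrightarrow> card M' \<le> card M" by blast
  interpret M: subgroup M G by (rule M(1))
  obtain x where x: "x \<in> carrier G" "x \<notin> M" using M M.subset by blast
  \<comment> \<open>An exponent prime to \<open>p\<close> is invertible modulo \<open>p\<close>, so
    \<open>x\<close> would be a power of an element of \<open>M\<close>.\<close>
  have xM: "p dvd i" if "x [^] (i::nat) \<in> M" for i
  proof (rule ccontr)
    assume "\<not> p dvd i"
    then have "coprime i p" using prime_imp_coprime[OF p] coprime_commute by blast
    then obtain u where u: "[i * u = 1] (mod p)" using cong_solve_coprime_nat[of i p] by auto
    have "(x [^] i) [^] u \<in> M" using that by (induction u) auto
    then have "x [^] (i * u) \<in> M" using x by (simp add: nat_pow_pow)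
    moreover have "x [^] (i * u) = x"
    proof -
      have "1 mod p = 1" using prime_gt_1_nat[OF p] by simp
      then have "i * u = p * (i * u div p) + 1" using u by (metis cong_def mult_div_mod_eq)
      then have "x [^] (i * u) = (x [^] p) [^] (i * u div p) \<otimes> x"
        using x by (metis nat_pow_pow nat_pow_mult nat_pow_eone nat_pow_closed)
      then show ?thesis using expo[OF x(1)] x by simp
    qed
    ultimately show False using x by simp
  qed
  define S where "S = {m \<otimes> x [^] (i::nat) | m i. m \<in> M}"
  have MS: "M \<subseteq> S"
  proof
    fix m assume "m \<in> M"
    then have "m = m \<otimes> x [^] (0::nat)" by simp
    then show "m \<in> S" using \<open>m \<in> M\<close> unfolding S_def by blast
  qed
  have xS: "x \<in> S"
  proof -
    have "x = \<one> \<otimes> x [^] (1::nat)" using x by simp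
    then show ?thesis unfolding S_def using M.one_closed by blast
  qed
  have S: "subgroup S G"
  proof (rule subgroupI)
    show "S \<subseteq> carrier G" using x by (auto simp: S_def)
    show "S \<noteq> {}" using xS by auto
    fix s assume "s \<in> S"
    then obtain m i where s: "m \<in> M" "s = m \<otimes> x [^] (i::nat)" by (auto simp: S_def)
    \<comment> \<open>Exponents are natural numbers, so the inverse of x^i is written as x^((p - 1)
      i).\<close>
    have "x [^] i \<otimes> x [^] ((p - 1) * i) = (x [^] p) [^] i"
      using x prime_gt_0_nat[OF p] by (simp add: nat_pow_mult nat_pow_pow diff_mult_distrib)
    then have "x [^] i \<otimes> x [^] ((p - 1) * i) = \<one>" using expo[OF x(1)] by simp
    then have "inv (x [^] i) = x [^] ((p - 1) * i)" using x by (metis comm inv_equality nat_pow_closed)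
    then have "inv s = inv m \<otimes> x [^] ((p - 1) * i)"
      using s x comm by (simp add: inv_mult_group)
    then show "inv s \<in> S" using s by (auto simp: S_def)
    fix s' assume "s' \<in> S"
    then obtain m' i' where s': "m' \<in> M" "s' = m' \<otimes> x [^] (i'::nat)" by (auto simp: S_def)
    have "s \<otimes> s' = m \<otimes> (x [^] i \<otimes> m') \<otimes> x [^] i'" using s s' x by (simp add: m_assoc)
    also have "x [^] i \<otimes> m' = m' \<otimes> x [^] i" using s' x by (intro comm) auto
    also have "m \<otimes> (m' \<otimes> x [^] i) \<otimes> x [^] i' = (m \<otimes> m') \<otimes> x [^] (i + i')"
      using s s' x by (simp add: m_assoc nat_pow_mult)
    finally show "s \<otimes> s' \<in> S" using s s' by (auto simp: S_def)
  qed
  have "card M < card S"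
    using x MS xS subgroup.subset[OF S] fin by (intro psubset_card_mono) (auto intro: finite_subset)
  then have SG: "S = carrier G" using max[OF S] by linarith
  define \<zeta> where "\<zeta> = cis (2 * pi / real p)"
  have \<zeta>p: "\<zeta> ^ p = 1" using prime_gt_0_nat[OF p] by (simp add: \<zeta>_def DeMoivre)
  have \<zeta>1: "\<zeta> \<noteq> 1"
  proof
    assume "\<zeta> = 1"
    have p2: "real p \<ge> 2" using prime_ge_2_nat[OF p] by simp
    have "Re \<zeta> = cos (2 * pi / real p)" by (simp add: \<zeta>_def)
    also have "\<dots> < cos 0"
      using p2 pi_gt_zero by (intro cos_monotone_0_pi) (auto simp: field_simps)
    finally show False using \<open>\<zeta> = 1\<close> by simp
  qed
  have \<zeta>pow: "\<zeta> ^ i = \<zeta> ^ j" if eq: "m \<otimes> x [^] (i::nat) = m' \<otimes> x [^] (j::nat)" and m: "m \<in> M" "m' \<in> M" and "j \<le> i" for m m' i j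
  proof -
    have "m \<otimes> x [^] (i - j) \<otimes> x [^] j = m' \<otimes> x [^] j"
      using eq m x \<open>j \<le> i\<close> by (simp add: m_assoc nat_pow_mult)
    then have "m \<otimes> x [^] (i - j) = m'" using m x by simp
    then have "x [^] (i - j) = inv m \<otimes> m'" using m x by (auto simp: inv_cancel_left)
    then have "p dvd i - j" using xM m by simp
    then obtain c where "i - j = p * c" by auto
    then have "i = j + p * c" using \<open>j \<le> i\<close> by simp
    then show ?thesis using \<zeta>p by (simp add: power_add power_mult)
  qed
  then have \<zeta>pow': "\<zeta> ^ i = \<zeta> ^ j" if "m \<otimes> x [^] (i::nat) = m' \<otimes> x [^] (j::nat)" "m \<in> M" "m' \<in> M" for m m' i j
    using that by (metis linorder_le_cases)
  \<comment> \<open>The chosen exponent is determined only modulo \<open>p\<close>, which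
    \<open>\<zeta>pow'\<close> shows to be enough.\<close>
  define e where "e g = (SOME i::nat. \<exists>m\<in>M. g = m \<otimes> x [^] i)" for g
  define \<beta> where "\<beta> = (\<lambda>g\<in>carrier G. \<zeta> ^ e g)"
  have \<beta>: "\<beta> (m \<otimes> x [^] (i::nat)) = \<zeta> ^ i" if m: "m \<in> M" for m i
  proof -
    have "\<exists>m'\<in>M. m \<otimes> x [^] i = m' \<otimes> x [^] e (m \<otimes> x [^] i)"
      unfolding e_def by (rule someI_ex) (use m in blast)
    then obtain m' where "m' \<in> M" "m \<otimes> x [^] i = m' \<otimes> x [^] e (m \<otimes> x [^] i)" by blast
    from \<zeta>pow'[OF this(2) m this(1)] show ?thesis using m x by (simp add: \<beta>_def)
  qed
  have "\<beta> \<in> lin_chars G"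
  proof (rule lin_charsI)
    fix g g' assume "g \<in> carrier G" "g' \<in> carrier G"
    then have "g \<in> S" "g' \<in> S" using SG by auto
    then obtain m i m' i' where g: "m \<in> M" "g = m \<otimes> x [^] (i::nat)" "m' \<in> M" "g' = m' \<otimes> x [^] (i'::nat)"
      unfolding S_def by blast
    have "g \<otimes> g' = m \<otimes> (x [^] i \<otimes> m') \<otimes> x [^] i'" using g x by (simp add: m_assoc)
    also have "x [^] i \<otimes> m' = m' \<otimes> x [^] i" using g x by (intro comm) auto
    also have "m \<otimes> (m' \<otimes> x [^] i) \<otimes> x [^] i' = (m \<otimes> m') \<otimes> x [^] (i + i')"
      using g x by (simp add: m_assoc nat_pow_mult)
    finally show "\<beta> (g \<otimes> g') = \<beta> g * \<beta> g'" using g by (simp add: \<beta> power_add)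
  qed (auto simp: \<beta>_def \<zeta>_def)
  moreover have "\<beta> x = \<zeta>" using \<beta>[of \<one> 1] x by simp
  ultimately show ?thesis using x \<zeta>1 by metis
qed

section \<open>Groups that are not \<open>p\<close>-nilpotent but all of whose proper quotients are\<close>

lemma (in group) conj_into_imp_conj_inv_into:
  assumes Q: "Q \<subseteq> carrier G" "finite Q" and g: "g \<in> carrier G"
    and conj: "\<And>x. x \<in> Q \<Longrightarrow> g \<otimes> x \<otimes> inv g \<in> Q" and x: "x \<in> Q"
  shows "inv g \<otimes> x \<otimes> g \<in> Q"
proof -
  have inj: "inj_on (\<lambda>x. g \<otimes> x \<otimes> inv g) Q"
    using Q(1) g by (intro inj_onI) (simp add: subset_iff)
  then have "(\<lambda>x. g \<otimes> x \<otimes> inv g) ` Q = Q"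
    using conj by (intro endo_inj_surj[OF Q(2) _ inj]) auto
  then obtain y where y: "y \<in> Q" "x = g \<otimes> y \<otimes> inv g" using x by blast
  have "y \<in> carrier G" using Q(1) y(1) by blast
  then have "inv g \<otimes> x \<otimes> g = y" using g by (simp add: y(2) m_assoc inv_cancel_left)
  then show ?thesis using y by simp
qed

text \<open>This is the normalizer of \<open>Q\<close>. Inclusion of the conjugate suffices because
  an injective self-map of a finite set is onto.\<close>

lemma (in group) subgroup_conj_stabilizer:
  assumes Q: "Q \<subseteq> carrier G" "finite Q"
  shows "subgroup {g \<in> carrier G. \<forall>x\<in>Q. g \<otimes> x \<otimes> inv g \<in> Q} G"
proof (rule subgroupI)
  show "{g \<in> carrier G. \<forall>x\<in>Q. g \<otimes> x \<otimes> inv g \<in> Q} \<noteq> {}"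
    using Q(1) by (auto intro!: exI[of _ \<one>])
  fix g assume g: "g \<in> {g \<in> carrier G. \<forall>x\<in>Q. g \<otimes> x \<otimes> inv g \<in> Q}"
  then show "inv g \<in> {g \<in> carrier G. \<forall>x\<in>Q. g \<otimes> x \<otimes> inv g \<in> Q}"
    using conj_into_imp_conj_inv_into[OF Q, of g] by auto
  fix h assume h: "h \<in> {g \<in> carrier G. \<forall>x\<in>Q. g \<otimes> x \<otimes> inv g \<in> Q}"
  have "g \<otimes> h \<otimes> x \<otimes> inv (g \<otimes> h) = g \<otimes> (h \<otimes> x \<otimes> inv h) \<otimes> inv g" if "x \<in> Q" for x
    using g h that Q(1) by (auto simp: inv_mult_group m_assoc)
  then show "g \<otimes> h \<in> {g \<in> carrier G. \<forall>x\<in>Q. g \<otimes> x \<otimes> inv g \<in> Q}" using g h by auto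
qed auto

text \<open>Any conjugate of \<open>Q\<close> is a \<open>q\<close>-group acting on the left cosets of \<open>Q\<close> in \<open>M\<close>, whose number is prime to \<open>q\<close>;
  a fixed coset conjugates it back into \<open>Q\<close>.\<close>

lemma (in group) frattini:
  assumes fin: "finite (carrier G)" and M: "M \<lhd> G" and Q: "subgroup Q G" "Q \<subseteq> M"
    and q: "prime q" "card Q = q ^ b" "\<not> q dvd card M div card Q" and g: "g \<in> carrier G"
  obtains m where "m \<in> M" "\<And>x. x \<in> Q \<Longrightarrow> (inv m \<otimes> g) \<otimes> x \<otimes> inv (inv m \<otimes> g) \<in> Q"
proof -
  interpret M: normal M G by (rule M)
  interpret Q: subgroup Q G by (rule Q(1))
  interpret MG: group "G\<lparr>carrier := M\<rparr>" using M.subgroup_axioms by (rule subgroup_imp_group)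
  interpret QG: group "G\<lparr>carrier := Q\<rparr>" using Q(1) by (rule subgroup_imp_group)
  define E where "E = (\<lambda>m. m <# Q) ` M"
  have finM: "finite M" using fin M.subset finite_subset by blast
  have QM: "subgroup Q (G\<lparr>carrier := M\<rparr>)" by (rule subgroup_incl[OF Q(1) M.subgroup_axioms Q(2)])
  have "lcosets\<^bsub>G\<lparr>carrier := M\<rparr>\<^esub> Q = E"
    by (auto simp: LCOSETS_def E_def)
  then have "card E * card Q = card M"
    using MG.l_lagrange[OF _ QM] finM by (simp add: Coset.order_def)
  moreover have "card Q > 0" using Q.one_closed finite_subset[OF Q(2) finM] by (metis card_gt_0_iff empty_iff)
  ultimately have "\<not> q dvd card E" using q(3) by (metis nonzero_mult_div_cancel_right less_numeral_extra(3))
  \<comment> \<open>The conjugate of \<open>Q\<close> acts by left multiplication; composing with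
    conjugation by \<open>g\<close> makes \<open>Q\<close> itself the acting group.\<close>
  define a where "a y C = (g \<otimes> y \<otimes> inv g) <# C" for y C
  have gM: "g \<otimes> y \<otimes> inv g \<in> M" if "y \<in> Q" for y
    using M.inv_op_closed2[OF g] Q(2) that by blast
  have a: "a y (m <# Q) = ((g \<otimes> y \<otimes> inv g) \<otimes> m) <# Q" if "y \<in> Q" "m \<in> M" for y m
    unfolding a_def using lcos_m_assoc[OF Q.subset] gM[OF that(1)] that(2) by auto
  have fixpts: "[card E = card {C \<in> E. \<forall>y\<in>carrier (G\<lparr>carrier := Q\<rparr>). a y C = C}] (mod q)"
  proof (rule p_group_fixed_points[where k = b])
    show "group (G\<lparr>carrier := Q\<rparr>)" by (rule QG.is_group)
    show "Coset.order (G\<lparr>carrier := Q\<rparr>) = q ^ b" using q(2) by (simp add: Coset.order_def)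
    show "finite E" using finM by (simp add: E_def)
    show "a y C \<in> E" if "y \<in> carrier (G\<lparr>carrier := Q\<rparr>)" "C \<in> E" for y C
      using that gM by (auto simp: E_def a)
    show "a \<one>\<^bsub>G\<lparr>carrier := Q\<rparr>\<^esub> C = C" if "C \<in> E" for C
      using that g by (auto simp: E_def a)
    show "a (y \<otimes>\<^bsub>G\<lparr>carrier := Q\<rparr>\<^esub> z) C = a y (a z C)"
      if "y \<in> carrier (G\<lparr>carrier := Q\<rparr>)" "z \<in> carrier (G\<lparr>carrier := Q\<rparr>)" "C \<in> E" for y z C
    proof -
      obtain m where m: "m \<in> M" "C = m <# Q" using \<open>C \<in> E\<close> by (auto simp: E_def)
      have yz: "y \<in> Q" "z \<in> Q" using \<open>y \<in> _\<close> \<open>z \<in> _\<close> by auto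
      have "a y (a z C) = ((g \<otimes> y \<otimes> inv g) \<otimes> ((g \<otimes> z \<otimes> inv g) \<otimes> m)) <# Q"
        using yz m gM by (simp add: a)
      also have "(g \<otimes> y \<otimes> inv g) \<otimes> ((g \<otimes> z \<otimes> inv g) \<otimes> m) = (g \<otimes> (y \<otimes> z) \<otimes> inv g) \<otimes> m"
        using yz m g by (simp add: m_assoc inv_cancel_left)
      finally show ?thesis using yz m by (simp add: a)
    qed
  qed (rule q(1))
  have "{C \<in> E. \<forall>y\<in>Q. a y C = C} \<noteq> {}"
  proof
    assume empty: "{C \<in> E. \<forall>y\<in>Q. a y C = C} = {}"
    have "[card E = card {C \<in> E. \<forall>y\<in>Q. a y C = C}] (mod q)" using fixpts by simp
    then have "[card E = 0] (mod q)" unfolding empty by simp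
    then show False using \<open>\<not> q dvd card E\<close> by (simp add: cong_0_iff)
  qed
  then obtain m where m: "m \<in> M" "\<And>y. y \<in> Q \<Longrightarrow> a y (m <# Q) = m <# Q" by (auto simp: E_def)
  have "(inv m \<otimes> g) \<otimes> y \<otimes> inv (inv m \<otimes> g) \<in> Q" if y: "y \<in> Q" for y
  proof -
    have "(g \<otimes> y \<otimes> inv g) \<otimes> m \<in> ((g \<otimes> y \<otimes> inv g) \<otimes> m) <# Q"
      using gM[OF y] m(1) Q(1) by (intro lcos_self) auto
    then have "(g \<otimes> y \<otimes> inv g) \<otimes> m \<in> m <# Q" using a[OF y m(1)] m(2)[OF y] by simp
    then obtain x where x: "x \<in> Q" "(g \<otimes> y \<otimes> inv g) \<otimes> m = m \<otimes> x" by (auto simp: l_coset_def)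
    have "(inv m \<otimes> g) \<otimes> y \<otimes> inv (inv m \<otimes> g) = inv m \<otimes> ((g \<otimes> y \<otimes> inv g) \<otimes> m)"
      using g m(1) y by (simp add: inv_mult_group m_assoc)
    also have "\<dots> = x" using x m(1) by (simp add: inv_cancel_left)
    finally show ?thesis using x by simp
  qed
  then show ?thesis using that m(1) by blast
qed

text \<open>A minimal normal subgroup \<open>N\<close> is a \<open>p\<close>-group, as otherwise the
  complement of \<open>G/N\<close> would lift. Inside that complement \<open>K/N\<close> there is a
  minimal normal subgroup \<open>M/N\<close> of \<open>G/N\<close>, a \<open>q\<close>-group with
  \<open>q\<close> different from \<open>p\<close>. For a Sylow \<open>q\<close>-subgroup
  \<open>Q\<close> of \<open>M\<close> one has M = N Q, and the Frattini argument shows that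
  \<open>N\<close> and the normalizer \<open>L\<close> of \<open>Q\<close> generate
  \<open>G\<close>. As \<open>N\<close> is abelian, the intersection of \<open>N\<close> and
  \<open>L\<close> is normal in \<open>G\<close>; if it were \<open>N\<close>, then \<open>Q\<close>
  would be a normal subgroup of order prime to \<open>p\<close>.\<close>

lemma (in group) minimal_non_p_nilpotent:
  assumes fin: "finite (carrier G)" and solv: "solvable G" and p: "prime p"
    and non: "\<not> p_nilpotent p G"
    and quot: "\<forall>T. T \<lhd> G \<and> T \<noteq> {\<one>} \<longrightarrow> p_nilpotent_mod p G T"
  shows "\<exists>N L. N \<lhd> G \<and> subgroup L G \<and> N \<inter> L = {\<one>} \<and> N <#> L = carrier G \<and> N \<noteq> {\<one>} \<and>
    (\<forall>x\<in>N. \<forall>y\<in>N. x \<otimes> y = y \<otimes> x) \<and> (\<forall>x\<in>N. x [^] p = \<one>) \<and>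
    (\<forall>T. T \<lhd> G \<and> T \<subseteq> N \<longrightarrow> T = {\<one>} \<or> T = N) \<and> (\<exists>x\<in>N. \<exists>g\<in>carrier G. g \<otimes> x \<noteq> x \<otimes> g)"
proof -
  \<comment> \<open>In a \<open>p\<close>-group the trivial subgroup is a normal
    \<open>p\<close>-complement.\<close>
  have ordG: "Coset.order G \<noteq> p ^ j" for j
  proof
    assume j: "Coset.order G = p ^ j"
    have "{\<one>} \<lhd> G" "coprime p (card {\<one>})" "card (rcosets {\<one>}) = p ^ j"
      using one_is_normal card_rcosets_triv[OF fin] j by simp_all
    then show False using non unfolding p_nilpotent_def by blast
  qed
  have "carrier G \<noteq> {\<one>}"
  proof
    assume "carrier G = {\<one>}"
    then have "Coset.order G = p ^ 0" by (simp add: Coset.order_def)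
    then show False using ordG by blast
  qed
  from elementary_abelian_normal_subgroup[OF fin solv normal_self this]
  obtain N r a where r: "prime r" and N: "N \<lhd> G" "N \<noteq> {\<one>}" and a: "card N = r ^ a"
    and comm: "\<forall>x\<in>N. \<forall>y\<in>N. x \<otimes> y = y \<otimes> x" and expo: "\<forall>x\<in>N. x [^] r = \<one>"
    and minN: "\<forall>T. T \<lhd> G \<and> T \<subseteq> N \<longrightarrow> T = {\<one>} \<or> T = N"
    by (elim exE conjE) (rule that)
  interpret N: normal N G by (rule N(1))
  have finN: "finite N" using fin N.subset finite_subset by blast
  have "\<not> coprime p (card N)"
    using coprime_normal_imp_p_nilpotent[OF fin N(1)] quot N non by blast
  then have "r = p"
    using a r p by (metis coprime_power_right_iff primes_coprime)
  obtain K j where K: "K \<lhd> G" "N \<subseteq> K" "coprime p (card K div card N)" "card (rcosets K) = p ^ j"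
    using quot[rule_format, of N] N unfolding p_nilpotent_mod_def by metis
  have Ks: "subgroup K G" using K(1) normal_imp_subgroup by blast
  have "K \<noteq> N"
  proof
    assume "K = N"
    then have "Coset.order G = p ^ (j + a)"
      using lagrange[OF Ks] K(4) a \<open>r = p\<close> by (simp add: power_add)
    then show False using ordG by blast
  qed
  define \<pi> where "\<pi> = (\<lambda>g. N #> g)"
  interpret \<pi>: surj_group_hom G "G Mod N" \<pi>
    using N.surj_group_hom_Mod(1)[OF fin] by (simp add: \<pi>_def)
  have ker: "kernel G (G Mod N) \<pi> = N" using N.surj_group_hom_Mod(2)[OF fin] by (simp add: \<pi>_def)
  have solvQ: "solvable (G Mod N)" using \<pi>.surj_hom_imp_solvable[OF \<pi>.surj solv] .
  have finQ: "finite (carrier (G Mod N))" using \<pi>.surj fin by (metis finite_imageI)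
  have preK: "\<pi>.pre (\<pi> ` K) = K" using \<pi>.pre_image[OF Ks] ker K(2) by simp
  have pre1: "\<pi>.pre {\<one>\<^bsub>G Mod N\<^esub>} = N" using ker by (simp add: \<pi>.pre_def kernel_def)
  have Kbar: "\<pi> ` K \<lhd> G Mod N" by (rule \<pi>.image_normal[OF K(1)])
  have "\<pi> ` K \<noteq> {\<one>\<^bsub>G Mod N\<^esub>}" using preK pre1 \<open>K \<noteq> N\<close> by metis
  from group.elementary_abelian_normal_subgroup[OF \<pi>.H.is_group finQ solvQ Kbar this]
  obtain Mb q b where q: "prime q" and b: "card Mb = q ^ b"
    and Mb: "Mb \<lhd> G Mod N" "Mb \<noteq> {\<one>\<^bsub>G Mod N\<^esub>}" "Mb \<subseteq> \<pi> ` K"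
    by (elim exE conjE) (rule that)
  define M where "M = \<pi>.pre Mb"
  have M: "M \<lhd> G" unfolding M_def by (rule \<pi>.pre_normal[OF Mb(1)])
  interpret M: normal M G by (rule M)
  have Mbc: "Mb \<subseteq> carrier (G Mod N)" using Mb(1) normal_imp_subgroup subgroup.subset by blast
  have Mb1: "\<one>\<^bsub>G Mod N\<^esub> \<in> Mb" using subgroup.one_closed[OF normal_imp_subgroup[OF Mb(1)]] .
  have "\<pi>.pre {\<one>\<^bsub>G Mod N\<^esub>} \<subseteq> M" unfolding M_def using Mb1 by (auto simp only: \<pi>.pre_def)
  then have NM: "N \<subseteq> M" unfolding pre1 .
  have "M \<subseteq> \<pi>.pre (\<pi> ` K)" unfolding M_def \<pi>.pre_def using Mb(3) by blast
  then have MK: "M \<subseteq> K" unfolding preK .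
  have cM: "card M = card N * q ^ b" using \<pi>.card_pre[OF Mbc] ker b by (simp add: M_def)
  have finMb: "finite Mb" using Mbc finQ finite_subset by blast
  have b0: "b \<noteq> 0"
  proof
    assume "b = 0"
    then have "card Mb = 1" using b by simp
    then show False using Mb(2) Mb1 by (metis card_1_singletonE singletonD)
  qed
  have Npos: "card N > 0" using finN N.one_closed by (metis card_gt_0_iff empty_iff)
  \<comment> \<open>The factor q^b of |M| divides |K| / |N|, which is prime to
    \<open>p\<close>.\<close>
  have "q \<noteq> p"
  proof
    assume "q = p"
    have "card M dvd card K" by (rule card_subgroup_dvd[OF M.subgroup_axioms Ks MK])
    then obtain c where "card K = card N * q ^ b * c" using cM by auto
    then have "card K div card N = q ^ b * c" using Npos by (simp add: mult.assoc)
    then have "p dvd card K div card N" using b0 \<open>q = p\<close> by (simp add: dvd_mult2)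
    then show False using K(3) p by (metis coprime_absorb_left not_prime_unit)
  qed
  interpret MG: group "G\<lparr>carrier := M\<rparr>" using M.subgroup_axioms by (rule subgroup_imp_group)
  have finM: "finite M" using fin M.subset finite_subset by blast
  obtain Q where Q': "subgroup Q (G\<lparr>carrier := M\<rparr>)" "card Q = q ^ b"
    using sylow_thm[OF q MG.is_group, of b "card N"] cM finM by (auto simp: Coset.order_def mult.commute)
  have QM: "Q \<subseteq> M" using subgroup.subset[OF Q'(1)] by simp
  have Q: "subgroup Q G" using incl_subgroup[OF M.subgroup_axioms Q'(1)] .
  interpret Q: subgroup Q G by (rule Q)
  have finQ': "finite Q" using finite_subset[OF QM finM] .
  have copq: "coprime p (q ^ b)" using primes_coprime[OF p q] \<open>q \<noteq> p\<close> by simp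
  have NQ: "N \<inter> Q = {\<one>}"
  proof -
    have "x = \<one>" if x: "x \<in> N" "x \<in> Q" for x
    proof -
      interpret QG: group "G\<lparr>carrier := Q\<rparr>" using Q by (rule subgroup_imp_group)
      have "x [^]\<^bsub>G\<lparr>carrier := Q\<rparr>\<^esub> (q ^ b) = \<one>" using QG.pow_order_eq_1[of x] x Q'(2) by (simp add: Coset.order_def)
      then have "x [^] (q ^ b) = \<one>" by (simp add: nat_pow_consistent[symmetric])
      then show ?thesis
        using pow_coprime_eq_one[OF _ _ _ copq, of x] expo x \<open>r = p\<close> by simp
    qed
    then show ?thesis by auto
  qed
  have MNQ: "\<exists>n\<in>N. \<exists>x\<in>Q. m = n \<otimes> x" if "m \<in> M" for m
  proof -
    \<comment> \<open>\<open>N\<close> and \<open>Q\<close> meet trivially, so the products n x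
      number |N| |Q| = |M| and exhaust \<open>M\<close>.\<close>
    have "inj_on (\<lambda>(n,x). n \<otimes> x) (N \<times> Q)"
    proof (rule inj_onI, clarsimp)
      fix n x n' x' assume h: "n \<in> N" "x \<in> Q" "n' \<in> N" "x' \<in> Q" "n \<otimes> x = n' \<otimes> x'"
      have "inv n' \<otimes> n = inv n' \<otimes> (n \<otimes> x) \<otimes> inv x" using h(1-4) by (simp add: m_assoc)
      also have "\<dots> = x' \<otimes> inv x" unfolding h(5) using h(1-4) by (simp add: m_assoc inv_cancel_left)
      finally have eq: "inv n' \<otimes> n = x' \<otimes> inv x" .
      have "inv n' \<otimes> n \<in> N" "x' \<otimes> inv x \<in> Q" using h by auto
      then have one: "inv n' \<otimes> n = \<one>" using eq NQ by auto
      then have "n = n'" using h by (metis N.mem_carrier inv_cancel_left(1) r_one)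
      moreover have "x = x'" using h(1,2,4,5) \<open>n = n'\<close> by simp
      ultimately show "n = n' \<and> x = x'" by simp
    qed
    then have "card ((\<lambda>(n,x). n \<otimes> x) ` (N \<times> Q)) = card M"
      using cM Q'(2) by (simp add: card_image card_cartesian_product)
    moreover have "(\<lambda>(n,x). n \<otimes> x) ` (N \<times> Q) \<subseteq> M" using NM QM by auto
    ultimately have "(\<lambda>(n,x). n \<otimes> x) ` (N \<times> Q) = M" using card_subset_eq[OF finM] by blast
    then show ?thesis using that by auto
  qed
  define L where "L = {g \<in> carrier G. \<forall>x\<in>Q. g \<otimes> x \<otimes> inv g \<in> Q}"
  have L: "subgroup L G" unfolding L_def by (rule subgroup_conj_stabilizer[OF Q.subset finQ'])
  interpret L: subgroup L G by (rule L)
  have L_I: "g \<in> L" if "g \<in> carrier G" "\<And>x. x \<in> Q \<Longrightarrow> g \<otimes> x \<otimes> inv g \<in> Q" for g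
    using that unfolding L_def by blast
  have QL: "Q \<subseteq> L" using L_I by auto
  have NL: "\<exists>n\<in>N. \<exists>l\<in>L. g = n \<otimes> l" if g: "g \<in> carrier G" for g
  proof -
    have "card M div card Q = p ^ a" using cM Q'(2) a \<open>r = p\<close> Npos finQ' Q.one_closed q
      by (simp add: prime_gt_0_nat)
    moreover have "\<not> q dvd p ^ a" using \<open>q \<noteq> p\<close> p q by (metis prime_dvd_power primes_dvd_imp_eq)
    ultimately have "\<not> q dvd card M div card Q" by simp
    from frattini[OF fin M Q QM q Q'(2) this g]
    obtain m where m: "m \<in> M" "\<And>x. x \<in> Q \<Longrightarrow> (inv m \<otimes> g) \<otimes> x \<otimes> inv (inv m \<otimes> g) \<in> Q" by blast
    have mg: "inv m \<otimes> g \<in> L" using m g by (intro L_I) auto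
    obtain n x where nx: "n \<in> N" "x \<in> Q" "m = n \<otimes> x" using MNQ[OF m(1)] by blast
    have "g = n \<otimes> (x \<otimes> (inv m \<otimes> g))"
      unfolding nx(3) using nx(1,2) g by (simp add: inv_mult_group m_assoc inv_cancel_left)
    moreover have "x \<otimes> (inv m \<otimes> g) \<in> L" using mg nx(2) QL by auto
    ultimately show ?thesis using nx(1) by blast
  qed
  have Cnormal: "N \<inter> L \<lhd> G"
  proof (rule normal_invI)
    show "subgroup (N \<inter> L) G" by (rule subgroups_Inter_pair[OF N.subgroup_axioms L])
    fix g c assume g: "g \<in> carrier G" and c: "c \<in> N \<inter> L"
    obtain n l where nl: "n \<in> N" "l \<in> L" "g = n \<otimes> l" using NL[OF g] by blast
    have d: "l \<otimes> c \<otimes> inv l \<in> N \<inter> L" using c nl N.inv_op_closed2 by auto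
    have "g \<otimes> c \<otimes> inv g = n \<otimes> (l \<otimes> c \<otimes> inv l) \<otimes> inv n"
      using nl c by (simp add: inv_mult_group m_assoc)
    \<comment> \<open>Commutativity of \<open>N\<close> removes the conjugation by \<open>n\<close>,
      so conjugation by \<open>g\<close> acts here as conjugation by \<open>l\<close>.\<close>
    also have "n \<otimes> (l \<otimes> c \<otimes> inv l) = (l \<otimes> c \<otimes> inv l) \<otimes> n" using comm d nl(1) by blast
    also have "(l \<otimes> c \<otimes> inv l) \<otimes> n \<otimes> inv n = l \<otimes> c \<otimes> inv l" using nl c by (simp add: m_assoc)
    finally show "g \<otimes> c \<otimes> inv g \<in> N \<inter> L" using d by simp
  qed
  have "N \<inter> L \<noteq> N"
  proof
    assume "N \<inter> L = N"
    then have "carrier G \<subseteq> L" using NL by blast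
    then have "Q \<lhd> G" using Q unfolding L_def by (intro normal_invI) blast+
    moreover have "Q \<noteq> {\<one>}"
    proof
      assume "Q = {\<one>}"
      then have "q ^ b = 1" using Q'(2) by simp
      then show False using b0 prime_gt_1_nat[OF q] by simp
    qed
    ultimately have "p_nilpotent p G"
      using coprime_normal_imp_p_nilpotent[OF fin, of Q p] quot copq Q'(2) by simp
    then show False using non by simp
  qed
  then have NL1: "N \<inter> L = {\<one>}" using minN Cnormal by blast
  have noncentral: "\<exists>x\<in>N. \<exists>g\<in>carrier G. g \<otimes> x \<noteq> x \<otimes> g"
  proof (rule ccontr)
    assume "\<not> ?thesis"
    then have c: "g \<otimes> x = x \<otimes> g" if "x \<in> N" "g \<in> carrier G" for x g using that by blast
    have "n \<in> L" if n: "n \<in> N" for n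
    proof -
      have "n \<otimes> x \<otimes> inv n = x" if "x \<in> Q" for x
        using c[OF n, of x] n that by (simp add: c[OF n, symmetric] m_assoc)
      then show ?thesis using n by (intro L_I) auto
    qed
    then have "N \<subseteq> {\<one>}" using NL1 by blast
    then show False using N(2) N.one_closed by blast
  qed
  have "N <#> L = carrier G"
  proof
    show "N <#> L \<subseteq> carrier G" by (rule setmult_subset_G[OF N.subset L.subset])
    show "carrier G \<subseteq> N <#> L" using NL unfolding set_mult_def by blast
  qed
  then show ?thesis
    using N L NL1 comm expo[unfolded \<open>r = p\<close>] minN noncentral by blast
qed

text \<open>\<open>R\<close> is chosen of greatest order among the normal subgroups with
  non-\<open>p\<close>-nilpotent quotient, so \<open>minimal_non_p_nilpotent\<close> applies to
  \<open>G Mod R\<close>, and its conclusions are pulled back to \<open>G\<close>. For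
  \<open>inv_triv\<close>, the kernel of an invariant character is normal in \<open>G\<close> and
  hence is \<open>R\<close> or the whole of \<open>N'\<close>; the first would make the section
  central.\<close>

lemma split_mod_prime_exists:
  fixes G :: "('a, 'b) monoid_scheme" (structure)
  assumes "group G" and fin: "finite (carrier G)" and solv: "solvable G" and p: "prime p"
    and non: "\<not> p_nilpotent p G"
  shows "\<exists>N R L. split_mod_prime G N R L p"
proof -
  interpret group G by fact
  have "\<not> p_nilpotent_mod p G {\<one>}" using non by (simp add: p_nilpotent_mod_one)
  then have "\<exists>R. (R \<lhd> G \<and> \<not> p_nilpotent_mod p G R) \<and>
      (\<forall>T. T \<lhd> G \<and> \<not> p_nilpotent_mod p G T \<longrightarrow> card T \<le> card R)"
    using one_is_normal fin
    by (intro ex_has_greatest_nat[of _ "{\<one>}" _ "Suc (card (carrier G))"])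
      (auto simp: less_Suc_eq_le intro: card_mono dest: subgroup.subset normal_imp_subgroup)
  then obtain R where R: "R \<lhd> G" "\<not> p_nilpotent_mod p G R"
    and max: "\<And>T. T \<lhd> G \<Longrightarrow> \<not> p_nilpotent_mod p G T \<Longrightarrow> card T \<le> card R" by blast
  interpret R: normal R G by (rule R(1))
  define H where "H = G Mod R"
  define \<pi> where "\<pi> = (\<lambda>g. R #> g)"
  interpret \<pi>: surj_group_hom G H \<pi>
    using R.surj_group_hom_Mod(1)[OF fin] by (simp add: \<pi>_def H_def)
  have ker: "kernel G H \<pi> = R" using R.surj_group_hom_Mod(2)[OF fin] by (simp add: \<pi>_def H_def)
  have kerD: "\<pi> g = \<one>\<^bsub>H\<^esub> \<longleftrightarrow> g \<in> R" if "g \<in> carrier G" for g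
    using ker that by (auto simp: kernel_def)
  have pre1: "\<pi>.pre {\<one>\<^bsub>H\<^esub>} = R" using ker by (simp add: \<pi>.pre_def kernel_def)
  have finR: "finite R" using fin R.subset finite_subset by blast
  have Rpos: "card R > 0" using finR R.one_closed by (metis card_gt_0_iff empty_iff)
  have nonH: "\<not> p_nilpotent p H"
    using \<pi>.p_nilpotent_mod_pre[OF \<pi>.H.one_is_normal, of p] pre1 R(2) \<pi>.H.p_nilpotent_mod_one[of p] by simp
  have quotH: "\<forall>T. T \<lhd> H \<and> T \<noteq> {\<one>\<^bsub>H\<^esub>} \<longrightarrow> p_nilpotent_mod p H T"
  proof (intro allI impI, elim conjE, rule ccontr)
    fix T assume T: "T \<lhd> H" "T \<noteq> {\<one>\<^bsub>H\<^esub>}" and "\<not> p_nilpotent_mod p H T"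
    then have "\<not> p_nilpotent_mod p G (\<pi>.pre T)" using \<pi>.p_nilpotent_mod_pre[OF T(1)] by simp
    from max[OF \<pi>.pre_normal[OF T(1)] this]
    \<comment> \<open>The preimage of \<open>T\<close> has order |R| |T|, so maximality of |R|
      forces \<open>T\<close> to be trivial.\<close>
    have "card R * card T \<le> card R"
      using \<pi>.card_pre[of T] ker subgroup.subset[OF normal_imp_subgroup[OF T(1)]] by simp
    then have "card T \<le> 1" using Rpos by simp
    moreover have T1: "\<one>\<^bsub>H\<^esub> \<in> T" using subgroup.one_closed[OF normal_imp_subgroup[OF T(1)]] .
    moreover have "finite T"
      using subgroup.subset[OF normal_imp_subgroup[OF T(1)]] \<pi>.surj fin by (metis finite_imageI finite_subset)
    ultimately have "T = {\<one>\<^bsub>H\<^esub>}" by (metis card_le_Suc0_iff_eq One_nat_def singletonI subsetI subset_antisym empty_subsetI insert_subset singleton_iff)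
    then show False using T(2) by simp
  qed
  have solvH: "solvable H" using \<pi>.surj_hom_imp_solvable[OF \<pi>.surj solv] .
  have finH: "finite (carrier H)" using \<pi>.surj fin by (metis finite_imageI)
  obtain N L where N: "N \<lhd> H" and L: "subgroup L H" and NL: "N \<inter> L = {\<one>\<^bsub>H\<^esub>}" "N <#>\<^bsub>H\<^esub> L = carrier H"
    and N1: "N \<noteq> {\<one>\<^bsub>H\<^esub>}" and comm: "\<forall>x\<in>N. \<forall>y\<in>N. x \<otimes>\<^bsub>H\<^esub> y = y \<otimes>\<^bsub>H\<^esub> x"
    and expo: "\<forall>x\<in>N. x [^]\<^bsub>H\<^esub> p = \<one>\<^bsub>H\<^esub>"
    and min: "\<forall>T. T \<lhd> H \<and> T \<subseteq> N \<longrightarrow> T = {\<one>\<^bsub>H\<^esub>} \<or> T = N"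
    and noncentral: "\<exists>x\<in>N. \<exists>g\<in>carrier H. g \<otimes>\<^bsub>H\<^esub> x \<noteq> x \<otimes>\<^bsub>H\<^esub> g"
    using \<pi>.H.minimal_non_p_nilpotent[OF finH solvH p nonH quotH] by (elim exE conjE) (rule that)
  have Nc: "N \<subseteq> carrier H" using subgroup.subset[OF normal_imp_subgroup[OF N]] .
  have Ns: "subgroup N H" using N normal_imp_subgroup by blast
  define N' L' where "N' = \<pi>.pre N" and "L' = \<pi>.pre L"
  have N': "N' \<lhd> G" unfolding N'_def by (rule \<pi>.pre_normal[OF N])
  have N'_iff: "n \<in> N' \<longleftrightarrow> n \<in> carrier G \<and> \<pi> n \<in> N" for n by (simp add: N'_def \<pi>.pre_def)
  have RN': "R \<subseteq> N'" unfolding N'_def pre1[symmetric]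
    using subgroup.one_closed[OF Ns] by (auto simp: \<pi>.pre_def)
  interpret N': normal N' G by (rule N')
  interpret split_mod G N' R L'
  proof (intro split_mod.intro split_mod_axioms.intro is_group)
    show "finite (carrier G)" by (rule fin)
    show "N' \<lhd> G" by (rule N')
    show "R \<lhd> G" by (rule R(1))
    show "subgroup L' G" unfolding L'_def by (rule \<pi>.pre_subgroup[OF L])
    show "N' \<inter> L' = R" unfolding N'_def L'_def pre1[symmetric] using NL(1) by (auto simp: \<pi>.pre_def)
    show "N' <#> L' = carrier G"
    proof
      show "N' <#> L' \<subseteq> carrier G"
        unfolding N'_def L'_def \<pi>.pre_def by (rule setmult_subset_G) blast+
      show "carrier G \<subseteq> N' <#> L'"
      proof
        fix g assume g: "g \<in> carrier G"
        then have "\<pi> g \<in> N <#>\<^bsub>H\<^esub> L" using NL(2) by simp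
        then obtain n l where nl: "n \<in> N" "l \<in> L" "\<pi> g = n \<otimes>\<^bsub>H\<^esub> l" by (auto simp: set_mult_def)
        have "n \<in> \<pi> ` carrier G" unfolding \<pi>.surj using nl(1) Nc by auto
        then obtain m where m: "m \<in> carrier G" "\<pi> m = n" by auto
        have lc: "l \<in> carrier H" using nl(2) L subgroup.mem_carrier by metis
        have nc: "n \<in> carrier H" using nl(1) Nc by auto
        have "\<pi> (inv m \<otimes> g) = inv\<^bsub>H\<^esub> n \<otimes>\<^bsub>H\<^esub> (n \<otimes>\<^bsub>H\<^esub> l)" using m g nl(3) by simp
        also have "\<dots> = l" using nc lc by (simp add: \<pi>.H.inv_cancel_left)
        finally have "inv m \<otimes> g \<in> L'" using m(1) g nl(2) unfolding L'_def \<pi>.pre_def by simp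
        moreover have "m \<in> N'" using m nl(1) unfolding N'_iff by simp
        moreover have "g = m \<otimes> (inv m \<otimes> g)" using m(1) g by (simp add: inv_cancel_left)
        ultimately show "g \<in> N' <#> L'" unfolding set_mult_def by blast
      qed
    qed
  qed
  have "split_mod_prime G N' R L' p"
  proof (intro split_mod_prime.intro split_mod_axioms split_mod_prime_axioms.intro)
    show "prime p" by (rule p)
    show "n [^] p \<in> R" if n: "n \<in> N'" for n
    proof -
      have nc: "n \<in> carrier G" "\<pi> n \<in> N" using n unfolding N'_iff by simp_all
      then have "\<pi> (n [^] p) = \<one>\<^bsub>H\<^esub>" using expo by (simp add: \<pi>.hom_nat_pow)
      then show ?thesis using kerD[of "n [^] p"] nc by simp
    qed
    show "\<nu> = (\<lambda>n\<in>N'. 1)" if \<nu>: "\<nu> \<in> X" and inv: "\<And>g. g \<in> carrier G \<Longrightarrow> act g \<nu> = \<nu>" for \<nu>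
    proof -
      have conj: "\<nu> (inv g \<otimes> n \<otimes> g) = \<nu> n" if "g \<in> carrier G" "n \<in> N'" for g n
        using fun_cong[OF inv[OF that(1)], of n] that(2) by (simp add: act_def)
      have conj': "\<nu> (g \<otimes> n \<otimes> inv g) = \<nu> n" if "g \<in> carrier G" "n \<in> N'" for g n
        using conj[of "inv g" n] that by simp
      define T where "T = {n \<in> N'. \<nu> n = 1}"
      have T: "T \<lhd> G"
      proof (rule normal_invI)
        show "subgroup T G"
          by (rule subgroupI) (auto simp: T_def X_D[OF \<nu>] intro!: exI[of _ \<one>])
        show "g \<otimes> n \<otimes> inv g \<in> T" if "g \<in> carrier G" "n \<in> T" for g n
          using that conj'[of g n] N'.inv_op_closed2[of g n] by (simp add: T_def)
      qed
      have RT: "R \<subseteq> T" using RN' X_D(4)[OF \<nu>] by (auto simp: T_def)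
      have preT: "\<pi>.pre (\<pi> ` T) = T" using \<pi>.pre_image[OF normal_imp_subgroup[OF T]] ker RT by simp
      have "\<pi> ` T \<subseteq> N" unfolding T_def N'_iff by blast
      then consider "\<pi> ` T = {\<one>\<^bsub>H\<^esub>}" | "\<pi> ` T = N" using min \<pi>.image_normal[OF T] by blast
      then have "T = N'"
      proof cases
        case 1
        then have TR: "T = R" using preT pre1 by metis
        have "g \<otimes>\<^bsub>H\<^esub> x = x \<otimes>\<^bsub>H\<^esub> g" if gx: "x \<in> N" "g \<in> carrier H" for x g
        proof -
          have "x \<in> \<pi> ` carrier G" "g \<in> \<pi> ` carrier G" unfolding \<pi>.surj using gx Nc by auto
          then obtain n h where nh: "n \<in> carrier G" "\<pi> n = x" "h \<in> carrier G" "\<pi> h = g" by auto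
          have n: "n \<in> N'" using nh gx unfolding N'_iff by simp
          have hn: "h \<otimes> n \<otimes> inv h \<in> N'" using N'.inv_op_closed2[OF nh(3) n] .
          \<comment> \<open>Invariance of \<open>\<nu>\<close> kills all commutators of
            \<open>G\<close> with \<open>N'\<close>; if the kernel is \<open>R\<close>, they become
            trivial in \<open>H\<close>.\<close>
          have "\<nu> ((h \<otimes> n \<otimes> inv h) \<otimes> inv n) = 1"
            using X_D[OF \<nu>] hn n conj'[OF nh(3) n] by simp
          then have "(h \<otimes> n \<otimes> inv h) \<otimes> inv n \<in> R" unfolding TR[symmetric] using hn n by (simp add: T_def)
          moreover have "(h \<otimes> n \<otimes> inv h) \<otimes> inv n \<in> carrier G" using nh by simp
          ultimately have "\<pi> ((h \<otimes> n \<otimes> inv h) \<otimes> inv n) = \<one>\<^bsub>H\<^esub>" using kerD by blast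
          then have "(g \<otimes>\<^bsub>H\<^esub> x \<otimes>\<^bsub>H\<^esub> inv\<^bsub>H\<^esub> g) \<otimes>\<^bsub>H\<^esub> inv\<^bsub>H\<^esub> x = \<one>\<^bsub>H\<^esub>" using nh by simp
          moreover have xc: "x \<in> carrier H" using gx Nc by auto
          ultimately have "g \<otimes>\<^bsub>H\<^esub> x \<otimes>\<^bsub>H\<^esub> inv\<^bsub>H\<^esub> g = x"
            using gx by (metis \<pi>.H.inv_closed \<pi>.H.inv_equality \<pi>.H.inv_inv \<pi>.H.m_closed)
          then show ?thesis using gx xc by (metis \<pi>.H.inv_closed \<pi>.H.inv_solve_right' \<pi>.H.m_closed)
        qed
        then show ?thesis using noncentral by blast
      next
        case 2
        then show ?thesis using preT by (simp add: N'_def)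
      qed
      then have "\<nu> n = 1" if "n \<in> N'" for n using that by (auto simp: T_def)
      then show ?thesis using X_D(1)[OF \<nu>] by (auto simp: fun_eq_iff extensional_def)
    qed
    show "\<exists>\<mu>\<in>X. \<mu> \<noteq> (\<lambda>n\<in>N'. 1)"
    proof -
      interpret NH: group "H\<lparr>carrier := N\<rparr>" using Ns by (rule \<pi>.H.subgroup_imp_group)
      have "\<exists>\<beta>\<in>lin_chars (H\<lparr>carrier := N\<rparr>). \<exists>x\<in>carrier (H\<lparr>carrier := N\<rparr>). \<beta> x \<noteq> 1"
      proof (rule NH.lin_char_exists[OF _ _ p])
        show "x [^]\<^bsub>H\<lparr>carrier := N\<rparr>\<^esub> p = \<one>\<^bsub>H\<lparr>carrier := N\<rparr>\<^esub>" if "x \<in> carrier (H\<lparr>carrier := N\<rparr>)" for x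
          using that expo by (simp add: \<pi>.H.nat_pow_consistent[symmetric])
      qed (use finite_subset[OF Nc finH] comm N1 in simp_all)
      then obtain \<beta> x where \<beta>: "\<beta> \<in> lin_chars (H\<lparr>carrier := N\<rparr>)" "x \<in> N" "\<beta> x \<noteq> 1"
        by auto
      \<comment> \<open>A nontrivial character of the section, inflated to
        \<open>N'\<close>.\<close>
      define \<mu> where "\<mu> = (\<lambda>n\<in>N'. \<beta> (\<pi> n))"
      have \<pi>N: "\<pi> n \<in> N" "n \<in> carrier G" if "n \<in> N'" for n using that unfolding N'_iff by simp_all
      have "\<mu> \<in> X"
      proof (rule X_I)
        show "\<mu> n \<noteq> 0" if "n \<in> N'" for n using that \<pi>N lin_charsD(2)[OF \<beta>(1)] by (simp add: \<mu>_def)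
        show "\<mu> (n \<otimes> m) = \<mu> n * \<mu> m" if "n \<in> N'" "m \<in> N'" for n m
          using that \<pi>N lin_charsD(3)[OF \<beta>(1), of "\<pi> n" "\<pi> m"] by (simp add: \<mu>_def)
        show "\<mu> r = 1" if "r \<in> R" for r
          using that RN' kerD[of r] NH.lin_char_one[OF \<beta>(1)] by (auto simp: \<mu>_def)
      qed (simp add: \<mu>_def)
      moreover obtain n where "n \<in> N'" "\<mu> n \<noteq> 1"
      proof -
        have "x \<in> \<pi> ` carrier G" unfolding \<pi>.surj using \<beta>(2) Nc by auto
        then obtain n where "n \<in> carrier G" "\<pi> n = x" by auto
        then show ?thesis using that[of n] \<beta> N'_iff[of n] by (simp add: \<mu>_def)
      qed
      ultimately show ?thesis by (metis restrict_apply')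
    qed
  qed
  then show ?thesis by blast
qed

section \<open>The cyclotomic field and the conclusion\<close>

text \<open>These are the closure properties that \<open>weighted_degree_sum_nonneg\<close> asks of
  \<open>k\<close>; the last holds because every \<open>m\<close>th root of unity is a power of the
  generator.\<close>

lemma cyclotomic_field_closed:
  shows "0 \<in> cyclotomic_field m" "1 \<in> cyclotomic_field m"
    and "\<And>x y. x \<in> cyclotomic_field m \<Longrightarrow> y \<in> cyclotomic_field m \<Longrightarrow> x + y \<in> cyclotomic_field m"
    and "\<And>x y. x \<in> cyclotomic_field m \<Longrightarrow> y \<in> cyclotomic_field m \<Longrightarrow> x * y \<in> cyclotomic_field m"
    and "\<And>z. m > 0 \<Longrightarrow> z ^ m = 1 \<Longrightarrow> z \<in> cyclotomic_field m"
proof -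
  show one: "1 \<in> cyclotomic_field m"
    unfolding cyclotomic_field_def using generate_field.one[of class_ring] by simp
  show add: "x + y \<in> cyclotomic_field m" if "x \<in> cyclotomic_field m" "y \<in> cyclotomic_field m" for x y
    using generate_field.eng_add[of _ class_ring] that unfolding cyclotomic_field_def by fastforce
  show mult: "x * y \<in> cyclotomic_field m" if "x \<in> cyclotomic_field m" "y \<in> cyclotomic_field m" for x y
    using generate_field.eng_mult[of _ class_ring] that unfolding cyclotomic_field_def by fastforce
  have "\<zero>\<^bsub>class_ring\<^esub> \<in> cyclotomic_field m"
    unfolding cyclotomic_field_def by (rule field.zero_in_generate[OF class_field])
  then show "0 \<in> cyclotomic_field m" by simp
  fix z :: complex assume m: "m > 0" and z: "z ^ m = 1"
  have \<zeta>: "cis (2 * pi / real m) \<in> cyclotomic_field m"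
    unfolding cyclotomic_field_def by (rule generate_field.incl) simp
  have "cis (2 * pi / real m) ^ k \<in> cyclotomic_field m" for k :: nat
    by (induction k) (auto simp: one \<zeta> mult)
  moreover obtain k where "z = cis (2 * pi * real k / real m)"
    using bij_betw_roots_unity[OF m] z unfolding bij_betw_def by blast
  then have "z = cis (2 * pi / real m) ^ k" by (simp add: DeMoivre mult_ac)
  ultimately show "z \<in> cyclotomic_field m" by simp
qed

theorem theorem1p4:
  fixes G :: "('a, 'b) monoid_scheme" and p :: nat
  assumes "group G" and "finite (carrier G)" and "solvable G"
    and "prime p" and "odd p"
    and "acd_over_p' (cyclotomic_field p) p G < 2 * (real p + 1) / (real p + 3) \<or>
         acd_over (cyclotomic_field p) G < 2 * (real p + 1) / (real p + 3)"
  shows "p_nilpotent p G"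
proof (rule ccontr)
  assume non: "\<not> p_nilpotent p G"
  obtain N R L where "split_mod_prime G N R L p"
    using split_mod_prime_exists[OF assms(1-4) non] by blast
  then interpret split_mod_prime G N R L p .
  define k where "k = cyclotomic_field p"
  define c where "c = 2 * (real p + 1) / (real p + 3)"
  have "average_degree G J \<ge> c" if J: "Irr_over_p' k p G \<subseteq> J" "J \<subseteq> Irr_over k G" for J
  proof -
    define n where "n = real (card J)"
    have finJ: "finite J" using J(2) finite_Irr[OF is_group fin] by (auto simp: Irr_over_def intro: finite_subset)
    \<comment> \<open>The trivial character makes \<open>J\<close> nonempty, so that the average has
      a positive denominator.\<close>
    have "(\<lambda>g\<in>carrier G. 1) \<in> J"
    proof -
      have "(\<lambda>g\<in>carrier G. 1) \<in> {\<chi> \<in> Irr G. char_degree G \<chi> = 1}"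
        using lin_chars_trivial[OF is_monoid] degree_one_Irr[OF is_group] by blast
      then have "(\<lambda>g\<in>carrier G. 1) \<in> Irr_over_p' k p G"
        using prime_gt_1_nat[OF p] cyclotomic_field_closed(2)[of p]
        by (auto simp: Irr_over_p'_def Irr_over_def k_def)
      then show ?thesis using J(1) by blast
    qed
    then have n: "n > 0" using finJ by (auto simp: n_def card_gt_0_iff)
    have "0 \<le> (\<Sum>\<chi>\<in>J. (real p + 3) * real (char_degree G \<chi>) - 2 * (real p + 1))"
      using cyclotomic_field_closed(5)[where m = p] prime_gt_0_nat[OF p] J
      by (intro weighted_degree_sum_nonneg[OF cyclotomic_field_closed(1-4)[where m = p]]) (auto simp: k_def)
    also have "\<dots> = (real p + 3) * (\<Sum>\<chi>\<in>J. real (char_degree G \<chi>)) - n * (2 * (real p + 1))"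
      by (simp add: sum_subtractf sum_distrib_left n_def)
    finally have "2 * (real p + 1) * n \<le> (\<Sum>\<chi>\<in>J. real (char_degree G \<chi>)) * (real p + 3)"
      by (simp add: mult.commute)
    then show ?thesis
      using n by (simp add: average_degree_def c_def n_def[symmetric] frac_le_eq divide_le_eq le_divide_eq mult.commute)
  qed
  from this[of "Irr_over_p' k p G"] this[of "Irr_over k G"] show False
    using assms(6) by (auto simp: acd_over_p'_def acd_over_def k_def c_def Irr_over_p'_def)
qed

end
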